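(* For every $s\in\mathcal S$, $\epsilon>0$ and $\delta>0$ there exists a $\delta'=\delta'(\epsilon,\delta)\in(0,1)$, depending on $\epsilon$ and $\delta$, such that the output $\widehat V(s)$ of $\mathrm{SmoothCruiser}(s,\epsilon,\delta')$ satisfies $$\mathbb P\left[\,|\widehat V(s)-V(s)|>\epsilon\,\right]\le\delta ,$$ and such that, $n(\epsilon,\delta')$ denoting the number of oracle calls made by $\mathrm{SmoothCruiser}(s,\epsilon,\delta')$, for every $c>0$ one has $n(\epsilon,\delta'(\epsilon,\delta))=\mathcal O(1/\epsilon^{4+c})$ as $\epsilon\to0$ (with $\delta$ fixed).
   Context: Setting. $\mathcal S$ is a set of states of arbitrary cardinality, $\mathcal A$ a finite set of actions with $|\mathcal A|=K$, $P(\cdot|s,a)$ a transition probability on $\mathcal S$ for each $(s,a)$, $R(s,a)\in[0,1]$ a (possibly random) reward, $\gamma\in(0,1)$ the discount factor, $\lambda>0$ a regularization parameter, and $L=1/\lambda$. (Two-player turn-based zero-sum games are included by letting the state record whose turn it is.) For each state $s$, $F_s:\mathbb R^K\to\mathbb R$ is either $F_s(x)=\lambda\log\sum_{i=1}^K e^{x_i/\lambda}$ (all states in an MDP, maximizer's states in a game) or $F_s(x)=-\lambda\log\sum_{i=1}^K e^{-x_i/\lambda}$ (minimizer's states in a game). The gradient $\nabla F_s(Q)$ is always a probability vector on $\mathcal A$. The entropy-regularized value function $V$ is the bounded function on $\mathcal S$ satisfying $V(s)=F_s(Q_s)$, where $Q_s(a)=\mathbb E[R(s,a)+\gamma V(z)]$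 with $z\sim P(\cdot|s,a)$. The oracle, called with $(s,a)$, returns a fresh independent sample $(R,Z)$ with $Z\sim P(\cdot|s,a)$ and $R$ distributed as $R(s,a)$. Constants: $M_\lambda=\sup_s|F_s(0)|=\lambda\log K$ and $\kappa=(1-\sqrt\gamma)/(KL)$; $\delta'\in(0,1)$ is a global parameter, and $$N(\epsilon)=\left\lceil \frac{18(1+M_\lambda)^2}{(1-\gamma)^4(1-\sqrt\gamma)^2}\,\frac{\log(2K/\delta')}{\epsilon^2}\right\rceil .$$ Algorithm. $\mathrm{SmoothCruiser}(s,\epsilon,\delta')$ computes $\widehat Q_s=\mathrm{estimateQ}(s,\epsilon)$ and outputs $\widehat V(s)=F_s(\widehat Q_s)$. The two procedures below call each other recursively, every call using fresh independent randomness. $\mathrm{estimateQ}(s,\epsilon)$: for each $a\in\mathcal A$ and $i=1,\dots,N(\epsilon)$, call the oracle at $(s,a)$ to get $(R,Z)$, compute $\widehat V=\mathrm{sampleV}(Z,\epsilon/\sqrt\gamma)$ and set $q_i=R+\gamma\widehat V$; then let $\widehat Q_s(a)$ be the mean of $q_1,\dots,q_{N(\epsilon)}$ clipped to the interval $[0,(1+M_\lambda)/(1-\gamma)]$. Output $\widehat Q_s=(\widehat Q_s(a))_{a\in\mathcal A}$. $\mathrm{sampleV}(s,\epsilon)$: (1) if $\epsilon\ge(1+M_\lambda)/(1-\gamma)$, output $0$; (2) otherwise, if $\epsilon\ge\kappa$, compute $\widehat Q_s=\mathrm{estimateQ}(s,\epsilon)$ and output $F_s(\widehat Q_s)$; (3)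 otherwise ($\epsilon<\kappa$), compute $\widehat Q_s=\mathrm{estimateQ}(s,\sqrt{\kappa\epsilon})$, draw an action $A\sim\nabla F_s(\widehat Q_s)$, call the oracle at $(s,A)$ to get $(R,Z)$, compute $\widehat V=\mathrm{sampleV}(Z,\epsilon/\sqrt\gamma)$, and output $F_s(\widehat Q_s)-\widehat Q_s^{\top}\nabla F_s(\widehat Q_s)+(R+\gamma\widehat V)$. The number of oracle calls is deterministic and does not depend on $s$ or on the oracle's outputs.
   Formalization: For games in which some Q_s(a) is negative, estimates are clipped to [-(1+M_λ)/(1-γ), (1+M_λ)/(1-γ)] instead of [0, (1+M_λ)/(1-γ)], as the claim fails with lower end 0; the algorithm is unchanged for all MDPs and for games with Q ≥ 0. *)

theory Defs
  imports "HOL-Probability.Probability" "HOL-Library.Landau_Symbols"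
begin

definition grad :: "('v::real_inner \<Rightarrow> real) \<Rightarrow> 'v \<Rightarrow> 'v" where
  "grad f x = (THE D. GDERIV f x :> D)"

text \<open>
  States are the points of an arbitrary measurable space \<open>S\<close>; a discrete state set is
  \<open>count_space A\<close>, for which every measurability assumption is void.  The minimizer owns the
  states in \<open>Mini\<close> (none in an MDP).  \<open>P s a\<close> is the transition law, \<open>Rew s a\<close> the law of the
  reward, and \<open>Orc s a\<close> the joint law of the pair returned by one oracle call; only its
  marginals are prescribed, so \<open>R\<close> and \<open>Z\<close> may be dependent within a call.
\<close>

locale regularized_game =
  fixes S :: "'s measure"
    and P :: "'s \<Rightarrow> 'a::finite \<Rightarrow> 's measure"
    and Rew :: "'s \<Rightarrow> 'a \<Rightarrow> real measure"
    and Orc :: "'s \<Rightarrow> 'a \<Rightarrow> (real \<times> 's) measure"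
    and Mini :: "'s set"
    and K :: nat
    and \<gamma> lam :: real
  assumes K: "K = CARD('a)"
    and gamma: "0 < \<gamma>" "\<gamma> < 1"
    and lam: "0 < lam"
    and Mini: "Mini \<in> sets S"
    and Orc: "\<And>a. (\<lambda>s. Orc s a) \<in> measurable S (prob_algebra (borel \<Otimes>\<^sub>M S))"
    and Orc_fst: "\<And>s a. s \<in> space S \<Longrightarrow> distr (Orc s a) borel fst = Rew s a"
    and Orc_snd: "\<And>s a. s \<in> space S \<Longrightarrow> distr (Orc s a) S snd = P s a"
    and Rew: "\<And>s a. s \<in> space S \<Longrightarrow> AE r in Rew s a. 0 \<le> r \<and> r \<le> 1"
begin

definition F :: "'s \<Rightarrow> real ^ 'a \<Rightarrow> real" where
  "F s x = (if s \<in> Mini then - lam * ln (\<Sum>i\<in>UNIV. exp (- (x $ i) / lam))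
                        else lam * ln (\<Sum>i\<in>UNIV. exp (x $ i / lam)))"

definition Q :: "('s \<Rightarrow> real) \<Rightarrow> 's \<Rightarrow> real ^ 'a" where
  "Q V s = (\<chi> a. (\<integral>r. r \<partial>Rew s a) + \<gamma> * (\<integral>z. V z \<partial>P s a))"

definition value_function :: "('s \<Rightarrow> real) \<Rightarrow> bool" where
  "value_function V \<longleftrightarrow> V \<in> borel_measurable S \<and> (\<exists>C. \<forall>s\<in>space S. \<bar>V s\<bar> \<le> C) \<and>
     (\<forall>s\<in>space S. V s = F s (Q V s))"

abbreviation L :: real where "L \<equiv> 1 / lam"
abbreviation Mlam :: real where "Mlam \<equiv> lam * ln (real K)"
abbreviation \<kappa> :: real where "\<kappa> \<equiv> (1 - sqrt \<gamma>) / (real K * L)"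
abbreviation qmax :: real where "qmax \<equiv> (1 + Mlam) / (1 - \<gamma>)"

lemma abs_F_0: "\<bar>F s 0\<bar> = Mlam"
proof -
  have "0 \<le> ln (real K)" by (simp add: K Suc_leI)
  then have "0 \<le> Mlam" using lam by simp
  then show ?thesis by (simp add: F_def K)
qed

definition nsamples :: "real \<Rightarrow> real \<Rightarrow> nat" where
  "nsamples \<delta>' \<epsilon> = nat \<lceil>18 * (1 + Mlam)\<^sup>2 / ((1 - \<gamma>) ^ 4 * (1 - sqrt \<gamma>)\<^sup>2) * (ln (2 * real K / \<delta>') / \<epsilon>\<^sup>2)\<rceil>"

text \<open>
  Every procedure denotes the joint law of its output and of the number of oracle calls it makes.
  \<open>backup W s a\<close> is one oracle call at \<open>(s, a)\<close> followed by a run of \<open>W\<close> at the sampled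
  next state.
\<close>

definition backup :: "('s \<Rightarrow> (real \<times> nat) measure) \<Rightarrow> 's \<Rightarrow> 'a \<Rightarrow> (real \<times> nat) measure" where
  "backup W s a = do {
     (r, z) \<leftarrow> Orc s a;
     (v, n) \<leftarrow> W z;
     return (borel \<Otimes>\<^sub>M count_space UNIV) (r + \<gamma> * v, Suc n)
   }"

text \<open>
  The argument \<open>lo\<close> is the lower end of the clipping interval \<open>[lo, qmax]\<close>; see \<open>valid_floor\<close>
  below.  The case \<open>\<epsilon> \<le> 0\<close> only makes the functions total: it is never reached
  from a call with positive accuracy.  The product measure makes all the samples drawn by
  \<open>estimateQ\<close> independent.
\<close>

function sampleV :: "real \<Rightarrow> real \<Rightarrow> real \<Rightarrow> 's \<Rightarrow> (real \<times> nat) measure"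
  and estimateQ :: "real \<Rightarrow> real \<Rightarrow> real \<Rightarrow> 's \<Rightarrow> ((real ^ 'a) \<times> nat) measure" where
  "sampleV lo \<delta>' \<epsilon> s =
    (if \<epsilon> \<le> 0 then undefined
     else if \<epsilon> \<ge> qmax then return (borel \<Otimes>\<^sub>M count_space UNIV) (0, 0)
     else if \<epsilon> \<ge> \<kappa> then do {
       (q, n) \<leftarrow> estimateQ lo \<delta>' \<epsilon> s;
       return (borel \<Otimes>\<^sub>M count_space UNIV) (F s q, n)
     }
     else let W = sampleV lo \<delta>' (\<epsilon> / sqrt \<gamma>) in do {
       (q, n) \<leftarrow> estimateQ lo \<delta>' (sqrt (\<kappa> * \<epsilon>)) s;
       a \<leftarrow> point_measure UNIV (\<lambda>a. ennreal (grad (F s) q $ a));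
       (y, m) \<leftarrow> backup W s a;
       return (borel \<Otimes>\<^sub>M count_space UNIV) (F s q - q \<bullet> grad (F s) q + y, n + m)
     })"
| "estimateQ lo \<delta>' \<epsilon> s =
    (if \<epsilon> \<le> 0 then undefined
     else let N = nsamples \<delta>' \<epsilon>; W = sampleV lo \<delta>' (\<epsilon> / sqrt \<gamma>) in
       distr (\<Pi>\<^sub>M p\<in>UNIV \<times> {1..N}. backup W s (fst p))
         (borel \<Otimes>\<^sub>M count_space UNIV)
         (\<lambda>\<omega>. (\<chi> a. max lo (min qmax ((\<Sum>i=1..N. fst (\<omega> (a, i))) / real N)),
               \<Sum>p\<in>UNIV \<times> {1..N}. snd (\<omega> p))))"
  by pat_completeness auto
termination
proof -
  define B where "B = qmax"
  define h where "h = (\<lambda>\<epsilon>. nat \<lceil>ln (B / \<epsilon>) / - ln (sqrt \<gamma>)\<rceil>)"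
  have sg: "0 < sqrt \<gamma>" "sqrt \<gamma> < 1" using gamma by auto
  have lg: "0 < - ln (sqrt \<gamma>)" using sg by simp
  have "0 \<le> ln K" by (simp add: K Suc_leI)
  then have B: "0 < B" using lam gamma by (simp add: B_def add_pos_nonneg)
  have mono: "h y \<le> h x" if "0 < x" "x \<le> y" for x y
  proof -
    have "B / y \<le> B / x" using that B by (intro divide_left_mono) auto
    then have "ln (B / y) \<le> ln (B / x)" using that B by simp
    then show ?thesis
      unfolding h_def using lg by (intro nat_mono ceiling_mono divide_right_mono) auto
  qed
  have step: "h (x / sqrt \<gamma>) < h x" if "0 < x" "x < B" for x
  proof -
    have "ln (B / (x / sqrt \<gamma>)) = ln (B / x) + ln (sqrt \<gamma>)"
      using that B sg by (subst ln_mult_pos [symmetric]) auto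
    then have "ln (B / (x / sqrt \<gamma>)) / - ln (sqrt \<gamma>) = ln (B / x) / - ln (sqrt \<gamma>) - 1"
      using lg by (simp add: field_simps)
    then have 1: "h (x / sqrt \<gamma>) = nat (\<lceil>ln (B / x) / - ln (sqrt \<gamma>)\<rceil> - 1)"
      by (simp only: h_def ceiling_diff_one)
    have "0 < ln (B / x)" using that by simp
    then have "0 < ln (B / x) / - ln (sqrt \<gamma>)" using lg by (rule divide_pos_pos)
    then have "0 < \<lceil>ln (B / x) / - ln (sqrt \<gamma>)\<rceil>" by (simp only: zero_less_ceiling)
    then show ?thesis unfolding 1 by (simp only: h_def)
  qed
  have sq: "x \<le> sqrt (k * x)" if "0 < x" "x < k" for x k :: real
  proof -
    have "x * x \<le> k * x" using that by (intro mult_right_mono) auto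
    then show ?thesis using that by (simp add: real_le_rsqrt power2_eq_square)
  qed
  have hsq: "h (sqrt (\<kappa> * x) / sqrt \<gamma>) \<le> h (x / sqrt \<gamma>)" if "0 < x" "x < \<kappa>" for x
    using that sg sq[OF that] by (intro mono divide_right_mono) auto
  let ?m = "\<lambda>p. case p of Inl (lo, \<delta>', \<epsilon>, s) \<Rightarrow> 2 * h \<epsilon>
                        | Inr (lo, \<delta>', \<epsilon>, s) \<Rightarrow> Suc (2 * h (\<epsilon> / sqrt \<gamma>))"
  show ?thesis
  proof (relation "Wellfounded.measure ?m", goal_cases)
    case 1 show ?case by simp
  next
    case (2 lo \<delta>' \<epsilon> s)
    then show ?case using step[of \<epsilon>] by (simp add: B_def)
  next
    case (3 lo \<delta>' \<epsilon> s z)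
    then show ?case using step[of \<epsilon>] by (simp add: B_def)
  next
    case (4 lo \<delta>' \<epsilon> s)
    from 4(1,2) have "h (\<epsilon> / sqrt \<gamma>) < h \<epsilon>" by (intro step) (auto simp: B_def)
    moreover from 4(1,3) have "h (sqrt (\<kappa> * \<epsilon>) / sqrt \<gamma>) \<le> h (\<epsilon> / sqrt \<gamma>)"
      by (intro hsq) auto
    ultimately show ?case by simp
  next
    case 5 show ?case by simp
  qed
qed

definition smooth_cruiser :: "real \<Rightarrow> real \<Rightarrow> real \<Rightarrow> 's \<Rightarrow> (real \<times> nat) measure" where
  "smooth_cruiser lo \<delta>' \<epsilon> s = do {
     (q, n) \<leftarrow> estimateQ lo \<delta>' \<epsilon> s;
     return (borel \<Otimes>\<^sub>M count_space UNIV) (F s q, n)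
   }"

text \<open>
  In an MDP \<open>Q V \<ge> 0\<close>, so clipping to \<open>[0, qmax]\<close> is harmless.  In a game \<open>Q V\<close> can be negative:
  with zero rewards and only minimizer states, every entry of \<open>Q V\<close> is \<open>- \<gamma> * Mlam / (1 - \<gamma>)\<close>,
  which an estimate clipped at \<open>0\<close> never approaches.  Games therefore use \<open>[- qmax, qmax]\<close>,
  and may use \<open>[0, qmax]\<close> when \<open>Q V \<ge> 0\<close>.
\<close>

definition valid_floor :: "('s \<Rightarrow> real) \<Rightarrow> real \<Rightarrow> bool" where
  "valid_floor V lo \<longleftrightarrow>
     (lo = 0 \<and> (Mini \<inter> space S = {} \<or> (\<forall>s\<in>space S. \<forall>a. 0 \<le> Q V s $ a))) \<or> lo = - qmax"

end

end

theory Submission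
  imports Defs "HOL-Real_Asymp.Real_Asymp"
begin

text \<open>
  Every value that the algorithm handles is bounded by a constant, so the analysis can use
  unconditional expectations and needs no union bound over the recursive calls. By induction on the
  accuracy, the output of \<open>sampleV\<close> has bias at most \<open>\<epsilon>\<close>: one call of \<open>estimateQ\<close> is off by more than
  a fixed fraction of its accuracy with probability at most \<open>\<delta>'\<close> (Hoeffding), and a first-order
  expansion of the \<open>1 / lam\<close>-smooth function \<open>F s\<close> around the crude estimate at accuracy
  \<open>sqrt (\<kappa> * \<epsilon>)\<close> leaves an error of order \<open>\<epsilon>\<close>. The failure event costs \<open>O(\<delta>')\<close> in the bias, so
  taking \<open>\<delta>'\<close> proportional to \<open>\<epsilon>\<close> suffices.

  With \<open>\<ell> = ln (2 * K / \<delta>')\<close>, the cost \<open>U\<close> of \<open>sampleV\<close> satisfies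
  \<open>U \<epsilon> \<le> U (\<epsilon> / sqrt \<gamma>) + O(\<ell> / \<epsilon>) * U (sqrt (\<kappa> * \<epsilon>) / sqrt \<gamma>)\<close>, which reproduces the
  bound \<open>\<Phi> * \<epsilon> powr - (2 + 2 * c)\<close> as soon as \<open>\<epsilon>\<close> is below a threshold that is a power of \<open>1 / \<ell>\<close>.
  At the threshold a crude product bound over the depth of the recursion gives
  \<open>\<Phi> = exp (O((ln \<ell>)\<^sup>2))\<close>, which is subpolynomial in \<open>1 / \<epsilon>\<close> since \<open>\<ell>\<close> is of order \<open>ln (1 / \<epsilon>)\<close>.
\<close>

subsection \<open>Log-sum-exp and softmax\<close>

text \<open>The exponent 4 is critical. A power \<epsilon> powr - p put into the cost recursion
  turns its second summand into O(\<ell>) * \<epsilon> powr (- 1 - p / 2), which at p = 2 is the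
  same power again, with a coefficient of order \<ell> where one below 1 is required. For p = 2 + 2
  * c the second summand is smaller than \<epsilon> powr - p by the factor \<epsilon> powr c, which
  outweighs \<ell> only below the threshold; this is the origin of both the threshold and the loss
  of c. The sample count of the outermost \<open>estimateQ\<close> adds the other 2.

  On the accuracy side everything is paid from one budget. A sample taken at accuracy \<epsilon> /
  sqrt \<gamma> and discounted by \<gamma> returns with bias at most sqrt \<gamma> * \<epsilon>, so
  each level may spend (1 - sqrt \<gamma>) * \<epsilon>: in the second branch of
  \<open>sampleV\<close> on sampling noise and the failure event, in the third on curvature and the
  failure event.\<close>

definition lse :: "real \<Rightarrow> real ^ 'a::finite \<Rightarrow> real" where
  "lse lam x = lam * ln (\<Sum>i\<in>UNIV. exp (x $ i / lam))"

definition softmax :: "real \<Rightarrow> real ^ 'a::finite \<Rightarrow> real ^ 'a" where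
  "softmax lam x = (\<chi> i. exp (x $ i / lam) / (\<Sum>j\<in>UNIV. exp (x $ j / lam)))"

lemma sum_exp_pos: "0 < (\<Sum>i\<in>UNIV. exp (f i :: real))" for f :: "'a::finite \<Rightarrow> real"
  by (intro sum_pos) auto

text \<open>\<open>grad\<close> is a definite description, so uniqueness must be settled before any
  computation: a linear functional determines its representing vector.\<close>

lemma grad_eqI: "grad f x = D" if "GDERIV f x :> D"
  unfolding grad_def
proof (rule the_equality)
  show "GDERIV f x :> D" by (rule that)
next
  fix D' assume "GDERIV f x :> D'"
  then have "(\<lambda>h. h \<bullet> D') = (\<lambda>h. h \<bullet> D)"
    using that unfolding gderiv_def by (rule has_derivative_unique)
  then show "D' = D" by (metis vector_eq_ldot)
qed

lemma GDERIV_lse: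
  assumes "lam \<noteq> 0"
  shows "GDERIV (lse lam) x :> softmax lam x"
proof -
  have "((\<lambda>x. lam * ln (\<Sum>i\<in>UNIV. exp (x $ i / lam))) has_derivative
      (\<lambda>h. lam * ((\<Sum>i\<in>UNIV. exp (x $ i / lam) * (h $ i / lam)) / (\<Sum>i\<in>UNIV. exp (x $ i / lam))))) (at x)"
    using sum_exp_pos[of "\<lambda>i. x $ i / lam"]
    by (auto intro!: derivative_eq_intros bounded_linear.has_derivative[OF bounded_linear_vec_nth] simp: assms divide_simps mult.commute)
  moreover have "lam * ((\<Sum>i\<in>UNIV. exp (x $ i / lam) * (h $ i / lam)) / (\<Sum>i\<in>UNIV. exp (x $ i / lam))) = h \<bullet> softmax lam x" for h
  proof -
    have "lam * (\<Sum>i\<in>UNIV. exp (x $ i / lam) * (h $ i / lam)) = (\<Sum>i\<in>UNIV. h $ i * exp (x $ i / lam))"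
      using assms by (simp add: sum_distrib_left mult_ac)
    then show ?thesis
      by (simp only: times_divide_eq_right) (simp add: inner_vec_def softmax_def sum_divide_distrib)
  qed
  ultimately show ?thesis
    unfolding gderiv_def lse_def by simp
qed

lemma softmax_nonneg: "0 \<le> softmax lam x $ i"
  using sum_exp_pos[of "\<lambda>i. x $ i / lam"] by (simp add: softmax_def)

lemma sum_softmax: "(\<Sum>i\<in>UNIV. softmax lam x $ i) = 1"
  using sum_exp_pos[of "\<lambda>i. x $ i / lam"] by (simp add: softmax_def flip: sum_divide_distrib)

text \<open>The right-hand side is a cumulant generating function of the increment under the law
  \<open>softmax lam x\<close>. Convexity and smoothness of \<open>lse\<close> thereby become
  Jensen's inequality and Hoeffding's lemma for one bounded random variable.\<close>

lemma lse_diff: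
  assumes "lam \<noteq> 0"
  shows "lse lam y - lse lam x = lam * ln (\<Sum>i\<in>UNIV. softmax lam x $ i * exp ((y - x) $ i / lam))"
proof -
  have "(\<Sum>i\<in>UNIV. softmax lam x $ i * exp ((y - x) $ i / lam)) =
      (\<Sum>i\<in>UNIV. exp (y $ i / lam)) / (\<Sum>i\<in>UNIV. exp (x $ i / lam))"
    by (simp add: softmax_def sum_divide_distrib diff_divide_distrib flip: exp_add)
  then show ?thesis
    using sum_exp_pos[of "\<lambda>i. x $ i / lam"] sum_exp_pos[of "\<lambda>i. y $ i / lam"]
    by (simp add: lse_def ln_div algebra_simps)
qed

lemma lse_tangent_le:
  assumes "0 < lam"
  shows "lse lam x + softmax lam x \<bullet> (y - x) \<le> lse lam y"
proof -
  let ?p = "\<lambda>i. softmax lam x $ i" and ?d = "\<lambda>i. (y - x) $ i / lam"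
  \<comment> \<open>Centring at the mean makes the linear term of exp t \<ge> 1 + t average to zero,
    which is Jensen's inequality here.\<close>
  define m where "m = (\<Sum>i\<in>UNIV. ?p i * ?d i)"
  have "(\<Sum>i\<in>UNIV. ?p i * (1 + (?d i - m))) \<le> (\<Sum>i\<in>UNIV. ?p i * exp (?d i - m))"
    by (intro sum_mono mult_left_mono softmax_nonneg exp_ge_add_one_self)
  moreover have "(\<Sum>i\<in>UNIV. ?p i * (1 + (?d i - m))) = 1"
    unfolding ring_distribs sum.distrib sum_subtractf right_diff_distrib m_def[symmetric] sum_distrib_right[symmetric] sum_softmax by simp
  moreover have "(\<Sum>i\<in>UNIV. ?p i * exp (?d i - m)) = (\<Sum>i\<in>UNIV. ?p i * exp (?d i)) / exp m"
    by (simp add: exp_diff sum_divide_distrib)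
  ultimately have "1 \<le> (\<Sum>i\<in>UNIV. ?p i * exp (?d i)) / exp m"
    by linarith
  then have "exp m \<le> (\<Sum>i\<in>UNIV. ?p i * exp (?d i))"
    by (simp only: le_divide_eq_1_pos exp_gt_zero)
  then have "m \<le> ln (\<Sum>i\<in>UNIV. ?p i * exp (?d i))"
    by (metis exp_gt_zero ln_exp ln_mono)
  then have "lam * m \<le> lse lam y - lse lam x"
    using assms by (simp add: lse_diff)
  moreover have "lam * m = softmax lam x \<bullet> (y - x)"
    using assms by (simp add: m_def inner_vec_def sum_distrib_left)
  ultimately show ?thesis by simp
qed

text \<open>Hoeffding's lemma bounds the centred cumulant generating function of a variable in
  [-D, D] by (2 * D)^2 / (8 * lam^2), and the prefactor \<open>lam\<close> leaves D^2 / (2 * lam).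
  The increment is measured in the sup norm because concentration controls each action
  separately.\<close>

lemma lse_le_tangent:
  assumes lam: "0 < lam" and D: "\<And>i. \<bar>y $ i - x $ i\<bar> \<le> D"
  shows "lse lam y \<le> lse lam x + softmax lam x \<bullet> (y - x) + D\<^sup>2 / (2 * lam)"
proof -
  define M where "M = point_measure UNIV (\<lambda>i. ennreal (softmax lam x $ i))"
  have "emeasure M (space M) = 1"
    by (simp add: M_def emeasure_point_measure_finite space_point_measure sum_ennreal softmax_nonneg sum_softmax)
  then interpret prob_space M by (rule prob_spaceI)
  define f where "f = (\<lambda>i. (y - x) $ i)"
  interpret interval_bounded_random_variable M f "- D" D
  proof unfold_locales
    show "f \<in> borel_measurable M"
      by (simp add: M_def)
    have "- D \<le> f i \<and> f i \<le> D" for i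
      using D[of i] by (auto simp: f_def abs_le_iff)
    then show "AE i in M. f i \<in> {- D..D}" by simp
  qed
  have int: "(\<integral>i. g i \<partial>M) = (\<Sum>i\<in>UNIV. softmax lam x $ i * g i)" for g :: "_ \<Rightarrow> real"
    unfolding M_def by (subst lebesgue_integral_point_measure_finite) (auto simp: softmax_nonneg)
  have m: "expectation f = softmax lam x \<bullet> (y - x)"
    by (simp add: int f_def inner_vec_def)
  have "(\<integral>\<^sup>+i. exp (1 / lam * (f i - expectation f)) \<partial>M) \<le> ennreal (exp ((1 / lam)\<^sup>2 * (D - - D)\<^sup>2 / 8))"
    by (rule Hoeffdings_lemma_nn_integral) (use lam in simp)
  also have "(\<integral>\<^sup>+i. exp (1 / lam * (f i - expectation f)) \<partial>M) = ennreal (\<integral>i. exp (1 / lam * (f i - expectation f)) \<partial>M)"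
    unfolding M_def by (intro nn_integral_eq_integral integrable_point_measure_finite) auto
  finally have "(\<Sum>i\<in>UNIV. softmax lam x $ i * exp (1 / lam * (f i - expectation f))) \<le> exp ((1 / lam)\<^sup>2 * (D - - D)\<^sup>2 / 8)"
    by (subst (asm) ennreal_le_iff) (auto simp only: int exp_ge_zero)
  also have "(\<Sum>i\<in>UNIV. softmax lam x $ i * exp (1 / lam * (f i - expectation f))) =
     (\<Sum>i\<in>UNIV. softmax lam x $ i * exp ((y - x) $ i / lam)) / exp (expectation f / lam)"
    by (simp add: f_def right_diff_distrib diff_divide_distrib exp_diff sum_divide_distrib)
  finally have "(\<Sum>i\<in>UNIV. softmax lam x $ i * exp ((y - x) $ i / lam)) \<le> exp ((1 / lam)\<^sup>2 * (D - - D)\<^sup>2 / 8 + expectation f / lam)"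
    by (simp add: exp_add field_simps)
  moreover have "0 < (\<Sum>i\<in>UNIV. softmax lam x $ i * exp ((y - x) $ i / lam))"
    by (intro sum_pos) (auto simp: softmax_def sum_exp_pos)
  ultimately have "ln (\<Sum>i\<in>UNIV. softmax lam x $ i * exp ((y - x) $ i / lam)) \<le> (1 / lam)\<^sup>2 * (D - - D)\<^sup>2 / 8 + expectation f / lam"
    by (metis ln_exp ln_mono)
  then have "lam * ln (\<Sum>i\<in>UNIV. softmax lam x $ i * exp ((y - x) $ i / lam)) \<le> lam * ((1 / lam)\<^sup>2 * (D - - D)\<^sup>2 / 8 + expectation f / lam)"
    using lam by simp
  also have "\<dots> = D\<^sup>2 / (2 * lam) + expectation f"
    using lam by (simp add: field_simps power2_eq_square)
  finally show ?thesis
    using lse_diff[of lam y x] lam by (simp add: m)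
qed

text \<open>Raising every coordinate by at most D multiplies the sum of exponentials by at most exp
  (D / lam); exchanging x and y gives the other sign.\<close>

lemma lse_lipschitz:
  assumes lam: "0 < lam" and D: "\<And>i. \<bar>y $ i - x $ i\<bar> \<le> D"
  shows "\<bar>lse lam y - lse lam x\<bar> \<le> D"
proof -
  have *: "lse lam y - lse lam x \<le> D" if D: "\<And>i. y $ i - x $ i \<le> D" for x y
  proof -
    have "(\<Sum>i\<in>UNIV. exp (y $ i / lam)) \<le> (\<Sum>i\<in>UNIV. exp (x $ i / lam) * exp (D / lam))"
      using D lam by (intro sum_mono) (simp add: divide_simps diff_le_eq add.commute flip: exp_add add_divide_distrib)
    then have "ln (\<Sum>i\<in>UNIV. exp (y $ i / lam)) \<le> ln ((\<Sum>i\<in>UNIV. exp (x $ i / lam)) * exp (D / lam))"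
      using sum_exp_pos by (intro ln_mono) (auto simp: sum_distrib_right)
    also have "\<dots> = ln (\<Sum>i\<in>UNIV. exp (x $ i / lam)) + D / lam"
      using sum_exp_pos[of "\<lambda>i. x $ i / lam"] by (simp add: ln_mult)
    finally show ?thesis
      using lam by (simp add: lse_def field_simps)
  qed
  show ?thesis
    using *[of y x] *[of x y] D by (simp add: abs_le_iff)
qed

lemma lse_ge_component:
  assumes "0 < lam"
  shows "x $ i \<le> lse lam x"
proof -
  have "exp (x $ i / lam) \<le> (\<Sum>i\<in>UNIV. exp (x $ i / lam))"
    by (intro member_le_sum) auto
  then have "x $ i / lam \<le> ln (\<Sum>i\<in>UNIV. exp (x $ i / lam))"
    by (metis exp_gt_zero ln_exp ln_mono)
  then show ?thesis using assms by (simp add: lse_def field_simps)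
qed

text \<open>The quantity below is \<open>lam\<close> times the Shannon entropy of \<open>softmax lam x\<close>.\<close>

lemma lse_minus_inner_bounds:
  fixes x :: "real ^ 'a::finite"
  assumes "0 < lam"
  shows "0 \<le> lse lam x - x \<bullet> softmax lam x"
    and "lse lam x - x \<bullet> softmax lam x \<le> lam * ln (real CARD('a))"
proof -
  have "x \<bullet> softmax lam x \<le> (\<Sum>i\<in>UNIV. lse lam x * softmax lam x $ i)"
    unfolding inner_vec_def
    using lse_ge_component[OF assms] by (auto intro!: sum_mono mult_right_mono softmax_nonneg)
  then show "0 \<le> lse lam x - x \<bullet> softmax lam x"
    by (simp add: sum_softmax flip: sum_distrib_left)
  show "lse lam x - x \<bullet> softmax lam x \<le> lam * ln (real CARD('a))"
    using lse_tangent_le[OF assms, of x 0] by (simp add: lse_def inner_commute)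
qed

section \<open>Measurability of vector-valued maps, log-sum-exp and softmax\<close>

lemma borel_measurable_vec_nth [measurable (raw)]:
  fixes f :: "'b \<Rightarrow> real ^ 'a::finite"
  assumes "f \<in> borel_measurable M"
  shows "(\<lambda>x. f x $ i) \<in> borel_measurable M"
  by (rule measurable_compose[OF assms]) (intro borel_measurable_continuous_onI continuous_intros)

lemma borel_measurable_vec_lambda:
  fixes f :: "'a::finite \<Rightarrow> 'b \<Rightarrow> real"
  assumes "\<And>i. f i \<in> borel_measurable M"
  shows "(\<lambda>x. \<chi> i. f i x) \<in> borel_measurable M"
  using assms by (subst borel_measurable_euclidean_space) (auto simp: Basis_vec_def inner_axis)

lemma borel_measurable_lse [measurable]: "lse lam \<in> borel_measurable borel"
  unfolding lse_def[abs_def] divide_inverse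
  by (intro borel_measurable_continuous_onI continuous_intros ballI) (simp_all add: less_imp_neq[OF sum_exp_pos, symmetric])

lemma borel_measurable_softmax [measurable]: "softmax lam \<in> borel_measurable borel"
  unfolding softmax_def[abs_def] divide_inverse
  by (intro borel_measurable_continuous_onI continuous_intros ballI) (simp_all add: less_imp_neq[OF sum_exp_pos, symmetric])

subsection \<open>Probability kernels\<close>

lemma prob_algebraD:
  assumes "\<kappa> \<in> M \<rightarrow>\<^sub>M prob_algebra N" "x \<in> space M"
  shows "prob_space (\<kappa> x)" "sets (\<kappa> x) = sets N" "space (\<kappa> x) = space N"
  using measurable_space[OF assms] by (auto simp: space_prob_algebra dest: sets_eq_imp_space_eq)

text \<open>It suffices to test a kernel on an intersection-stable generator. On the boxes that
  generate a finite product, the measure is a finite product of factors, each measurable in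
  s.\<close>

lemma measurable_PiM_prob_algebra:
  assumes "finite I" and \<kappa>: "\<And>i. i \<in> I \<Longrightarrow> (\<lambda>s. \<kappa> s i) \<in> S \<rightarrow>\<^sub>M prob_algebra (N i)"
  shows "(\<lambda>s. PiM I (\<kappa> s)) \<in> S \<rightarrow>\<^sub>M prob_algebra (PiM I N)"
proof (rule measurable_prob_algebra_generated[OF sets_PiM Int_stable_prod_algebra prod_algebra_sets_into_space])
  fix s assume s: "s \<in> space S"
  show "prob_space (PiM I (\<kappa> s))"
    using prob_algebraD(1)[OF \<kappa> s] by (intro prob_space_PiM)
  show "sets (PiM I (\<kappa> s)) = sets (PiM I N)"
    using prob_algebraD(2)[OF \<kappa> s] by (intro sets_PiM_cong) auto
next
  fix A assume "A \<in> prod_algebra I N"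
  then obtain X where A: "A = Pi\<^sub>E I X" and X: "\<And>i. i \<in> I \<Longrightarrow> X i \<in> sets (N i)"
    using \<open>finite I\<close> by (auto simp: prod_algebra_eq_finite)
  have "emeasure (PiM I (\<kappa> s)) A = (\<Prod>i\<in>I. emeasure (\<kappa> s i) (X i))" if s: "s \<in> space S" for s
  proof -
    have "prod_emb I (\<kappa> s) I (Pi\<^sub>E I X) = Pi\<^sub>E I X"
      using prob_algebraD(3)[OF \<kappa> s] sets.sets_into_space[OF X]
      by (intro prod_emb_PiE_same_index) auto
    then show ?thesis
      using emeasure_PiM_emb[of I "\<kappa> s" I X] prob_algebraD(1,2)[OF \<kappa> s] X \<open>finite I\<close>
      by (simp add: A)
  qed
  moreover have "(\<lambda>s. \<Prod>i\<in>I. emeasure (\<kappa> s i) (X i)) \<in> borel_measurable S"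
    using \<kappa> X by (intro borel_measurable_prod_ennreal measurable_emeasure_kernel[OF measurable_prob_algebraD]) auto
  ultimately show "(\<lambda>s. emeasure (PiM I (\<kappa> s)) A) \<in> borel_measurable S"
    by (subst measurable_cong) auto
qed

lemma AE_bind_prob_algebra:
  assumes M: "M \<in> space (prob_algebra N)" and \<kappa>: "\<kappa> \<in> N \<rightarrow>\<^sub>M prob_algebra R"
    and P: "Measurable.pred R P"
  shows "(AE x in M \<bind> \<kappa>. P x) \<longleftrightarrow> (AE x in M. AE y in \<kappa> x. P y)"
proof (rule AE_bind[OF _ P])
  show "\<kappa> \<in> M \<rightarrow>\<^sub>M subprob_algebra R"
    using measurable_prob_algebraD[OF \<kappa>] M by (simp add: space_prob_algebra cong: measurable_cong_sets)
qed

text \<open>Outputs are bounded only almost surely, because rewards lie in [0, 1] only almost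
  surely. The integral is computed for a truncation that is bounded everywhere and agrees with
  \<open>f\<close> almost surely on both sides.\<close>

lemma integral_bind_AE_bounded:
  fixes f :: "'b \<Rightarrow> real"
  assumes M: "M \<in> space (prob_algebra N)" and \<kappa>: "\<kappa> \<in> N \<rightarrow>\<^sub>M prob_algebra R"
    and f [measurable]: "f \<in> borel_measurable R" and C: "AE x in M. AE y in \<kappa> x. \<bar>f y\<bar> \<le> C"
  shows "(\<integral>y. f y \<partial>(M \<bind> \<kappa>)) = (\<integral>x. (\<integral>y. f y \<partial>\<kappa> x) \<partial>M)"
proof -
  \<comment> \<open>The absolute value keeps the truncation interval nonempty whatever the sign of
    C.\<close>
  define g where "g y = max (- \<bar>C\<bar>) (min \<bar>C\<bar> (f y))" for y
  have g [measurable]: "g \<in> borel_measurable R" by (simp add: g_def[abs_def])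
  have g_bound: "\<bar>g y\<bar> \<le> \<bar>C\<bar>" for y by (auto simp: g_def)
  have eq: "f y = g y" if "\<bar>f y\<bar> \<le> C" for y using that by (auto simp: g_def)
  interpret prob_space M using M by (simp add: space_prob_algebra)
  have sM: "sets M = sets N" "space M = space N" using M by (auto simp: space_prob_algebra dest: sets_eq_imp_space_eq)
  have \<kappa>': "\<kappa> \<in> M \<rightarrow>\<^sub>M subprob_algebra R"
    using measurable_prob_algebraD[OF \<kappa>] sM by (simp cong: measurable_cong_sets)
  have sets_bind: "sets (M \<bind> \<kappa>) = sets R"
    using prob_algebraD[OF \<kappa>] sM not_empty by (intro sets_bind) auto
  have fk: "f \<in> borel_measurable (\<kappa> x)" "g \<in> borel_measurable (\<kappa> x)" if "x \<in> space M" for x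
    using prob_algebraD(2)[OF \<kappa>] that sM f g by (auto cong: measurable_cong_sets)
  have fb: "f \<in> borel_measurable (M \<bind> \<kappa>)" "g \<in> borel_measurable (M \<bind> \<kappa>)"
    using sets_bind f g by (auto cong: measurable_cong_sets)
  have "AE y in M \<bind> \<kappa>. \<bar>f y\<bar> \<le> C"
    using C by (subst AE_bind_prob_algebra[OF M \<kappa>]) auto
  then have "(\<integral>y. f y \<partial>(M \<bind> \<kappa>)) = (\<integral>y. g y \<partial>(M \<bind> \<kappa>))"
    by (intro integral_cong_AE fb) (auto intro: eq)
  also have "\<dots> = (\<integral>x. (\<integral>y. g y \<partial>\<kappa> x) \<partial>M)"
    using g_bound prob_algebraD(1)[OF \<kappa>] sM
    by (intro integral_bind[OF g _ \<kappa>', where B'=1]) (auto simp: finite_measure_axioms prob_space.emeasure_space_1)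
  also have "\<dots> = (\<integral>x. (\<integral>y. f y \<partial>\<kappa> x) \<partial>M)"
  proof (rule integral_cong_AE)
    show "AE x in M. (\<integral>y. g y \<partial>\<kappa> x) = (\<integral>y. f y \<partial>\<kappa> x)"
      using C AE_space
    proof eventually_elim
      case (elim x)
      then show ?case by (intro integral_cong_AE fk) (auto intro: eq[symmetric])
    qed
  qed (rule measurable_compose[OF \<kappa>'], rule integral_measurable_subprob_algebra, fact)+
  finally show ?thesis .
qed

text \<open>Independence means that the joint law is the product of the marginals. Points of the
  product space are extensional, so restricting them to I is the identity and the joint law is
  \<open>PiM I M\<close> itself.\<close>

lemma indep_vars_PiM_components:
  assumes "I \<noteq> {}" and M: "\<And>i. i \<in> I \<Longrightarrow> prob_space (M i)"
  shows "prob_space.indep_vars (PiM I M) M (\<lambda>i \<omega>. \<omega> i) I"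
proof -
  interpret prob_space "PiM I M" by (intro prob_space_PiM M)
  have "distr (PiM I M) (PiM I M) (\<lambda>\<omega>. \<lambda>i\<in>I. \<omega> i) = distr (PiM I M) (PiM I M) (\<lambda>\<omega>. \<omega>)"
    by (intro distr_cong) (auto simp: space_PiM)
  also have "\<dots> = (\<Pi>\<^sub>M i\<in>I. distr (PiM I M) (M i) (\<lambda>\<omega>. \<omega> i))"
    by (simp, intro PiM_cong refl distr_PiM_component[symmetric] M)
  finally show ?thesis
    using \<open>I \<noteq> {}\<close> by (subst indep_vars_iff_distr_eq_PiM') auto
qed

text \<open>J is a part of I because the samples of all actions live in one product space, while
  Hoeffding's inequality is applied to the row of a single action.\<close>

lemma PiM_mean_concentration:
  fixes f :: "'b \<Rightarrow> real"
  assumes "finite J" "J \<noteq> {}" "J \<subseteq> I" and M: "\<And>i. i \<in> I \<Longrightarrow> prob_space (M i)"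
    and f: "\<And>i. i \<in> J \<Longrightarrow> f \<in> borel_measurable (M i)"
    and ab: "\<And>i. i \<in> J \<Longrightarrow> AE x in M i. f x \<in> {a..b}" and "a < b"
    and \<mu>: "\<And>i. i \<in> J \<Longrightarrow> (\<integral>x. f x \<partial>M i) = \<mu>" and "0 \<le> t"
  shows "measure (PiM I M) {\<omega>\<in>space (PiM I M). \<bar>(\<Sum>i\<in>J. f (\<omega> i)) / real (card J) - \<mu>\<bar> \<ge> t}
          \<le> 2 * exp (- 2 * real (card J) * t\<^sup>2 / (b - a)\<^sup>2)"
proof -
  interpret prob_space "PiM I M" by (intro prob_space_PiM M)
  have *: "indep_vars (\<lambda>_. borel) (\<lambda>i \<omega>. f (\<omega> i)) J"
    using assms f by (intro indep_vars_compose2[OF indep_vars_subset[OF indep_vars_PiM_components]]) auto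
  have rv: "(\<lambda>\<omega>. f (\<omega> i)) \<in> borel_measurable (PiM I M)" if "i \<in> J" for i
    using that \<open>J \<subseteq> I\<close> by (intro measurable_compose[OF _ f[OF that]]) auto
  interpret H: Hoeffding_ineq "PiM I M" J "\<lambda>i \<omega>. f (\<omega> i)" "\<lambda>_. a" "\<lambda>_. b" "real (card J) * \<mu>"
  proof unfold_locales
    fix i assume "i \<in> J"
    then show "AE \<omega> in PiM I M. f (\<omega> i) \<in> {a..b}"
      using assms by (intro AE_PiM_component[of I M i "\<lambda>x. f x \<in> {a..b}"]) auto
  next
    have "expectation (\<lambda>\<omega>. f (\<omega> i)) = \<mu>" if "i \<in> J" for i
    proof -
      have "(\<integral>x. f x \<partial>M i) = (\<integral>x. f x \<partial>distr (PiM I M) (M i) (\<lambda>\<omega>. \<omega> i))"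
        using that assms by (subst distr_PiM_component) auto
      also have "\<dots> = expectation (\<lambda>\<omega>. f (\<omega> i))"
        using that assms f by (intro integral_distr) auto
      finally show ?thesis using \<mu>[OF that] by simp
    qed
    then show "real (card J) * \<mu> \<equiv> \<Sum>i\<in>J. expectation (\<lambda>\<omega>. f (\<omega> i))"
      by simp
  qed (use assms * in auto)
  have J: "0 < real (card J)" using assms by (simp add: card_gt_0_iff)
  have "prob {\<omega>\<in>space (PiM I M). \<bar>(\<Sum>i\<in>J. f (\<omega> i)) - real (card J) * \<mu>\<bar> \<ge> real (card J) * t}
     \<le> 2 * exp (- 2 * (real (card J) * t)\<^sup>2 / (\<Sum>i\<in>J. (b - a)\<^sup>2))"
    using J assms by (intro H.Hoeffding_ineq_abs_ge) auto
  moreover have "- 2 * (real (card J) * t)\<^sup>2 / (\<Sum>i\<in>J. (b - a)\<^sup>2) = - 2 * real (card J) * t\<^sup>2 / (b - a)\<^sup>2"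
    using J by (simp add: power2_eq_square)
  moreover have "real (card J) * t \<le> \<bar>x - real (card J) * \<mu>\<bar> \<longleftrightarrow> t \<le> \<bar>x / real (card J) - \<mu>\<bar>" for x
  proof -
    have "x / real (card J) - \<mu> = (x - real (card J) * \<mu>) / real (card J)"
      using J by (simp add: field_simps)
    then have "\<bar>x / real (card J) - \<mu>\<bar> = \<bar>x - real (card J) * \<mu>\<bar> / real (card J)"
      by (simp add: abs_divide)
    then show ?thesis using J by (simp add: pos_le_divide_eq mult.commute)
  qed
  ultimately show ?thesis by simp
qed

subsection \<open>The regularized operator and one step of the algorithm\<close>

context regularized_game
begin

text \<open>Negating argument and value turns the minimizer's operator into \<open>lse\<close>, so
  every bound on \<open>F\<close> is read off from \<open>lse\<close> at x or at - x.\<close>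

lemma F_eq: "F s x = (if s \<in> Mini then - lse lam (- x) else lse lam x)"
  by (simp add: F_def lse_def)

text \<open>The inner and the outer minus sign cancel, so the gradient is a probability vector in
  minimizer states too.\<close>

lemma grad_F: "grad (F s) x = softmax lam (if s \<in> Mini then - x else x)"
proof (rule grad_eqI)
  have "lam \<noteq> 0" using lam by simp
  then have "GDERIV (\<lambda>x. - lse lam (- x)) x :> - (- softmax lam (- x))"
    using has_derivative_compose[OF has_derivative_minus[OF has_derivative_ident], of "lse lam" "\<lambda>h. h \<bullet> softmax lam (- x)" x UNIV]
      GDERIV_lse[of lam "- x"]
    by (intro GDERIV_minus) (simp add: gderiv_def)
  then show "GDERIV (F s) x :> softmax lam (if s \<in> Mini then - x else x)"
    using GDERIV_lse[OF \<open>lam \<noteq> 0\<close>, of x] by (cases "s \<in> Mini") (simp_all add: F_eq[abs_def])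
qed

lemma F_lipschitz: "\<bar>F s y - F s x\<bar> \<le> D" if "\<And>a. \<bar>y $ a - x $ a\<bar> \<le> D"
  using lse_lipschitz[OF lam, of y x D] lse_lipschitz[OF lam, of "- x" "- y" D] that by (simp add: F_eq)

lemma F_tangent:
  assumes "\<And>a. \<bar>y $ a - x $ a\<bar> \<le> D"
  shows "\<bar>F s y - (F s x + grad (F s) x \<bullet> (y - x))\<bar> \<le> D\<^sup>2 / (2 * lam)"
proof -
  have *: "\<bar>lse lam y - (lse lam x + softmax lam x \<bullet> (y - x))\<bar> \<le> D\<^sup>2 / (2 * lam)"
    if "\<And>a. \<bar>y $ a - x $ a\<bar> \<le> D" for x y :: "real ^ 'a"
    using lse_tangent_le[OF lam, of x y] lse_le_tangent[OF lam that]
      divide_nonneg_pos[of "D\<^sup>2" "2 * lam"] lam by (auto simp: abs_le_iff)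
  show ?thesis
  proof (cases "s \<in> Mini")
    case True
    have "\<bar>lse lam (- y) - (lse lam (- x) + softmax lam (- x) \<bullet> (- y - - x))\<bar> \<le> D\<^sup>2 / (2 * lam)"
      using assms by (intro *) (simp add: abs_minus_commute)
    then show ?thesis using True by (simp add: F_eq grad_F inner_diff_right abs_le_iff)
  next
    case False
    then show ?thesis using *[OF assms] by (simp add: F_eq grad_F)
  qed
qed

lemma Mlam_nonneg: "0 \<le> Mlam"
  using lam by (simp add: K Suc_leI)

text \<open>The bound is uniform in x because the difference is an entropy up to sign and scale. It
  keeps the output of the one-sample branch bounded although its two terms can each be
  large.\<close>

lemma F_minus_inner: "\<bar>F s x - x \<bullet> grad (F s) x\<bar> \<le> Mlam"
  using lse_minus_inner_bounds[OF lam, of x] lse_minus_inner_bounds[OF lam, of "- x"] Mlam_nonneg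
  by (simp add: F_eq grad_F K abs_le_iff)

lemma F_abs_le: "\<bar>F s x\<bar> \<le> D + Mlam" if "\<And>a. \<bar>x $ a\<bar> \<le> D"
  using F_lipschitz[of x 0 D s] that abs_F_0[of s] by force

lemma grad_F_nonneg: "0 \<le> grad (F s) x $ a"
  by (simp add: grad_F softmax_nonneg)

lemma sum_grad_F: "(\<Sum>a\<in>UNIV. grad (F s) x $ a) = 1"
  by (simp add: grad_F sum_softmax)

lemma measurable_F [measurable (raw)]:
  assumes [measurable]: "f \<in> M \<rightarrow>\<^sub>M S" "g \<in> borel_measurable M"
  shows "(\<lambda>x. F (f x) (g x)) \<in> borel_measurable M"
  unfolding F_eq using Mini by measurable

lemma measurable_grad_F [measurable (raw)]:
  assumes [measurable]: "f \<in> M \<rightarrow>\<^sub>M S" "g \<in> borel_measurable M"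
  shows "(\<lambda>x. grad (F (f x)) (g x)) \<in> borel_measurable M"
  unfolding grad_F using Mini by measurable

text \<open>No output of the algorithm exceeds \<open>vmax\<close> in absolute value.\<close>

definition vmax :: real where "vmax = qmax + Mlam"

lemma qmax_ge_1: "1 \<le> qmax"
  using gamma Mlam_nonneg by (simp add: field_simps)

lemma vmax_le: "vmax \<le> 2 * qmax"
proof -
  have "1 + Mlam \<le> qmax"
    using gamma Mlam_nonneg by (simp add: pos_le_divide_eq mult_left_le)
  moreover have "q + m \<le> 2 * q" if "1 + m \<le> q" for q m :: real
    using that by linarith
  ultimately show ?thesis unfolding vmax_def by blast
qed

lemma qmax_le_vmax: "qmax \<le> vmax"
  using Mlam_nonneg by (simp add: vmax_def)

text \<open>\<open>qmax\<close> is the fixed point of the recursion for the largest value compatible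
  with rewards in [0, 1] and an entropy term of size at most \<open>Mlam\<close> per step.\<close>

lemma qmax_eq: "1 + Mlam + \<gamma> * qmax = qmax"
  using gamma by (simp add: field_simps)

section \<open>Outcome spaces and the two marginals of one oracle call\<close>

abbreviation RN :: "(real \<times> nat) measure" where "RN \<equiv> borel \<Otimes>\<^sub>M count_space UNIV"
abbreviation QN :: "((real ^ 'a) \<times> nat) measure" where "QN \<equiv> borel \<Otimes>\<^sub>M count_space UNIV"

context
  fixes s assumes s: "s \<in> space S"
begin

lemma Orc_prob: "Orc s a \<in> space (prob_algebra (borel \<Otimes>\<^sub>M S))"
  using measurable_space[OF Orc s] .

lemma measurable_Orc_eq: "measurable (Orc s a) N = measurable (borel \<Otimes>\<^sub>M S) N"
  using Orc_prob by (intro measurable_cong_sets) (auto simp: space_prob_algebra)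

lemma prob_space_Orc: "prob_space (Orc s a)"
  using Orc_prob[of a] by (simp add: space_prob_algebra)

lemma space_Orc: "space (Orc s a) = UNIV \<times> space S"
  using prob_algebraD(3)[OF Orc s] by (simp add: space_pair_measure)

lemma sets_P: "sets (P s a) = sets S"
  using Orc_snd[OF s] by (metis sets_distr)

lemma space_P: "space (P s a) = space S"
  using Orc_snd[OF s] by (metis space_distr)

lemma prob_space_P: "prob_space (P s a)"
  using prob_space.prob_space_distr[OF prob_space_Orc[of a], where f=snd and M'=S] Orc_snd[OF s]
  by (simp add: measurable_Orc_eq)

lemma integral_P: "h \<in> borel_measurable S \<Longrightarrow> (\<integral>z. h z \<partial>P s a) = (\<integral>x. h (snd x) \<partial>Orc s a)" for h :: "'s \<Rightarrow> real"
  unfolding Orc_snd[OF s, symmetric] by (rule integral_distr) (simp_all add: measurable_Orc_eq)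

lemma integral_Rew: "(\<integral>r. r \<partial>Rew s a) = (\<integral>x. fst x \<partial>Orc s a)"
  unfolding Orc_fst[OF s, symmetric] by (rule integral_distr) (simp_all add: measurable_Orc_eq)

lemma AE_Orc_reward: "AE x in Orc s a. 0 \<le> fst x \<and> fst x \<le> 1"
  using Rew[OF s, of a] unfolding Orc_fst[OF s, symmetric]
  by (rule AE_distrD[rotated]) (simp add: measurable_Orc_eq)

lemma integrable_Orc_reward: "integrable (Orc s a) fst"
proof -
  interpret prob_space "Orc s a" by (rule prob_space_Orc)
  show ?thesis
  proof (rule integrable_const_bound[where B=1])
    show "AE x in Orc s a. norm (fst x) \<le> 1"
      using AE_Orc_reward[of a] by eventually_elim auto
  qed (simp add: measurable_Orc_eq)
qed

lemma integral_Rew_bounds: "0 \<le> (\<integral>r. r \<partial>Rew s a)" "(\<integral>r. r \<partial>Rew s a) \<le> 1"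
proof -
  interpret prob_space "Orc s a" by (rule prob_space_Orc)
  show "0 \<le> (\<integral>r. r \<partial>Rew s a)"
    unfolding integral_Rew using AE_Orc_reward[of a] by (intro integral_nonneg_AE) auto
  show "(\<integral>r. r \<partial>Rew s a) \<le> 1"
    unfolding integral_Rew using AE_Orc_reward[of a] integrable_Orc_reward
    by (intro integral_le_const) auto
qed

lemma integrable_P:
  fixes h :: "'s \<Rightarrow> real"
  assumes "h \<in> borel_measurable S" "\<And>z. z \<in> space S \<Longrightarrow> \<bar>h z\<bar> \<le> C"
  shows "integrable (P s a) h"
proof -
  interpret prob_space "P s a" by (rule prob_space_P)
  show ?thesis using assms sets_P space_P
    by (intro integrable_const_bound[where B=C]) (auto cong: measurable_cong_sets)
qed

lemma integral_P_abs_le: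
  fixes h :: "'s \<Rightarrow> real"
  assumes "h \<in> borel_measurable S" "\<And>z. z \<in> space S \<Longrightarrow> \<bar>h z\<bar> \<le> C"
  shows "\<bar>\<integral>z. h z \<partial>P s a\<bar> \<le> C"
proof -
  interpret prob_space "P s a" by (rule prob_space_P)
  have "(\<integral>z. h z \<partial>P s a) \<le> C"
    using assms by (intro integral_le_const integrable_P) (auto simp: space_P abs_le_iff)
  moreover have "- C \<le> (\<integral>z. h z \<partial>P s a)"
    using assms by (intro integral_ge_const integrable_P) (auto simp: space_P abs_le_iff minus_le_iff)
  ultimately show ?thesis by auto
qed

end

section \<open>One oracle call followed by an arbitrary sampler at the next state\<close>

definition call :: "(real \<times> nat) measure \<Rightarrow> real \<Rightarrow> (real \<times> nat) measure" where
  "call M r = distr M RN (\<lambda>x. (r + \<gamma> * fst x, Suc (snd x)))"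

context
  fixes W :: "'s \<Rightarrow> (real \<times> nat) measure"
  assumes W: "W \<in> S \<rightarrow>\<^sub>M prob_algebra RN"
begin

lemma measurable_call: "(\<lambda>x. call (W (snd x)) (fst x)) \<in> borel \<Otimes>\<^sub>M S \<rightarrow>\<^sub>M prob_algebra RN"
  unfolding call_def using W by measurable

text \<open>The monadic program becomes a composition of kernels built from \<open>distr\<close>, to
  which the rules for measurability, almost sure events and integrals apply. The rewriting is made
  pointwise on the space of \<open>Orc s a\<close>, since \<open>W z\<close> is controlled only for
  z in \<open>space S\<close>.\<close>

lemma backup_eq:
  assumes "s \<in> space S"
  shows "backup W s a = Orc s a \<bind> (\<lambda>x. call (W (snd x)) (fst x))"
  unfolding backup_def
proof (rule bind_cong[OF refl], clarify)
  fix r z assume "(r, z) \<in> space (Orc s a)"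
  then have z: "z \<in> space S" using space_Orc[OF assms] by auto
  have "space (W z) \<noteq> {}" "measurable (W z) RN = measurable RN RN"
    using prob_algebraD[OF W z] by (auto simp: space_pair_measure intro!: measurable_cong_sets)
  then have "W z \<bind> (\<lambda>x. return RN (r + \<gamma> * fst x, Suc (snd x))) = call (W z) r"
    unfolding call_def by (intro bind_return_distr') auto
  then show "W z \<bind> (\<lambda>(v, n). return RN (r + \<gamma> * v, Suc n)) = call (W (snd (r, z))) (fst (r, z))"
    by (simp add: case_prod_beta')
qed

lemma measurable_backup: "(\<lambda>s. backup W s a) \<in> S \<rightarrow>\<^sub>M prob_algebra RN"
proof -
  have "(\<lambda>s. Orc s a \<bind> (\<lambda>x. call (W (snd x)) (fst x))) \<in> S \<rightarrow>\<^sub>M prob_algebra RN"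
    by (rule measurable_bind_prob_space[OF Orc measurable_call])
  then show ?thesis
    by (subst measurable_cong[OF backup_eq])
qed

context
  fixes C :: real and n :: nat
  assumes W_AE: "\<And>z. z \<in> space S \<Longrightarrow> AE x in W z. \<bar>fst x\<bar> \<le> C \<and> snd x = n"
begin

lemma AE_backup:
  assumes s: "s \<in> space S"
  shows "AE x in backup W s a. fst x \<in> {- (\<gamma> * C)..1 + \<gamma> * C} \<and> snd x = Suc n"
  unfolding backup_eq[OF s]
proof (subst AE_bind_prob_algebra[OF Orc_prob[OF s] measurable_call])
  show "AE x in Orc s a. AE y in call (W (snd x)) (fst x). fst y \<in> {- (\<gamma> * C)..1 + \<gamma> * C} \<and> snd y = Suc n"
    using AE_Orc_reward[OF s] AE_space
  proof eventually_elim
    case (elim x)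
    then have z: "snd x \<in> space S" using space_Orc[OF s] by auto
    have "measurable (W (snd x)) RN = measurable RN RN"
      using prob_algebraD[OF W z] by (auto intro!: measurable_cong_sets)
    then have "(\<lambda>y. (fst x + \<gamma> * fst y, Suc (snd y))) \<in> W (snd x) \<rightarrow>\<^sub>M RN" by simp
    then show ?case
      unfolding call_def
    proof (subst AE_distr_iff)
      show "AE y in W (snd x). fst (fst x + \<gamma> * fst y, Suc (snd y)) \<in> {- (\<gamma> * C)..1 + \<gamma> * C} \<and>
          snd (fst x + \<gamma> * fst y, Suc (snd y)) = Suc n"
        using W_AE[OF z]
      proof eventually_elim
        case (elim y)
        then have "\<bar>\<gamma> * fst y\<bar> \<le> \<gamma> * C"
          using gamma by (simp add: abs_mult)
        then show ?case
          using \<open>0 \<le> fst x \<and> fst x \<le> 1\<close> elim by (auto simp: abs_le_iff)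
      qed
    qed auto
  qed
qed simp

text \<open>Linearity of expectation sees only the marginals of R and Z, so a dependence between
  them within a call is harmless. The almost sure bound C supplies integrability.\<close>

lemma integral_backup:
  assumes s: "s \<in> space S"
  shows "(\<integral>x. fst x \<partial>backup W s a) = (\<integral>r. r \<partial>Rew s a) + \<gamma> * (\<integral>z. (\<integral>x. fst x \<partial>W z) \<partial>P s a)"
proof -
  interpret prob_space "Orc s a" by (rule prob_space_Orc[OF s])
  have intW: "integrable (W z) fst" "prob_space (W z)" "measurable (W z) RN = measurable RN RN" if z: "z \<in> space S" for z
  proof -
    show pW: "prob_space (W z)" and mW: "measurable (W z) RN = measurable RN RN"
      using prob_algebraD[OF W z] by (auto intro!: measurable_cong_sets)
    interpret W: prob_space "W z" by fact
    have "measurable (W z) borel = measurable RN borel"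
      using prob_algebraD[OF W z] by (auto intro!: measurable_cong_sets)
    then show "integrable (W z) fst"
      using W_AE[OF z] by (intro W.integrable_const_bound[where B=C]) auto
  qed
  have mEW: "(\<lambda>z. \<integral>x. fst x \<partial>W z) \<in> borel_measurable S"
    by (rule measurable_compose[OF measurable_prob_algebraD[OF W]]) (rule integral_measurable_subprob_algebra, simp)
  have EW: "\<bar>\<integral>x. fst x \<partial>W z\<bar> \<le> C" if z: "z \<in> space S" for z
  proof -
    interpret W: prob_space "W z" using intW[OF z] by simp
    have "AE x in W z. fst x \<le> C" "AE x in W z. - C \<le> fst x"
      using W_AE[OF z] by (auto elim!: eventually_mono)
    then show ?thesis
      using W.integral_le_const[OF intW(1)[OF z]] W.integral_ge_const[OF intW(1)[OF z]]
      by (simp add: abs_le_iff minus_le_iff)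
  qed
  have "(\<integral>x. fst x \<partial>backup W s a) = (\<integral>x. (\<integral>y. fst y \<partial>call (W (snd x)) (fst x)) \<partial>Orc s a)"
    unfolding backup_eq[OF s]
  proof (rule integral_bind_AE_bounded[OF Orc_prob[OF s] measurable_call])
    have "AE x in backup W s a. \<bar>fst x\<bar> \<le> 1 + \<gamma> * C"
      using AE_backup[OF s] by eventually_elim auto
    then show "AE x in Orc s a. AE y in call (W (snd x)) (fst x). \<bar>fst y\<bar> \<le> 1 + \<gamma> * C"
      unfolding backup_eq[OF s] by (subst (asm) AE_bind_prob_algebra[OF Orc_prob[OF s] measurable_call]) simp
  qed simp
  also have "\<dots> = (\<integral>x. fst x + \<gamma> * (\<integral>y. fst y \<partial>W (snd x)) \<partial>Orc s a)"
  proof (rule Bochner_Integration.integral_cong[OF refl])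
    fix x assume "x \<in> space (Orc s a)"
    then have z: "snd x \<in> space S" using space_Orc[OF s] by auto
    interpret W: prob_space "W (snd x)" using intW[OF z] by simp
    have "(\<integral>y. fst y \<partial>call (W (snd x)) (fst x)) = (\<integral>y. fst x + \<gamma> * fst y \<partial>W (snd x))"
      unfolding call_def using intW(3)[OF z] by (subst integral_distr) auto
    also have "\<dots> = fst x + \<gamma> * (\<integral>y. fst y \<partial>W (snd x))"
      using intW(1)[OF z] by (simp add: W.prob_space)
    finally show "(\<integral>y. fst y \<partial>call (W (snd x)) (fst x)) = fst x + \<gamma> * (\<integral>y. fst y \<partial>W (snd x))" .
  qed
  also have "\<dots> = (\<integral>x. fst x \<partial>Orc s a) + \<gamma> * (\<integral>x. (\<integral>y. fst y \<partial>W (snd x)) \<partial>Orc s a)"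
  proof (subst Bochner_Integration.integral_add)
    have "integrable (Orc s a) (\<lambda>x. \<integral>y. fst y \<partial>W (snd x))"
      using EW space_Orc[OF s] mEW
      by (intro integrable_const_bound[where B=C] AE_I2) (auto simp: measurable_Orc_eq[OF s] intro: measurable_compose[OF measurable_snd])
    then show "integrable (Orc s a) (\<lambda>x. \<gamma> * (\<integral>y. fst y \<partial>W (snd x)))" by simp
  qed (simp_all add: integrable_Orc_reward[OF s])
  finally show ?thesis
    using integral_P[OF s mEW, of a] by (simp add: integral_Rew[OF s])
qed

lemma backup_bias:
  assumes s: "s \<in> space S"
    and V: "V \<in> borel_measurable S" "\<And>z. z \<in> space S \<Longrightarrow> \<bar>V z\<bar> \<le> D"
    and bias: "\<And>z. z \<in> space S \<Longrightarrow> \<bar>(\<integral>x. fst x \<partial>W z) - V z\<bar> \<le> \<eta>"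
  shows "\<bar>(\<integral>x. fst x \<partial>backup W s a) - Q V s $ a\<bar> \<le> \<gamma> * \<eta>"
proof -
  have mEW: "(\<lambda>z. \<integral>x. fst x \<partial>W z) \<in> borel_measurable S"
    by (rule measurable_compose[OF measurable_prob_algebraD[OF W]]) (rule integral_measurable_subprob_algebra, simp)
  have bd: "\<bar>\<integral>x. fst x \<partial>W z\<bar> \<le> D + \<eta>" if "z \<in> space S" for z
    using V(2)[OF that] bias[OF that] by linarith
  have "(\<integral>z. (\<integral>x. fst x \<partial>W z) \<partial>P s a) - (\<integral>z. V z \<partial>P s a) = (\<integral>z. (\<integral>x. fst x \<partial>W z) - V z \<partial>P s a)"
    by (rule Bochner_Integration.integral_diff[symmetric]) (rule integrable_P[OF s mEW bd] integrable_P[OF s V]; assumption)+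
  moreover have "\<bar>\<integral>z. (\<integral>x. fst x \<partial>W z) - V z \<partial>P s a\<bar> \<le> \<eta>"
    using mEW V bias by (intro integral_P_abs_le[OF s]) auto
  ultimately have "\<bar>(\<integral>z. (\<integral>x. fst x \<partial>W z) \<partial>P s a) - (\<integral>z. V z \<partial>P s a)\<bar> \<le> \<eta>" by simp
  then have "\<gamma> * \<bar>(\<integral>z. (\<integral>x. fst x \<partial>W z) \<partial>P s a) - (\<integral>z. V z \<partial>P s a)\<bar> \<le> \<gamma> * \<eta>"
    using gamma by simp
  moreover have "(\<integral>x. fst x \<partial>backup W s a) - Q V s $ a =
      \<gamma> * ((\<integral>z. (\<integral>x. fst x \<partial>W z) \<partial>P s a) - (\<integral>z. V z \<partial>P s a))"
    by (simp add: integral_backup[OF s] Q_def right_diff_distrib)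
  ultimately show ?thesis
    using gamma by (simp only: abs_mult abs_of_pos)
qed

end
end

text \<open>The body of \<open>estimateQ\<close> with the recursive call replaced by an arbitrary
  kernel, so that one level can be analysed before anything is known about the recursion.\<close>

definition average :: "real \<Rightarrow> nat \<Rightarrow> ('s \<Rightarrow> (real \<times> nat) measure) \<Rightarrow> 's \<Rightarrow> ((real ^ 'a) \<times> nat) measure" where
  "average lo N W s = distr (\<Pi>\<^sub>M p\<in>UNIV \<times> {1..N}. backup W s (fst p)) QN
     (\<lambda>\<omega>. (\<chi> a. max lo (min qmax ((\<Sum>i=1..N. fst (\<omega> (a, i))) / real N)),
           \<Sum>p\<in>UNIV \<times> {1..N}. snd (\<omega> p)))"

context
  fixes W :: "'s \<Rightarrow> (real \<times> nat) measure"
  assumes W: "W \<in> S \<rightarrow>\<^sub>M prob_algebra RN"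
begin

lemma measurable_average_map:
  "(\<lambda>\<omega>. (\<chi> a. max lo (min qmax ((\<Sum>i=1..N. fst (\<omega> (a, i))) / real N)),
        \<Sum>p\<in>UNIV \<times> {1..N}. snd (\<omega> p))) \<in> (\<Pi>\<^sub>M p\<in>UNIV \<times> {1..N}. RN) \<rightarrow>\<^sub>M QN"
proof (rule measurable_Pair)
  show "(\<lambda>\<omega>. \<chi> a. max lo (min qmax ((\<Sum>i=1..N. fst (\<omega> (a, i))) / real N))) \<in> borel_measurable (\<Pi>\<^sub>M p\<in>UNIV \<times> {1..N}. RN)"
    by (rule borel_measurable_vec_lambda) measurable
  show "(\<lambda>\<omega>. \<Sum>p\<in>UNIV \<times> {1..N}. snd (\<omega> p)) \<in> (\<Pi>\<^sub>M p\<in>UNIV \<times> {1..N}. RN) \<rightarrow>\<^sub>M count_space UNIV"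
    by measurable
qed

lemma measurable_average: "average lo N W \<in> S \<rightarrow>\<^sub>M prob_algebra QN"
  unfolding average_def[abs_def]
  by (rule measurable_compose[OF measurable_PiM_prob_algebra measurable_distr_prob_space[OF measurable_average_map]])
     (auto intro: measurable_backup[OF W])

context
  fixes s assumes s: "s \<in> space S"
begin

lemma prob_space_backup: "prob_space (backup W s a)"
  using prob_algebraD(1)[OF measurable_backup[OF W] s] .

lemma measurable_backup_eq: "measurable (backup W s a) N = measurable RN N"
  using prob_algebraD(2)[OF measurable_backup[OF W] s] by (intro measurable_cong_sets) auto

lemma measurable_PiM_backup_eq:
  "measurable (\<Pi>\<^sub>M p\<in>I. backup W s (fst p)) N = measurable (\<Pi>\<^sub>M p\<in>I. RN) N" for I :: "('a \<times> nat) set"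
  using prob_algebraD(2)[OF measurable_backup[OF W] s]
  by (intro measurable_cong_sets sets_PiM_cong) auto

context
  fixes C :: real and n :: nat
  assumes W_AE: "\<And>z. z \<in> space S \<Longrightarrow> AE x in W z. \<bar>fst x\<bar> \<le> C \<and> snd x = n"
begin

lemma AE_backup': "AE x in backup W s a. fst x \<in> {- (\<gamma> * C)..1 + \<gamma> * C} \<and> snd x = Suc n"
  by (rule AE_backup[OF W _ s]) (rule W_AE)

lemma AE_average:
  assumes "- qmax \<le> lo" "lo \<le> qmax"
  shows "AE x in average lo N W s. (\<forall>a. \<bar>fst x $ a\<bar> \<le> qmax) \<and> snd x = K * N * Suc n"
proof -
  let ?I = "(UNIV :: 'a set) \<times> {1..N}"
  have "AE \<omega> in (\<Pi>\<^sub>M p\<in>?I. backup W s (fst p)). \<forall>p\<in>?I. snd (\<omega> p) = Suc n"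
  proof (intro eventually_ball_finite ballI)
    fix p assume "p \<in> ?I"
    have "AE x in backup W s (fst p). snd x = Suc n"
      using AE_backup' by eventually_elim auto
    then show "AE \<omega> in (\<Pi>\<^sub>M p\<in>?I. backup W s (fst p)). snd (\<omega> p) = Suc n"
      using \<open>p \<in> ?I\<close> prob_space_backup
      by (intro AE_PiM_component[where P = "\<lambda>x. snd x = Suc n"]) auto
  qed simp
  then have "AE \<omega> in (\<Pi>\<^sub>M p\<in>?I. backup W s (fst p)).
     (\<forall>a. \<bar>(\<chi> a. max lo (min qmax ((\<Sum>i=1..N. fst (\<omega> (a, i))) / real N))) $ a\<bar> \<le> qmax) \<and>
     (\<Sum>p\<in>?I. snd (\<omega> p)) = K * N * Suc n"
  proof eventually_elim
    case (elim \<omega>)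
    then have "(\<Sum>p\<in>?I. snd (\<omega> p)) = (\<Sum>p\<in>?I. Suc n)"
      by (intro sum.cong) auto
    then show ?case
      using assms qmax_ge_1 by (simp add: K card_cartesian_product abs_le_iff max_def min_def)
  qed
  then show ?thesis
    unfolding average_def using measurable_average_map
    by (subst AE_distr_iff) (auto simp: measurable_PiM_backup_eq)
qed

text \<open>Clipping to an interval that contains \<open>q $ a\<close> cannot increase the distance
  to \<open>q $ a\<close>, so every deviation of the output is a deviation of a raw mean.
  Hoeffding's inequality then applies with a range of length 1 + 2 * \<gamma> * C, and the union is
  over the K actions of this level only.\<close>

lemma average_concentration:
  assumes lo: "\<And>a. lo \<le> q $ a" "\<And>a. q $ a \<le> qmax" and "0 < N" "0 \<le> t" "0 \<le> C"
    and bias: "\<And>a. \<bar>(\<integral>x. fst x \<partial>backup W s a) - q $ a\<bar> \<le> \<eta>"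
  shows "measure (average lo N W s) {x \<in> space (average lo N W s). \<exists>a. \<bar>fst x $ a - q $ a\<bar> > \<eta> + t}
     \<le> 2 * real K * exp (- 2 * real N * t\<^sup>2 / (1 + 2 * \<gamma> * C)\<^sup>2)"
proof -
  let ?I = "(UNIV :: 'a set) \<times> {1..N}"
  let ?M = "\<Pi>\<^sub>M p\<in>?I. backup W s (fst p)"
  define m where "m \<omega> a = (\<Sum>i=1..N. fst (\<omega> (a, i))) / real N" for \<omega> :: "'a \<times> nat \<Rightarrow> real \<times> nat" and a
  define \<mu> where "\<mu> a = (\<integral>x. fst x \<partial>backup W s a)" for a
  interpret prob_space ?M by (intro prob_space_PiM prob_space_backup)
  have dev: "prob {\<omega> \<in> space ?M. \<bar>m \<omega> a - \<mu> a\<bar> \<ge> t} \<le> 2 * exp (- 2 * real N * t\<^sup>2 / (1 + 2 * \<gamma> * C)\<^sup>2)" for a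
  proof -
    have "(\<Sum>p\<in>{a} \<times> {1..N}. fst (\<omega> p)) = (\<Sum>i=1..N. fst (\<omega> (a, i)))" for \<omega> :: "'a \<times> nat \<Rightarrow> real \<times> nat"
      using sum.cartesian_product'[of "\<lambda>p. fst (\<omega> p)" "{a}" "{1..N}"] by simp
    moreover have "prob {\<omega> \<in> space ?M. \<bar>(\<Sum>p\<in>{a} \<times> {1..N}. fst (\<omega> p)) / real (card ({a} \<times> {1..N})) - \<mu> a\<bar> \<ge> t}
      \<le> 2 * exp (- 2 * real (card ({a} \<times> {1..N})) * t\<^sup>2 / (1 + \<gamma> * C - - (\<gamma> * C))\<^sup>2)"
    proof (rule PiM_mean_concentration)
      fix p assume p: "p \<in> {a} \<times> {1..N}"
      show "fst \<in> borel_measurable (backup W s (fst p))" by (simp add: measurable_backup_eq)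
      show "AE x in backup W s (fst p). fst x \<in> {- (\<gamma> * C)..1 + \<gamma> * C}"
        using AE_backup' by eventually_elim auto
      show "(\<integral>x. fst x \<partial>backup W s (fst p)) = \<mu> a" using p by (auto simp: \<mu>_def)
    qed (use \<open>0 < N\<close> \<open>0 \<le> t\<close> \<open>0 \<le> C\<close> gamma prob_space_backup in \<open>auto intro: add_strict_increasing2 mult_nonneg_nonneg simp: neg_less_iff_less\<close>)
    ultimately show ?thesis by (simp add: m_def card_cartesian_product ac_simps)
  qed
  have meas: "(\<lambda>\<omega>. m \<omega> a) \<in> borel_measurable ?M" for a
    unfolding m_def measurable_PiM_backup_eq by measurable
  have "measure (average lo N W s) {x \<in> space (average lo N W s). \<exists>a. \<bar>fst x $ a - q $ a\<bar> > \<eta> + t} =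
    prob {\<omega> \<in> space ?M. \<exists>a. \<bar>max lo (min qmax (m \<omega> a)) - q $ a\<bar> > \<eta> + t}"
  proof -
    let ?f = "\<lambda>\<omega>. (\<chi> a. max lo (min qmax ((\<Sum>i=1..N. fst (\<omega> (a, i))) / real N)),
        \<Sum>p\<in>UNIV \<times> {1..N}. snd (\<omega> p))"
    let ?E = "{x \<in> space QN. \<exists>a. \<bar>fst x $ a - q $ a\<bar> > \<eta> + t}"
    have "?f \<in> ?M \<rightarrow>\<^sub>M QN" "?E \<in> sets QN"
      using measurable_average_map by (simp only: measurable_PiM_backup_eq) measurable
    then have "measure (distr ?M QN ?f) ?E = prob (?f -` ?E \<inter> space ?M)"
      by (rule measure_distr)
    also have "?f -` ?E \<inter> space ?M = {\<omega> \<in> space ?M. \<exists>a. \<bar>max lo (min qmax (m \<omega> a)) - q $ a\<bar> > \<eta> + t}"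
      by (auto simp: space_pair_measure m_def)
    finally show ?thesis by (simp add: average_def)
  qed
  also have "\<dots> \<le> prob (\<Union>a. {\<omega> \<in> space ?M. \<bar>m \<omega> a - \<mu> a\<bar> \<ge> t})"
  proof (rule finite_measure_mono)
    show "{\<omega> \<in> space ?M. \<exists>a. \<bar>max lo (min qmax (m \<omega> a)) - q $ a\<bar> > \<eta> + t} \<subseteq> (\<Union>a. {\<omega> \<in> space ?M. \<bar>m \<omega> a - \<mu> a\<bar> \<ge> t})"
    proof clarify
      fix \<omega> a assume "\<omega> \<in> space ?M" and *: "\<bar>max lo (min qmax (m \<omega> a)) - q $ a\<bar> > \<eta> + t"
      have "\<bar>max lo (min qmax (m \<omega> a)) - q $ a\<bar> \<le> \<bar>m \<omega> a - q $ a\<bar>"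
        using lo[of a] by (auto simp: max_def min_def abs_if)
      then have "t \<le> \<bar>m \<omega> a - \<mu> a\<bar>"
        using * bias[of a] by (simp add: \<mu>_def)
      then show "\<omega> \<in> (\<Union>a. {\<omega> \<in> space ?M. \<bar>m \<omega> a - \<mu> a\<bar> \<ge> t})"
        using \<open>\<omega> \<in> space ?M\<close> by auto
    qed
  qed (use meas in measurable)
  also have "\<dots> \<le> (\<Sum>a\<in>UNIV. prob {\<omega> \<in> space ?M. \<bar>m \<omega> a - \<mu> a\<bar> \<ge> t})"
    using meas by (intro finite_measure_subadditive_finite) auto
  also have "\<dots> \<le> (\<Sum>a\<in>(UNIV :: 'a set). 2 * exp (- 2 * real N * t\<^sup>2 / (1 + 2 * \<gamma> * C)\<^sup>2))"
    by (intro sum_mono dev)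
  also have "\<dots> = 2 * real K * exp (- 2 * real N * t\<^sup>2 / (1 + 2 * \<gamma> * C)\<^sup>2)"
    by (simp add: K)
  finally show ?thesis .
qed

end
end
end
end

text \<open>Turns the high-probability guarantee of \<open>estimateQ\<close> into a bias bound for
  \<open>sampleV\<close>: a failure inside the recursion is paid for by its probability times the
  size of the integrand.\<close>

lemma (in prob_space) integral_abs_le_bad_event:
  fixes f :: "'a \<Rightarrow> real"
  assumes [measurable]: "f \<in> borel_measurable M" "Measurable.pred M R"
    and B: "AE x in M. \<bar>f x\<bar> \<le> B" and A: "AE x in M. \<not> R x \<longrightarrow> \<bar>f x\<bar> \<le> A" and "0 \<le> A"
  shows "\<bar>\<integral>x. f x \<partial>M\<bar> \<le> A + B * prob {x \<in> space M. R x}"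
proof -
  let ?g = "\<lambda>x. A + B * indicator {x \<in> space M. R x} x"
  have int: "integrable M f" using B by (intro integrable_const_bound[where B=B]) auto
  have "\<bar>\<integral>x. f x \<partial>M\<bar> \<le> (\<integral>x. \<bar>f x\<bar> \<partial>M)"
    by (rule integral_abs_bound)
  also have "\<dots> \<le> (\<integral>x. ?g x \<partial>M)"
  proof (rule integral_mono_AE)
    show "AE x in M. \<bar>f x\<bar> \<le> ?g x"
      using A B AE_space by eventually_elim (use \<open>0 \<le> A\<close> in \<open>auto split: split_indicator\<close>)
  qed (use int in \<open>auto intro!: Bochner_Integration.integrable_add integrable_mult_right integrable_real_indicator simp: emeasure_eq_measure\<close>)
  also have "\<dots> = A + B * prob {x \<in> space M. R x}"
    by (subst Bochner_Integration.integral_add) (auto simp: prob_space emeasure_eq_measure intro!: integrable_mult_right integrable_real_indicator)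
  finally show ?thesis .
qed

lemma measurable_point_measure_prob_algebra:
  fixes p :: "'b \<Rightarrow> real ^ 'a::finite"
  assumes [measurable]: "p \<in> borel_measurable M"
    and "\<And>x a. x \<in> space M \<Longrightarrow> 0 \<le> p x $ a" "\<And>x. x \<in> space M \<Longrightarrow> (\<Sum>a\<in>UNIV. p x $ a) = 1"
  shows "(\<lambda>x. point_measure UNIV (\<lambda>a. ennreal (p x $ a))) \<in> M \<rightarrow>\<^sub>M prob_algebra (count_space UNIV)"
proof (rule measurable_prob_algebra_generated[where \<Omega> = UNIV and G = UNIV])
  fix x assume "x \<in> space M"
  then show "prob_space (point_measure UNIV (\<lambda>a. ennreal (p x $ a)))"
    using assms by (intro prob_spaceI) (simp add: emeasure_point_measure_finite space_point_measure sum_ennreal)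
next
  fix A :: "'a set"
  show "(\<lambda>x. emeasure (point_measure UNIV (\<lambda>a. ennreal (p x $ a))) A) \<in> borel_measurable M"
    by (simp add: emeasure_point_measure_finite)
qed (auto simp: Int_stable_def sets_point_measure intro: sigma_sets.Basic)

section \<open>The one-sample branch of \<open>sampleV\<close>\<close>

context regularized_game
begin

definition shift :: "(real \<times> nat) measure \<Rightarrow> real \<Rightarrow> nat \<Rightarrow> (real \<times> nat) measure" where
  "shift M c k = distr M RN (\<lambda>y. (c + fst y, k + snd y))"

text \<open>The continuation of the third branch of \<open>sampleV\<close> once the crude estimate
  \<open>fst x\<close> and its call count \<open>snd x\<close> are known; the branch is then a
  single bind of two kernels.\<close>

definition one_sample :: "('s \<Rightarrow> (real \<times> nat) measure) \<Rightarrow> 's \<Rightarrow> (real ^ 'a) \<times> nat \<Rightarrow> (real \<times> nat) measure" where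
  "one_sample W s x = point_measure UNIV (\<lambda>a. ennreal (grad (F s) (fst x) $ a)) \<bind>
     (\<lambda>a. shift (backup W s a) (F s (fst x) - fst x \<bullet> grad (F s) (fst x)) (snd x))"

context
  fixes W :: "'s \<Rightarrow> (real \<times> nat) measure"
  assumes W: "W \<in> S \<rightarrow>\<^sub>M prob_algebra RN"
begin

lemma one_sample_eq:
  assumes s: "s \<in> space S"
  shows "(\<lambda>(q, n). point_measure UNIV (\<lambda>a. ennreal (grad (F s) q $ a)) \<bind> (\<lambda>a. backup W s a \<bind>
     (\<lambda>(y, m). return RN (F s q - q \<bullet> grad (F s) q + y, n + m)))) = one_sample W s"
proof -
  have "backup W s a \<bind> (\<lambda>(y, m). return RN (c + y, k + m)) = shift (backup W s a) c k" for a c and k :: nat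
  proof -
    have "space (backup W s a) \<noteq> {}"
      using prob_algebraD(3)[OF measurable_backup[OF W] s] by (simp add: space_pair_measure)
    then have "backup W s a \<bind> (\<lambda>x. return RN (c + fst x, k + snd x)) = shift (backup W s a) c k"
      unfolding shift_def by (intro bind_return_distr') (auto simp: measurable_backup_eq[OF W s])
    then show ?thesis by (simp add: case_prod_beta')
  qed
  then show ?thesis by (simp add: fun_eq_iff one_sample_def)
qed

lemma measurable_shift [measurable (raw)]:
  assumes [measurable]: "f \<in> M \<rightarrow>\<^sub>M prob_algebra RN" "g \<in> borel_measurable M" "h \<in> M \<rightarrow>\<^sub>M count_space UNIV"
  shows "(\<lambda>x. shift (f x) (g x) (h x)) \<in> M \<rightarrow>\<^sub>M prob_algebra RN"
  unfolding shift_def by measurable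

lemma measurable_one_sample_pair: "(\<lambda>(s, x). one_sample W s x) \<in> S \<Otimes>\<^sub>M QN \<rightarrow>\<^sub>M prob_algebra RN"
  unfolding one_sample_def case_prod_beta'
proof (rule measurable_bind_prob_space2[OF measurable_point_measure_prob_algebra])
  show "(\<lambda>x. grad (F (fst x)) (fst (snd x))) \<in> borel_measurable (S \<Otimes>\<^sub>M QN)" by measurable
  \<comment> \<open>The action is held fixed first: joint measurability in state, estimate and
    action follows from measurability for each of the finitely many actions.\<close>
  have "(\<lambda>y. shift (backup W (fst (fst y)) a)
            (F (fst (fst y)) (fst (snd (fst y))) - fst (snd (fst y)) \<bullet> grad (F (fst (fst y))) (fst (snd (fst y))))
            (snd (snd (fst y)))) \<in> (S \<Otimes>\<^sub>M QN) \<Otimes>\<^sub>M count_space UNIV \<rightarrow>\<^sub>M prob_algebra RN" for a :: 'a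
    using measurable_backup[OF W, of a] by measurable
  then show "(\<lambda>(x, a). shift (backup W (fst x) a) (F (fst x) (fst (snd x)) - fst (snd x) \<bullet> grad (F (fst x)) (fst (snd x)))
          (snd (snd x))) \<in> (S \<Otimes>\<^sub>M QN) \<Otimes>\<^sub>M count_space UNIV \<rightarrow>\<^sub>M prob_algebra RN"
    unfolding case_prod_beta'
    by (rule measurable_compose_countable'[where I = UNIV and f = "\<lambda>a y. shift (backup W (fst (fst y)) a)
            (F (fst (fst y)) (fst (snd (fst y))) - fst (snd (fst y)) \<bullet> grad (F (fst (fst y))) (fst (snd (fst y))))
            (snd (snd (fst y)))"]) (auto intro: countable_finite)
qed (simp_all add: grad_F_nonneg sum_grad_F)

context
  fixes s assumes s: "s \<in> space S"
begin

lemma measurable_one_sample: "one_sample W s \<in> QN \<rightarrow>\<^sub>M prob_algebra RN"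
  using measurable_compose[OF measurable_Pair1'[OF s] measurable_one_sample_pair] by simp

lemma policy_prob: "point_measure UNIV (\<lambda>a. ennreal (grad (F s) q $ a)) \<in> space (prob_algebra (count_space UNIV))"
  using measurable_space[OF measurable_point_measure_prob_algebra[of "\<lambda>_::unit. grad (F s) q" "count_space UNIV"], of "()"]
  by (simp add: grad_F_nonneg sum_grad_F)

lemma measurable_shift_backup: "(\<lambda>a. shift (backup W s a) c k) \<in> count_space UNIV \<rightarrow>\<^sub>M prob_algebra RN"
proof -
  have "shift (backup W s a) c k \<in> space (prob_algebra RN)" for a
    using measurable_space[OF measurable_backup[OF W] s, of a]
      measurable_space[OF measurable_shift[of "\<lambda>_. backup W s a" "count_space UNIV" "\<lambda>_. c" "\<lambda>_. k"], of "()"] by simp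
  then show ?thesis by simp
qed

context
  fixes C :: real and n :: nat
  assumes W_AE: "\<And>z. z \<in> space S \<Longrightarrow> AE x in W z. \<bar>fst x\<bar> \<le> C \<and> snd x = n" and C: "0 \<le> C"
begin

lemma AE_backup'': "AE x in backup W s a. fst x \<in> {- (\<gamma> * C)..1 + \<gamma> * C} \<and> snd x = Suc n"
  by (rule AE_backup[OF W _ s]) (rule W_AE)

lemma AE_one_sample: "AE y in one_sample W s x. \<bar>fst y\<bar> \<le> 1 + Mlam + \<gamma> * C \<and> snd y = snd x + Suc n"
proof -
  let ?c = "F s (fst x) - fst x \<bullet> grad (F s) (fst x)"
  let ?P = "\<lambda>y. \<bar>fst y\<bar> \<le> 1 + Mlam + \<gamma> * C \<and> snd y = snd x + Suc n"
  have "AE y in shift (backup W s a) ?c (snd x). ?P y" for a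
  proof -
    have "AE y in backup W s a. ?P (?c + fst y, snd x + snd y)"
      using AE_backup''
      by eventually_elim (use F_minus_inner[of s "fst x"] mult_nonneg_nonneg[of \<gamma> C] gamma C in auto)
    then show ?thesis
      unfolding shift_def by (subst AE_distr_iff) (auto simp: measurable_backup_eq[OF W s])
  qed
  moreover have "Measurable.pred RN ?P" by measurable
  ultimately show ?thesis
    unfolding one_sample_def
    by (subst AE_bind_prob_algebra[OF policy_prob measurable_shift_backup]) auto
qed

lemma integrable_backup: "integrable (backup W s a) fst"
proof -
  interpret prob_space "backup W s a" by (rule prob_space_backup[OF W s])
  show ?thesis
  proof (rule integrable_const_bound)
    show "AE x in backup W s a. norm (fst x) \<le> 1 + \<gamma> * C"
      using AE_backup''
      by eventually_elim (use mult_nonneg_nonneg[of \<gamma> C] gamma C in auto)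
  qed (simp add: measurable_backup_eq[OF W s])
qed

text \<open>Drawing the action from the gradient makes one sample of one action an unbiased
  substitute for a sum over all actions. The result is the tangent of \<open>F s\<close> at the
  crude estimate, evaluated at the vector of backup means.\<close>

lemma integral_one_sample:
  "(\<integral>y. fst y \<partial>one_sample W s x) = F s (fst x) - fst x \<bullet> grad (F s) (fst x)
     + grad (F s) (fst x) \<bullet> (\<chi> a. \<integral>y. fst y \<partial>backup W s a)"
proof -
  let ?c = "F s (fst x) - fst x \<bullet> grad (F s) (fst x)"
  let ?p = "grad (F s) (fst x)"
  have sh: "(\<integral>y. fst y \<partial>shift (backup W s a) ?c (snd x)) = ?c + (\<integral>y. fst y \<partial>backup W s a)" for a
  proof -
    interpret prob_space "backup W s a" by (rule prob_space_backup[OF W s])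
    have "(\<integral>y. fst y \<partial>shift (backup W s a) ?c (snd x)) = (\<integral>y. ?c + fst y \<partial>backup W s a)"
      unfolding shift_def by (subst integral_distr) (auto simp: measurable_backup_eq[OF W s])
    also have "\<dots> = ?c + (\<integral>y. fst y \<partial>backup W s a)"
      by (simp add: integrable_backup prob_space)
    finally show ?thesis .
  qed
  have "(\<integral>y. fst y \<partial>one_sample W s x) = (\<integral>a. (\<integral>y. fst y \<partial>shift (backup W s a) ?c (snd x)) \<partial>point_measure UNIV (\<lambda>a. ennreal (?p $ a)))"
    unfolding one_sample_def
  proof (rule integral_bind_AE_bounded[OF policy_prob measurable_shift_backup])
    have "AE y in one_sample W s x. \<bar>fst y\<bar> \<le> 1 + Mlam + \<gamma> * C"
      using AE_one_sample by eventually_elim simp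
    then show "AE a in point_measure UNIV (\<lambda>a. ennreal (?p $ a)). AE y in shift (backup W s a) ?c (snd x). \<bar>fst y\<bar> \<le> 1 + Mlam + \<gamma> * C"
      unfolding one_sample_def by (subst (asm) AE_bind_prob_algebra[OF policy_prob measurable_shift_backup]) simp
  qed simp
  also have "\<dots> = (\<Sum>a\<in>UNIV. ?p $ a * (?c + (\<integral>y. fst y \<partial>backup W s a)))"
    unfolding sh by (subst lebesgue_integral_point_measure_finite) (auto simp: grad_F_nonneg)
  also have "\<dots> = (\<Sum>a\<in>UNIV. ?p $ a) * ?c + ?p \<bullet> (\<chi> a. \<integral>y. fst y \<partial>backup W s a)"
    by (simp only: distrib_left sum.distrib sum_distrib_right inner_vec_def vec_lambda_beta inner_real_def)
  finally show ?thesis by (simp add: sum_grad_F)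
qed

lemma one_sample_mean_abs_le: "\<bar>\<integral>y. fst y \<partial>one_sample W s x\<bar> \<le> 1 + Mlam + \<gamma> * C"
proof -
  have p: "prob_space (one_sample W s x)" "measurable (one_sample W s x) borel = measurable RN borel"
    using prob_algebraD[OF measurable_one_sample, of x] by (auto simp: space_pair_measure intro!: measurable_cong_sets)
  interpret prob_space "one_sample W s x" by fact
  have int: "integrable (one_sample W s x) fst"
    using AE_one_sample p by (intro integrable_const_bound[where B="1 + Mlam + \<gamma> * C"]) auto
  have "AE y in one_sample W s x. fst y \<le> 1 + Mlam + \<gamma> * C"
    using AE_one_sample by eventually_elim auto
  moreover have "AE y in one_sample W s x. - (1 + Mlam + \<gamma> * C) \<le> fst y"
    using AE_one_sample by eventually_elim auto
  ultimately show ?thesis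
    using integral_le_const[OF int, of "1 + Mlam + \<gamma> * C"] integral_ge_const[OF int, of "- (1 + Mlam + \<gamma> * C)"]
    by linarith
qed

text \<open>Two errors add up: the remainder of the first-order expansion, quadratic in D, and the
  bias of the backups, which a probability vector averages without amplifying. The quadratic
  remainder is why a crude estimate with D of order sqrt \<epsilon> is good enough.\<close>

lemma one_sample_bias:
  assumes bias: "\<And>a. \<bar>(\<integral>y. fst y \<partial>backup W s a) - q $ a\<bar> \<le> \<eta>"
    and D: "\<And>a. \<bar>fst x $ a - q $ a\<bar> \<le> D"
  shows "\<bar>(\<integral>y. fst y \<partial>one_sample W s x) - F s q\<bar> \<le> D\<^sup>2 / (2 * lam) + \<eta>"
proof -
  let ?p = "grad (F s) (fst x)" and ?y = "\<chi> a. \<integral>y. fst y \<partial>backup W s a"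
  have "\<bar>?p \<bullet> (?y - q)\<bar> \<le> (\<Sum>a\<in>UNIV. ?p $ a * \<eta>)"
    unfolding inner_vec_def using bias
    by (intro order_trans[OF sum_abs] sum_mono) (auto simp: abs_mult grad_F_nonneg intro: mult_left_mono)
  then have "\<bar>?p \<bullet> (?y - q)\<bar> \<le> \<eta>" by (simp add: sum_grad_F flip: sum_distrib_right)
  moreover have "\<bar>F s q - (F s (fst x) + ?p \<bullet> (q - fst x))\<bar> \<le> D\<^sup>2 / (2 * lam)"
    using D by (intro F_tangent) (simp add: abs_minus_commute)
  moreover have "(\<integral>y. fst y \<partial>one_sample W s x) - F s q = ?p \<bullet> (?y - q) - (F s q - (F s (fst x) + ?p \<bullet> (q - fst x)))"
    by (simp add: integral_one_sample inner_diff_right inner_commute[of "fst x"])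
  ultimately show ?thesis by linarith
qed

end
end
end

subsection \<open>The recursion\<close>

text \<open>The number of divisions by sqrt \<gamma> after which the accuracy reaches
  \<open>qmax\<close> and \<open>sampleV\<close> returns 0. The crude estimate of the third branch
  starts from a coarser accuracy, so its recursion is no deeper.\<close>

definition depth :: "real \<Rightarrow> nat" where
  "depth \<epsilon> = nat \<lceil>ln (qmax / \<epsilon>) / - ln (sqrt \<gamma>)\<rceil>"

lemma sqrt_gamma: "0 < sqrt \<gamma>" "sqrt \<gamma> < 1"
  using gamma by auto

lemma ln_sqrt_gamma: "0 < - ln (sqrt \<gamma>)"
  using sqrt_gamma by simp

lemma qmax_pos: "0 < qmax"
  using qmax_ge_1 by linarith

lemma kappa_pos: "0 < \<kappa>"
  using sqrt_gamma lam by (simp add: K)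

lemma depth_antimono: "depth y \<le> depth x" if "0 < x" "x \<le> y"
proof -
  have "qmax / y \<le> qmax / x"
    using that qmax_pos by (intro divide_left_mono) auto
  moreover have "0 < qmax / y"
    using that by (intro divide_pos_pos[OF qmax_pos]) auto
  ultimately have "ln (qmax / y) \<le> ln (qmax / x)"
    by (rule ln_mono)
  then show ?thesis
    unfolding depth_def using ln_sqrt_gamma by (intro nat_mono ceiling_mono divide_right_mono) auto
qed

text \<open>For x < qmax the ceiling is positive, so the truncation to \<open>nat\<close> does not
  swallow the subtraction of 1. Equality lets each level account for exactly one factor in the crude
  cost bound.\<close>

lemma depth_step: "Suc (depth (x / sqrt \<gamma>)) = depth x" if "0 < x" "x < qmax"
proof -
  have "ln (qmax / (x / sqrt \<gamma>)) = ln (qmax / x) + ln (sqrt \<gamma>)"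
  proof -
    have "qmax / (x / sqrt \<gamma>) = (qmax / x) * sqrt \<gamma>" by simp
    moreover have "0 < qmax / x"
      using that by (intro divide_pos_pos[OF qmax_pos])
    ultimately show ?thesis
      using sqrt_gamma by (simp only: ln_mult_pos)
  qed
  then have "ln (qmax / (x / sqrt \<gamma>)) / - ln (sqrt \<gamma>) = ln (qmax / x) / - ln (sqrt \<gamma>) - 1"
    using ln_sqrt_gamma by (simp add: field_simps)
  then have "depth (x / sqrt \<gamma>) = nat (\<lceil>ln (qmax / x) / - ln (sqrt \<gamma>)\<rceil> - 1)"
    by (simp only: depth_def ceiling_diff_one)
  moreover have "0 < ln (qmax / x)"
    using that by (intro ln_gt_zero) (simp only: less_divide_eq_1_pos)
  then have "0 < ln (qmax / x) / - ln (sqrt \<gamma>)"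
    using ln_sqrt_gamma by (rule divide_pos_pos)
  then have "0 < \<lceil>ln (qmax / x) / - ln (sqrt \<gamma>)\<rceil>"
    by (simp only: zero_less_ceiling)
  ultimately show ?thesis
    unfolding depth_def by linarith
qed

lemma le_sqrt_mult: "x \<le> sqrt (k * x)" if "0 < x" "x < k" for x k :: real
  using that by (intro real_le_rsqrt) (simp add: power2_eq_square mult_right_mono)

text \<open>The count component of the joint law is almost surely constant, and this is the
  constant. \<open>Suc\<close> adds the oracle call that precedes each inner run.\<close>

function calls :: "real \<Rightarrow> real \<Rightarrow> nat" where
  "calls \<delta>' \<epsilon> =
    (if \<epsilon> \<le> 0 \<or> \<epsilon> \<ge> qmax then 0
     else if \<epsilon> \<ge> \<kappa> then K * nsamples \<delta>' \<epsilon> * Suc (calls \<delta>' (\<epsilon> / sqrt \<gamma>))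
     else K * nsamples \<delta>' (sqrt (\<kappa> * \<epsilon>)) * Suc (calls \<delta>' (sqrt (\<kappa> * \<epsilon>) / sqrt \<gamma>)) + Suc (calls \<delta>' (\<epsilon> / sqrt \<gamma>)))"
  by pat_completeness auto
termination
proof (relation "Wellfounded.measure (\<lambda>(\<delta>', \<epsilon>). depth \<epsilon>)", goal_cases)
  case (2 \<delta>' \<epsilon>)
  then show ?case using depth_step[of \<epsilon>] by simp
next
  case (3 \<delta>' \<epsilon>)
  then have "depth (sqrt (\<kappa> * \<epsilon>) / sqrt \<gamma>) \<le> depth (\<epsilon> / sqrt \<gamma>)"
    using sqrt_gamma le_sqrt_mult[of \<epsilon> \<kappa>] by (intro depth_antimono divide_right_mono) auto
  then show ?case using 3 depth_step[of \<epsilon>] by simp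
next
  case (4 \<delta>' \<epsilon>)
  then show ?case using depth_step[of \<epsilon>] by simp
qed simp

declare calls.simps [simp del] sampleV.simps [simp del] estimateQ.simps [simp del]

definition calls_Q :: "real \<Rightarrow> real \<Rightarrow> nat" where
  "calls_Q \<delta>' \<epsilon> = K * nsamples \<delta>' \<epsilon> * Suc (calls \<delta>' (\<epsilon> / sqrt \<gamma>))"

text \<open>Induction along the three branches of \<open>sampleV\<close>, with positivity of all
  accuracies built in.\<close>

lemma accuracy_induct [consumes 1, case_names large middle small]:
  assumes "0 < \<epsilon>"
    and large: "\<And>\<epsilon>. 0 < \<epsilon> \<Longrightarrow> qmax \<le> \<epsilon> \<Longrightarrow> R \<epsilon>"
    and middle: "\<And>\<epsilon>. 0 < \<epsilon> \<Longrightarrow> \<epsilon> < qmax \<Longrightarrow> \<kappa> \<le> \<epsilon> \<Longrightarrow> R (\<epsilon> / sqrt \<gamma>) \<Longrightarrow> R \<epsilon>"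
    and small: "\<And>\<epsilon>. 0 < \<epsilon> \<Longrightarrow> \<epsilon> < qmax \<Longrightarrow> \<epsilon> < \<kappa> \<Longrightarrow> R (sqrt (\<kappa> * \<epsilon>) / sqrt \<gamma>) \<Longrightarrow> R (\<epsilon> / sqrt \<gamma>) \<Longrightarrow> R \<epsilon>"
  shows "R \<epsilon>"
  using \<open>0 < \<epsilon>\<close>
\<comment> \<open>The first argument of \<open>calls\<close> is passed on unchanged, so a dummy
  value serves.\<close>
proof (induction "1::real" \<epsilon> rule: calls.induct)
  case (1 \<epsilon>)
  have "0 < sqrt (\<kappa> * \<epsilon>)"
    using 1(4) kappa_pos by (simp only: real_sqrt_gt_0_iff mult_pos_pos)
  then have pos: "0 < \<epsilon> / sqrt \<gamma>" "0 < sqrt (\<kappa> * \<epsilon>) / sqrt \<gamma>"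
    by (intro divide_pos_pos[OF _ sqrt_gamma(1)] 1(4))+
  consider "qmax \<le> \<epsilon>" | "\<epsilon> < qmax" "\<kappa> \<le> \<epsilon>" | "\<epsilon> < qmax" "\<epsilon> < \<kappa>" by linarith
  then show ?case
  proof cases
    assume "qmax \<le> \<epsilon>"
    show ?thesis by (rule large) fact+
  next
    assume *: "\<epsilon> < qmax" "\<kappa> \<le> \<epsilon>"
    have "\<not> (\<epsilon> \<le> 0 \<or> qmax \<le> \<epsilon>)" using * 1(4) by linarith
    then have "R (\<epsilon> / sqrt \<gamma>)" using *(2) pos(1) by (rule 1(1))
    with 1(4) * show ?thesis by (rule middle)
  next
    assume *: "\<epsilon> < qmax" "\<epsilon> < \<kappa>"
    have neg: "\<not> (\<epsilon> \<le> 0 \<or> qmax \<le> \<epsilon>)" "\<not> \<kappa> \<le> \<epsilon>" using * 1(4) by linarith+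
    have "R (sqrt (\<kappa> * \<epsilon>) / sqrt \<gamma>)" using neg pos(2) by (rule 1(2))
    with 1(4) * show ?thesis
    proof (rule small)
      show "R (\<epsilon> / sqrt \<gamma>)" using neg pos(1) by (rule 1(3))
    qed
  qed
qed

lemma estimateQ_eq:
  "0 < \<epsilon> \<Longrightarrow> estimateQ lo \<delta>' \<epsilon> = average lo (nsamples \<delta>' \<epsilon>) (sampleV lo \<delta>' (\<epsilon> / sqrt \<gamma>))"
  by (rule ext) (simp add: estimateQ.simps average_def Let_def)

definition reg_value :: "((real ^ 'a) \<times> nat) measure \<Rightarrow> 's \<Rightarrow> (real \<times> nat) measure" where
  "reg_value E s = distr E RN (\<lambda>x. (F s (fst x), snd x))"

lemma bind_return_reg_value:
  assumes "sets E = sets QN" and s: "s \<in> space S"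
  shows "E \<bind> (\<lambda>(q, n). return RN (F s q, n)) = reg_value E s"
proof -
  have "(\<lambda>x. (F s (fst x), snd x)) \<in> QN \<rightarrow>\<^sub>M RN" using s by measurable
  then have "(\<lambda>x. (F s (fst x), snd x)) \<in> E \<rightarrow>\<^sub>M RN"
    using assms by (simp cong: measurable_cong_sets)
  moreover have "space E \<noteq> {}"
    using sets_eq_imp_space_eq[OF assms(1)] by (simp add: space_pair_measure)
  ultimately have "E \<bind> (\<lambda>x. return RN (F s (fst x), snd x)) = reg_value E s"
    unfolding reg_value_def by (rule bind_return_distr'[rotated])
  then show ?thesis by (simp add: case_prod_beta')
qed

lemma sampleV_large: "0 < \<epsilon> \<Longrightarrow> qmax \<le> \<epsilon> \<Longrightarrow> sampleV lo \<delta>' \<epsilon> = (\<lambda>_. return RN (0, 0))"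
  by (rule ext) (simp add: sampleV.simps)

text \<open>Rewriting bind and return into \<open>distr\<close> requires the inner sampler to be a
  measurable kernel. Hence the assumption, which the induction over the accuracy supplies.\<close>

lemma sampleV_middle:
  assumes "0 < \<epsilon>" "\<epsilon> < qmax" "\<kappa> \<le> \<epsilon>" "sampleV lo \<delta>' (\<epsilon> / sqrt \<gamma>) \<in> S \<rightarrow>\<^sub>M prob_algebra RN" "s \<in> space S"
  shows "sampleV lo \<delta>' \<epsilon> s = reg_value (estimateQ lo \<delta>' \<epsilon> s) s"
proof -
  have "sets (estimateQ lo \<delta>' \<epsilon> s) = sets QN"
    using prob_algebraD[OF measurable_average[OF assms(4)] assms(5)] assms(1) by (simp add: estimateQ_eq)
  then show ?thesis
    using assms by (subst sampleV.simps) (simp add: bind_return_reg_value)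
qed

lemma sampleV_small:
  assumes "0 < \<epsilon>" "\<epsilon> < qmax" "\<epsilon> < \<kappa>" "sampleV lo \<delta>' (\<epsilon> / sqrt \<gamma>) \<in> S \<rightarrow>\<^sub>M prob_algebra RN" "s \<in> space S"
  shows "sampleV lo \<delta>' \<epsilon> s = estimateQ lo \<delta>' (sqrt (\<kappa> * \<epsilon>)) s \<bind> one_sample (sampleV lo \<delta>' (\<epsilon> / sqrt \<gamma>)) s"
  using assms by (subst sampleV.simps) (simp add: Let_def one_sample_eq)

lemma measurable_reg_value:
  assumes [measurable]: "E \<in> S \<rightarrow>\<^sub>M prob_algebra QN"
  shows "(\<lambda>s. reg_value (E s) s) \<in> S \<rightarrow>\<^sub>M prob_algebra RN"
  unfolding reg_value_def by measurable

lemma measurable_reg_value_map: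
  assumes "E \<in> space (prob_algebra QN)" "s \<in> space S"
  shows "(\<lambda>x. (F s (fst x), snd x)) \<in> E \<rightarrow>\<^sub>M RN"
proof -
  have "(\<lambda>x. (F s (fst x), snd x)) \<in> QN \<rightarrow>\<^sub>M RN" using assms by measurable
  then show ?thesis using assms by (simp add: space_prob_algebra cong: measurable_cong_sets)
qed

lemma AE_reg_value:
  assumes E: "E \<in> space (prob_algebra QN)" and s: "s \<in> space S"
    and AE: "AE x in E. (\<forall>a. \<bar>fst x $ a\<bar> \<le> qmax) \<and> snd x = n"
  shows "AE x in reg_value E s. \<bar>fst x\<bar> \<le> vmax \<and> snd x = n"
proof -
  have "AE x in E. \<bar>fst (F s (fst x), snd x)\<bar> \<le> vmax \<and> snd (F s (fst x), snd x) = n"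
    using AE by eventually_elim (simp add: vmax_def F_abs_le)
  moreover have "{x \<in> space RN. \<bar>fst x\<bar> \<le> vmax \<and> snd x = n} \<in> sets RN" by measurable
  ultimately show ?thesis
    unfolding reg_value_def using measurable_reg_value_map[OF E s] by (subst AE_distr_iff) auto
qed

text \<open>The invariant \<bar>output\<bar> \<le> vmax survives the one-sample branch because
  \<open>vmax\<close> is not below the fixed point \<open>qmax\<close>. The value qmax + Mlam itself
  is dictated by the second branch, which applies \<open>F\<close> to a clipped vector.\<close>

lemma vmax_step: "1 + Mlam + \<gamma> * vmax \<le> vmax"
proof -
  have "1 + Mlam + \<gamma> * vmax = qmax + \<gamma> * Mlam"
    using qmax_eq by (simp only: vmax_def distrib_left)
  then show ?thesis
    using mult_right_mono[of \<gamma> 1 Mlam] gamma Mlam_nonneg unfolding vmax_def by linarith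
qed

lemma vmax_nonneg: "0 \<le> vmax"
  using qmax_le_vmax qmax_pos by linarith

context
  fixes lo :: real and \<delta>' :: real
  assumes lo: "- qmax \<le> lo" "lo \<le> qmax"
begin

text \<open>Measurability, size and cost are proved together: the equation for a branch needs
  measurable recursive calls, and its almost sure bound and count come from theirs.\<close>

lemma sampleV_spec:
  assumes "0 < \<epsilon>"
  shows "sampleV lo \<delta>' \<epsilon> \<in> S \<rightarrow>\<^sub>M prob_algebra RN \<and>
    (\<forall>s\<in>space S. AE x in sampleV lo \<delta>' \<epsilon> s. \<bar>fst x\<bar> \<le> vmax \<and> snd x = calls \<delta>' \<epsilon>)"
  using assms
proof (induction \<epsilon> rule: accuracy_induct)
  case (large \<epsilon>)
  have "Measurable.pred RN (\<lambda>x. \<bar>fst x\<bar> \<le> vmax \<and> snd x = calls \<delta>' \<epsilon>)" by measurable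
  then have "AE x in return RN (0, 0). \<bar>fst x\<bar> \<le> vmax \<and> snd x = calls \<delta>' \<epsilon>"
    using large vmax_nonneg by (subst AE_return) (auto simp: calls.simps space_pair_measure)
  moreover have "return RN (0, 0) \<in> space (prob_algebra RN)"
    by (simp add: space_prob_algebra prob_space_return space_pair_measure)
  ultimately show ?case
    unfolding sampleV_large[OF large] by (intro conjI ballI measurable_const)
next
  case (middle \<epsilon>)
  let ?W = "sampleV lo \<delta>' (\<epsilon> / sqrt \<gamma>)"
  note W = conjunct1[OF middle(4)] and AE = bspec[OF conjunct2[OF middle(4)]]
  have E: "estimateQ lo \<delta>' \<epsilon> \<in> S \<rightarrow>\<^sub>M prob_algebra QN"
    using middle(1) measurable_average[OF W] by (simp add: estimateQ_eq)
  have "sampleV lo \<delta>' \<epsilon> \<in> S \<rightarrow>\<^sub>M prob_algebra RN"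
    using measurable_reg_value[OF E] by (simp only: measurable_cong[OF sampleV_middle[OF middle(1-3) W]])
  moreover have "AE x in sampleV lo \<delta>' \<epsilon> s. \<bar>fst x\<bar> \<le> vmax \<and> snd x = calls \<delta>' \<epsilon>" if s: "s \<in> space S" for s
  proof -
    have "AE x in estimateQ lo \<delta>' \<epsilon> s. (\<forall>a. \<bar>fst x $ a\<bar> \<le> qmax) \<and> snd x = K * nsamples \<delta>' \<epsilon> * Suc (calls \<delta>' (\<epsilon> / sqrt \<gamma>))"
      unfolding estimateQ_eq[OF middle(1)] by (rule AE_average[OF W s AE lo])
    note AE_E = this
    have calls_eq: "calls \<delta>' \<epsilon> = K * nsamples \<delta>' \<epsilon> * Suc (calls \<delta>' (\<epsilon> / sqrt \<gamma>))"
      using middle(1-3) by (subst calls.simps) auto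
    show ?thesis
      unfolding sampleV_middle[OF middle(1-3) W s] calls_eq by (rule AE_reg_value[OF measurable_space[OF E s] s AE_E])
  qed
  ultimately show ?case by blast
next
  case (small \<epsilon>)
  let ?e = "sqrt (\<kappa> * \<epsilon>)"
  let ?W = "sampleV lo \<delta>' (\<epsilon> / sqrt \<gamma>)" and ?W' = "sampleV lo \<delta>' (?e / sqrt \<gamma>)"
  have e: "0 < ?e" using small(1) kappa_pos by (simp only: real_sqrt_gt_0_iff mult_pos_pos)
  note W = conjunct1[OF small(5)] and AE = bspec[OF conjunct2[OF small(5)]]
    and W' = conjunct1[OF small(4)] and AE' = bspec[OF conjunct2[OF small(4)]]
  have E: "estimateQ lo \<delta>' ?e \<in> S \<rightarrow>\<^sub>M prob_algebra QN"
    using measurable_average[OF W'] by (simp only: estimateQ_eq[OF e])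
  have "(\<lambda>s. estimateQ lo \<delta>' ?e s \<bind> one_sample ?W s) \<in> S \<rightarrow>\<^sub>M prob_algebra RN"
    by (rule measurable_bind_prob_space2[OF E measurable_one_sample_pair[OF W]])
  then have "sampleV lo \<delta>' \<epsilon> \<in> S \<rightarrow>\<^sub>M prob_algebra RN"
    by (simp only: measurable_cong[OF sampleV_small[OF small(1-3) W]])
  moreover have "AE x in sampleV lo \<delta>' \<epsilon> s. \<bar>fst x\<bar> \<le> vmax \<and> snd x = calls \<delta>' \<epsilon>" if s: "s \<in> space S" for s
  proof -
    have calls_eq: "calls \<delta>' \<epsilon> = K * nsamples \<delta>' ?e * Suc (calls \<delta>' (?e / sqrt \<gamma>)) + Suc (calls \<delta>' (\<epsilon> / sqrt \<gamma>))"
      using small(1-3) by (subst calls.simps) auto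
    have "AE x in estimateQ lo \<delta>' ?e s. (\<forall>a. \<bar>fst x $ a\<bar> \<le> qmax) \<and> snd x = K * nsamples \<delta>' ?e * Suc (calls \<delta>' (?e / sqrt \<gamma>))"
      unfolding estimateQ_eq[OF e] by (rule AE_average[OF W' s AE' lo])
    then have "AE x in estimateQ lo \<delta>' ?e s. AE y in one_sample ?W s x. \<bar>fst y\<bar> \<le> vmax \<and> snd y = calls \<delta>' \<epsilon>"
    proof eventually_elim
      case (elim x)
      have "AE y in one_sample ?W s x. \<bar>fst y\<bar> \<le> 1 + Mlam + \<gamma> * vmax \<and> snd y = snd x + Suc (calls \<delta>' (\<epsilon> / sqrt \<gamma>))"
        by (rule AE_one_sample[OF W s AE vmax_nonneg])
      then show ?case
      proof eventually_elim
        case (elim y)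
        have "snd x = K * nsamples \<delta>' ?e * Suc (calls \<delta>' (?e / sqrt \<gamma>))"
          by (rule conjunct2) fact
        with elim show ?case
          using vmax_step unfolding calls_eq by linarith
      qed
    qed
    moreover have "Measurable.pred RN (\<lambda>y. \<bar>fst y\<bar> \<le> vmax \<and> snd y = calls \<delta>' \<epsilon>)" by measurable
    ultimately show ?thesis
      unfolding sampleV_small[OF small(1-3) W s]
      by (simp only: AE_bind_prob_algebra[OF measurable_space[OF E s] measurable_one_sample[OF W s]])
  qed
  ultimately show ?case by blast
qed

lemma measurable_sampleV: "0 < \<epsilon> \<Longrightarrow> sampleV lo \<delta>' \<epsilon> \<in> S \<rightarrow>\<^sub>M prob_algebra RN"
  using sampleV_spec by blast

lemma AE_sampleV: "0 < \<epsilon> \<Longrightarrow> s \<in> space S \<Longrightarrow> AE x in sampleV lo \<delta>' \<epsilon> s. \<bar>fst x\<bar> \<le> vmax \<and> snd x = calls \<delta>' \<epsilon>"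
  using sampleV_spec by blast

lemma measurable_estimateQ: "0 < \<epsilon> \<Longrightarrow> estimateQ lo \<delta>' \<epsilon> \<in> S \<rightarrow>\<^sub>M prob_algebra QN"
  using sqrt_gamma by (simp add: estimateQ_eq measurable_average measurable_sampleV)

lemma AE_estimateQ:
  assumes "0 < \<epsilon>" "s \<in> space S"
  shows "AE x in estimateQ lo \<delta>' \<epsilon> s. (\<forall>a. \<bar>fst x $ a\<bar> \<le> qmax) \<and> snd x = calls_Q \<delta>' \<epsilon>"
proof -
  have e: "0 < \<epsilon> / sqrt \<gamma>" using assms sqrt_gamma by simp
  show ?thesis
    unfolding estimateQ_eq[OF assms(1)] calls_Q_def
    by (rule AE_average[OF measurable_sampleV[OF e] assms(2) AE_sampleV[OF e] lo])
qed

lemma smooth_cruiser_eq: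
  assumes "0 < \<epsilon>" "s \<in> space S"
  shows "smooth_cruiser lo \<delta>' \<epsilon> s = reg_value (estimateQ lo \<delta>' \<epsilon> s) s"
  unfolding smooth_cruiser_def
  using prob_algebraD[OF measurable_estimateQ assms(2)] assms by (intro bind_return_reg_value) auto

lemma smooth_cruiser_calls:
  assumes "0 < \<epsilon>" "s \<in> space S"
  shows "AE x in smooth_cruiser lo \<delta>' \<epsilon> s. snd x = calls_Q \<delta>' \<epsilon>"
  unfolding smooth_cruiser_eq[OF assms]
  using AE_reg_value[OF measurable_space[OF measurable_estimateQ[OF assms(1)] assms(2)] assms(2) AE_estimateQ[OF assms]]
  by eventually_elim simp

end

subsection \<open>Accuracy\<close>

text \<open>Relative error of \<open>estimateQ\<close> outside its failure event: sqrt \<gamma> is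
  the bias inherited from the samples, and five sixths of the remaining budget go to the sampling
  deviation. The last sixth is kept for the failure event.\<close>

definition \<rho> :: real where "\<rho> = sqrt \<gamma> + 5 / 6 * (1 - sqrt \<gamma>)"

lemma rho_bounds: "0 \<le> \<rho>" "\<rho> \<le> 1"
proof -
  have "0 \<le> g + 5 / 6 * (1 - g) \<and> g + 5 / 6 * (1 - g) \<le> 1" if "0 < g" "g < 1" for g :: real
    using that by (simp add: field_simps)
  then show "0 \<le> \<rho>" "\<rho> \<le> 1"
    unfolding \<rho>_def using sqrt_gamma by blast+
qed

context
  fixes V :: "'s \<Rightarrow> real"
  assumes V: "value_function V"
begin

lemma value_measurable: "V \<in> borel_measurable S"
  using V by (simp add: value_function_def)

lemma value_eq: "s \<in> space S \<Longrightarrow> V s = F s (Q V s)"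
  using V by (simp add: value_function_def)

lemma Q_abs_le:
  assumes s: "s \<in> space S" and "\<And>z. z \<in> space S \<Longrightarrow> \<bar>V z\<bar> \<le> C"
  shows "\<bar>Q V s $ a\<bar> \<le> 1 + \<gamma> * C"
proof -
  have "\<bar>\<integral>z. V z \<partial>P s a\<bar> \<le> C"
    by (rule integral_P_abs_le[OF s value_measurable assms(2)])
  then have "\<gamma> * \<bar>\<integral>z. V z \<partial>P s a\<bar> \<le> \<gamma> * C"
    using gamma by simp
  then have "\<bar>\<gamma> * (\<integral>z. V z \<partial>P s a)\<bar> \<le> \<gamma> * C"
    using gamma by (simp add: abs_mult)
  then show ?thesis
    using integral_Rew_bounds[OF s, of a] by (simp add: Q_def abs_le_iff)
qed

text \<open>The supremum c of \<bar>V\<bar> satisfies c \<le> 1 + \<gamma> * c + Mlam. This bounds c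
  because boundedness of V, part of \<open>value_function\<close>, makes c finite.\<close>

lemma value_abs_le_qmax:
  assumes s: "s \<in> space S"
  shows "\<bar>V s\<bar> \<le> qmax"
proof -
  obtain C where C: "\<And>z. z \<in> space S \<Longrightarrow> \<bar>V z\<bar> \<le> C"
    using V unfolding value_function_def by blast
  define c where "c = (SUP z\<in>space S. \<bar>V z\<bar>)"
  have bdd: "bdd_above ((\<lambda>z. \<bar>V z\<bar>) ` space S)"
    using C by (auto intro!: bdd_aboveI2)
  have le_c: "\<bar>V z\<bar> \<le> c" if "z \<in> space S" for z
    unfolding c_def using that bdd by (rule cSUP_upper)
  have "\<bar>V z\<bar> \<le> 1 + \<gamma> * c + Mlam" if "z \<in> space S" for z
    unfolding value_eq[OF that] by (rule F_abs_le) (rule Q_abs_le[OF that le_c])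
  then have "c \<le> 1 + \<gamma> * c + Mlam"
    unfolding c_def using s by (intro cSUP_least) auto
  then have "c \<le> qmax"
    using gamma by (simp add: pos_le_divide_eq algebra_simps)
  then show ?thesis using le_c[OF s] by linarith
qed

lemma Q_le_qmax:
  assumes s: "s \<in> space S"
  shows "\<bar>Q V s $ a\<bar> \<le> qmax"
  using Q_abs_le[OF s value_abs_le_qmax, of a] qmax_eq Mlam_nonneg by linarith

text \<open>Log-sum-exp dominates each of its arguments, so any single action gives V \<ge> \<gamma>
  * c for the infimum c of V; then c \<ge> \<gamma> * c forces c \<ge> 0.\<close>

lemma value_nonneg_if_no_minimizer:
  assumes "Mini \<inter> space S = {}" and s: "s \<in> space S"
  shows "0 \<le> V s"
proof -
  define c where "c = (INF z\<in>space S. V z)"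
  have bdd: "bdd_below (V ` space S)"
    using value_abs_le_qmax by (intro bdd_belowI2[of _ "- qmax"]) (auto simp: abs_le_iff minus_le_iff)
  have c_le: "c \<le> V z" if "z \<in> space S" for z
    unfolding c_def using that bdd by (intro cINF_lower)
  have "\<gamma> * c \<le> V z" if z: "z \<in> space S" for z
  proof -
    fix a :: 'a
    interpret prob_space "P z a" by (rule prob_space_P[OF z])
    have "c \<le> (\<integral>y. V y \<partial>P z a)"
      using integrable_P[OF z value_measurable value_abs_le_qmax] c_le
      by (intro integral_ge_const) (auto simp: space_P[OF z])
    then have "\<gamma> * c \<le> Q V z $ a"
      using gamma integral_Rew_bounds(1)[OF z, of a] by (simp add: Q_def add_increasing)
    also have "\<dots> \<le> lse lam (Q V z)"
      by (rule lse_ge_component[OF lam])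
    also have "\<dots> = V z"
      using value_eq[OF z] assms(1) z by (auto simp: F_eq)
    finally show ?thesis .
  qed
  then have "\<gamma> * c \<le> c"
    unfolding c_def using s by (intro cINF_greatest) auto
  then have "0 \<le> (1 - \<gamma>) * c" by (simp add: algebra_simps)
  then have "0 \<le> c"
    using gamma by (simp add: zero_le_mult_iff)
  then show ?thesis using c_le[OF s] by linarith
qed

context
  fixes lo :: real
  assumes floor: "valid_floor V lo"
begin

lemma floor_bounds: "- qmax \<le> lo" "lo \<le> qmax"
  using floor qmax_pos unfolding valid_floor_def by auto

text \<open>With \<open>Q_le_qmax\<close> this places the true Q-values inside the clipping
  interval, which is what makes clipping harmless.\<close>

lemma floor_le_Q:
  assumes s: "s \<in> space S"
  shows "lo \<le> Q V s $ a"
proof (cases "lo = - qmax")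
  case True
  then show ?thesis using Q_le_qmax[OF s, of a] by (simp add: abs_le_iff minus_le_iff)
next
  case False
  then have "lo = 0" and *: "Mini \<inter> space S = {} \<or> (\<forall>s\<in>space S. \<forall>a. 0 \<le> Q V s $ a)"
    using floor by (auto simp: valid_floor_def)
  have "0 \<le> Q V s $ a" if "Mini \<inter> space S = {}"
  proof -
    interpret prob_space "P s a" by (rule prob_space_P[OF s])
    have "0 \<le> (\<integral>z. V z \<partial>P s a)"
      using value_nonneg_if_no_minimizer[OF that] by (intro integral_nonneg_AE) (auto simp: space_P[OF s])
    then show ?thesis
      using gamma integral_Rew_bounds(1)[OF s, of a] by (simp add: Q_def)
  qed
  with * s \<open>lo = 0\<close> show ?thesis by auto
qed

context
  fixes \<delta>' :: real
  assumes \<delta>': "0 < \<delta>'" "\<delta>' < 1"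
begin

lemma log_pos: "0 < ln (2 * real K / \<delta>')"
proof -
  have "1 < 2 * real K / \<delta>'"
  proof -
    have "1 \<le> real K" by (simp add: K Suc_leI)
    then have "\<delta>' < 2 * real K" using \<delta>' by linarith
    then show ?thesis using \<delta>' by (simp add: less_divide_eq)
  qed
  then show ?thesis by simp
qed

lemma nsamples_pos: "0 < \<epsilon> \<Longrightarrow> 0 < nsamples \<delta>' \<epsilon>"
  unfolding nsamples_def using log_pos gamma sqrt_gamma Mlam_nonneg by (simp add: zero_less_divide_iff zero_less_mult_iff)

text \<open>The samples range over an interval of length 1 + 2 * \<gamma> * vmax \<le> 5 * qmax,
  because vmax \<le> 2 * qmax and qmax \<ge> 1. The fraction 5 / 6 is chosen so that 2 * 18 * (5 /
  6)^2 = 25 matches the square of 5; the remaining factor 1 / (1 - \<gamma>)^2 is at least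
  1.\<close>

lemma hoeffding_exponent:
  assumes "0 < \<epsilon>"
  shows "2 * real K * exp (- 2 * real (nsamples \<delta>' \<epsilon>) * (5 / 6 * (1 - sqrt \<gamma>) * \<epsilon>)\<^sup>2 / (1 + 2 * \<gamma> * vmax)\<^sup>2) \<le> \<delta>'"
proof -
  let ?l = "ln (2 * real K / \<delta>')" and ?g = "1 - sqrt \<gamma>"
  have g: "0 < ?g" using sqrt_gamma by simp
  have w: "1 + 2 * \<gamma> * vmax \<le> 5 * qmax" "0 < 1 + 2 * \<gamma> * vmax"
  proof -
    have "\<gamma> * vmax \<le> 1 * (2 * qmax)"
      using gamma vmax_le vmax_nonneg by (intro mult_mono) auto
    moreover have "1 + 2 * x \<le> 5 * q" if "x \<le> 1 * (2 * q)" "1 \<le> q" for x q :: real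
      using that by linarith
    ultimately show "1 + 2 * \<gamma> * vmax \<le> 5 * qmax" using qmax_ge_1 by (simp only: mult.assoc)
    have "0 \<le> 2 * \<gamma> * vmax" using gamma vmax_nonneg by simp
    then show "0 < 1 + 2 * \<gamma> * vmax" by linarith
  qed
  have w2: "(1 + 2 * \<gamma> * vmax)\<^sup>2 \<le> (5 * qmax)\<^sup>2"
    using w by (intro power_mono) auto
  have "18 * (1 + Mlam)\<^sup>2 / ((1 - \<gamma>) ^ 4 * ?g\<^sup>2) * (?l / \<epsilon>\<^sup>2) \<le> real (nsamples \<delta>' \<epsilon>)"
    unfolding nsamples_def by (rule real_nat_ceiling_ge)
  then have N: "18 * qmax\<^sup>2 / ((1 - \<gamma>)\<^sup>2 * ?g\<^sup>2) * (?l / \<epsilon>\<^sup>2) \<le> real (nsamples \<delta>' \<epsilon>)"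
    by (simp add: power_divide power4_eq_xxxx power2_eq_square mult_ac)
  have "(5 * qmax)\<^sup>2 * ?l \<le> (5 * qmax)\<^sup>2 * ?l / (1 - \<gamma>)\<^sup>2"
  proof -
    have "(1 - \<gamma>)\<^sup>2 \<le> 1" using gamma by (intro power_le_one) auto
    moreover have "0 \<le> (5 * qmax)\<^sup>2 * ?l" using log_pos by simp
    ultimately show ?thesis
      using gamma by (simp only: pos_le_divide_eq zero_less_power diff_gt_0_iff_gt mult_left_le)
  qed
  also have "\<dots> = 2 * (18 * qmax\<^sup>2 / ((1 - \<gamma>)\<^sup>2 * ?g\<^sup>2) * (?l / \<epsilon>\<^sup>2)) * (5 / 6 * ?g * \<epsilon>)\<^sup>2"
  proof -
    have *: "(5 * q)\<^sup>2 * l / c = 2 * (18 * q\<^sup>2 / (c * g\<^sup>2) * (l / e\<^sup>2)) * (5 / 6 * g * e)\<^sup>2"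
      if "g \<noteq> 0" "e \<noteq> 0" for q l c g e :: real
      using that by (simp add: power2_eq_square)
    show ?thesis by (rule *) (use g \<open>0 < \<epsilon>\<close> in auto)
  qed
  also have "\<dots> \<le> 2 * real (nsamples \<delta>' \<epsilon>) * (5 / 6 * ?g * \<epsilon>)\<^sup>2"
    using N by (intro mult_right_mono mult_left_mono) auto
  finally have "(5 * qmax)\<^sup>2 * ?l \<le> 2 * real (nsamples \<delta>' \<epsilon>) * (5 / 6 * ?g * \<epsilon>)\<^sup>2" .
  moreover have "(1 + 2 * \<gamma> * vmax)\<^sup>2 * ?l \<le> (5 * qmax)\<^sup>2 * ?l"
    using w2 log_pos by (intro mult_right_mono) auto
  ultimately have "?l \<le> 2 * real (nsamples \<delta>' \<epsilon>) * (5 / 6 * ?g * \<epsilon>)\<^sup>2 / (1 + 2 * \<gamma> * vmax)\<^sup>2"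
    using w(2) by (subst pos_le_divide_eq) (simp_all add: mult.commute)
  then have "exp (- (2 * real (nsamples \<delta>' \<epsilon>) * (5 / 6 * ?g * \<epsilon>)\<^sup>2 / (1 + 2 * \<gamma> * vmax)\<^sup>2)) \<le> exp (- ?l)"
    by simp
  also have "exp (- ?l) = \<delta>' / (2 * real K)"
    using \<delta>' by (simp add: exp_minus K)
  finally show ?thesis
    by (simp add: K field_simps)
qed

lemma estimateQ_concentration:
  assumes "0 < \<epsilon>" and s: "s \<in> space S"
    and bias: "\<And>z. z \<in> space S \<Longrightarrow> \<bar>(\<integral>x. fst x \<partial>sampleV lo \<delta>' (\<epsilon> / sqrt \<gamma>) z) - V z\<bar> \<le> \<epsilon> / sqrt \<gamma>"
  shows "measure (estimateQ lo \<delta>' \<epsilon> s) {x \<in> space (estimateQ lo \<delta>' \<epsilon> s). \<exists>a. \<bar>fst x $ a - Q V s $ a\<bar> > \<rho> * \<epsilon>} \<le> \<delta>'"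
proof -
  have e: "0 < \<epsilon> / sqrt \<gamma>" using assms sqrt_gamma by simp
  let ?W = "sampleV lo \<delta>' (\<epsilon> / sqrt \<gamma>)"
  note W = measurable_sampleV[OF floor_bounds e]
  note AE = AE_sampleV[OF floor_bounds e]
  have "\<bar>(\<integral>x. fst x \<partial>backup ?W s a) - Q V s $ a\<bar> \<le> \<gamma> * (\<epsilon> / sqrt \<gamma>)" for a
    by (rule backup_bias[OF W AE s value_measurable value_abs_le_qmax bias])
  moreover have "\<gamma> * (\<epsilon> / sqrt \<gamma>) = sqrt \<gamma> * \<epsilon>"
    using gamma by (simp add: field_simps)
  ultimately have b: "\<bar>(\<integral>x. fst x \<partial>backup ?W s a) - Q V s $ a\<bar> \<le> sqrt \<gamma> * \<epsilon>" for a by simp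
  have "measure (average lo (nsamples \<delta>' \<epsilon>) ?W s) {x \<in> space (average lo (nsamples \<delta>' \<epsilon>) ?W s).
      \<exists>a. \<bar>fst x $ a - Q V s $ a\<bar> > sqrt \<gamma> * \<epsilon> + 5 / 6 * (1 - sqrt \<gamma>) * \<epsilon>}
    \<le> 2 * real K * exp (- 2 * real (nsamples \<delta>' \<epsilon>) * (5 / 6 * (1 - sqrt \<gamma>) * \<epsilon>)\<^sup>2 / (1 + 2 * \<gamma> * vmax)\<^sup>2)"
    using assms(1) sqrt_gamma Q_le_qmax[OF s, THEN abs_le_D1]
    by (intro average_concentration[OF W s AE] floor_le_Q[OF s] b vmax_nonneg nsamples_pos) auto
  also have "\<dots> \<le> \<delta>'"
    by (rule hoeffding_exponent[OF assms(1)])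
  finally show ?thesis
    by (simp add: estimateQ_eq[OF assms(1)] \<rho>_def distrib_right)
qed

text \<open>
  The bias is bounded unconditionally: the bad event of an inner call to \<open>estimateQ\<close> has probability
  at most \<open>\<delta>'\<close> and contributes at most \<open>2 * vmax * \<delta>'\<close>, which is absorbed by the slack that the
  constant 18 in \<open>nsamples\<close> leaves in Hoeffding's inequality.
\<close>

lemma sampleV_bias:
  assumes "0 < \<epsilon>" "12 * vmax * \<delta>' \<le> (1 - sqrt \<gamma>) * \<epsilon>" "s \<in> space S"
  shows "\<bar>(\<integral>x. fst x \<partial>sampleV lo \<delta>' \<epsilon> s) - V s\<bar> \<le> \<epsilon>"
  using assms
proof (induction \<epsilon> arbitrary: s rule: accuracy_induct)
  case (large \<epsilon>)
  have "(\<integral>x. fst x \<partial>return RN (0::real, 0::nat)) = 0"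
    by (subst integral_return) (auto simp: space_pair_measure)
  then show ?case
    using value_abs_le_qmax[OF large(4)] large by (simp add: sampleV_large)
next
  case (middle \<epsilon>)
  note s = \<open>s \<in> space S\<close>
  let ?E = "estimateQ lo \<delta>' \<epsilon> s"
  have mono: "\<epsilon> \<le> \<epsilon> / sqrt \<gamma>" "0 < \<epsilon> / sqrt \<gamma>"
    using middle(1) sqrt_gamma by (simp_all add: pos_le_divide_eq mult_left_le)
  \<comment> \<open>The condition that ties \<delta>' to the accuracy passes to the recursive calls
    because their accuracies are only larger.\<close>
  have "(1 - sqrt \<gamma>) * \<epsilon> \<le> (1 - sqrt \<gamma>) * (\<epsilon> / sqrt \<gamma>)"
    using mono sqrt_gamma by (intro mult_left_mono) auto
  then have "12 * vmax * \<delta>' \<le> (1 - sqrt \<gamma>) * (\<epsilon> / sqrt \<gamma>)"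
    using middle.prems by linarith
  then have conc: "measure ?E {x \<in> space ?E. \<exists>a. \<bar>fst x $ a - Q V s $ a\<bar> > \<rho> * \<epsilon>} \<le> \<delta>'"
    using middle by (intro estimateQ_concentration) auto
  have E: "?E \<in> space (prob_algebra QN)"
    using measurable_space[OF measurable_estimateQ[OF floor_bounds middle(1)] s] .
  interpret prob_space ?E using E by (simp add: space_prob_algebra)
  have mE: "measurable ?E N = measurable QN N" for N
    using E by (intro measurable_cong_sets) (auto simp: space_prob_algebra)
  have mF: "(\<lambda>x. F s (fst x)) \<in> borel_measurable ?E"
    unfolding mE using s by measurable
  have AE: "AE x in ?E. \<bar>F s (fst x)\<bar> \<le> vmax"
    using AE_estimateQ[OF floor_bounds middle(1) s] by eventually_elim (simp add: vmax_def F_abs_le)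
  have V_le: "\<bar>V s\<bar> \<le> vmax"
    using value_abs_le_qmax[OF s] qmax_le_vmax by linarith
  have "(\<integral>x. fst x \<partial>sampleV lo \<delta>' \<epsilon> s) = (\<integral>x. F s (fst x) \<partial>?E)"
    unfolding sampleV_middle[OF middle(1-3) measurable_sampleV[OF floor_bounds mono(2)] s] reg_value_def
    using measurable_reg_value_map[OF E s] by (subst integral_distr) auto
  moreover have "(\<integral>x. F s (fst x) - V s \<partial>?E) = (\<integral>x. F s (fst x) \<partial>?E) - V s"
    using AE mF by (subst Bochner_Integration.integral_diff) (auto simp: prob_space intro!: integrable_const_bound[where B = vmax])
  ultimately have "\<bar>(\<integral>x. fst x \<partial>sampleV lo \<delta>' \<epsilon> s) - V s\<bar> = \<bar>\<integral>x. F s (fst x) - V s \<partial>?E\<bar>" by simp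
  also have "\<dots> \<le> \<rho> * \<epsilon> + 2 * vmax * prob {x \<in> space ?E. \<exists>a. \<bar>fst x $ a - Q V s $ a\<bar> > \<rho> * \<epsilon>}"
  proof (rule integral_abs_le_bad_event)
    show "Measurable.pred ?E (\<lambda>x. \<exists>a. \<bar>fst x $ a - Q V s $ a\<bar> > \<rho> * \<epsilon>)"
      unfolding mE by measurable
    show "AE x in ?E. \<bar>F s (fst x) - V s\<bar> \<le> 2 * vmax"
      using AE by eventually_elim (use V_le in linarith)
    show "AE x in ?E. \<not> (\<exists>a. \<bar>fst x $ a - Q V s $ a\<bar> > \<rho> * \<epsilon>) \<longrightarrow> \<bar>F s (fst x) - V s\<bar> \<le> \<rho> * \<epsilon>"
      unfolding value_eq[OF s] by (intro AE_I2 impI F_lipschitz) (simp add: not_less)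
    show "0 \<le> \<rho> * \<epsilon>" using middle(1) sqrt_gamma by (simp add: \<rho>_def)
  qed (use mF in simp)
  also have "\<dots> \<le> \<rho> * \<epsilon> + 2 * vmax * \<delta>'"
    using conc vmax_nonneg by (intro add_left_mono mult_left_mono) auto
  also have "\<dots> \<le> \<epsilon>"
  proof -
    \<comment> \<open>This is the sixth kept in reserve; the 12 of the assumption is 6 times the
      factor 2 in 2 * vmax * \<delta>'.\<close>
    have "\<rho> * \<epsilon> = \<epsilon> - (1 - sqrt \<gamma>) * \<epsilon> / 6"
      by (simp add: \<rho>_def field_simps)
    then show ?thesis using middle.prems by simp
  qed
  finally show ?case .
next
  case (small \<epsilon>)
  note s = \<open>s \<in> space S\<close>
  let ?e = "sqrt (\<kappa> * \<epsilon>)"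
  let ?W = "sampleV lo \<delta>' (\<epsilon> / sqrt \<gamma>)" and ?E = "estimateQ lo \<delta>' ?e s"
  have mono: "\<epsilon> \<le> \<epsilon> / sqrt \<gamma>" "0 < \<epsilon> / sqrt \<gamma>"
    using small(1) sqrt_gamma by (simp_all add: pos_le_divide_eq mult_left_le)
  have "\<epsilon> \<le> ?e" using small by (intro le_sqrt_mult)
  then have e: "0 < ?e" using small(1) by linarith
  have "\<epsilon> / sqrt \<gamma> \<le> ?e / sqrt \<gamma>"
    using \<open>\<epsilon> \<le> ?e\<close> sqrt_gamma by (intro divide_right_mono) auto
  then have "(1 - sqrt \<gamma>) * \<epsilon> \<le> (1 - sqrt \<gamma>) * (\<epsilon> / sqrt \<gamma>)" "(1 - sqrt \<gamma>) * \<epsilon> \<le> (1 - sqrt \<gamma>) * (?e / sqrt \<gamma>)"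
    using mono sqrt_gamma by (intro mult_left_mono; simp)+
  then have cond: "12 * vmax * \<delta>' \<le> (1 - sqrt \<gamma>) * (\<epsilon> / sqrt \<gamma>)" "12 * vmax * \<delta>' \<le> (1 - sqrt \<gamma>) * (?e / sqrt \<gamma>)"
    using small.prems by linarith+
  have conc: "measure ?E {x \<in> space ?E. \<exists>a. \<bar>fst x $ a - Q V s $ a\<bar> > \<rho> * ?e} \<le> \<delta>'"
    by (rule estimateQ_concentration[OF e s small(4)[OF cond(2)]])
  note W = measurable_sampleV[OF floor_bounds mono(2)]
  note AEW = AE_sampleV[OF floor_bounds mono(2)]
  have "\<bar>(\<integral>x. fst x \<partial>backup ?W s a) - Q V s $ a\<bar> \<le> \<gamma> * (\<epsilon> / sqrt \<gamma>)" for a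
    by (rule backup_bias[OF W AEW s value_measurable value_abs_le_qmax small(5)[OF cond(1)]])
  moreover have "\<gamma> * (\<epsilon> / sqrt \<gamma>) = sqrt \<gamma> * \<epsilon>"
    using gamma by (simp add: field_simps)
  ultimately have b: "\<bar>(\<integral>x. fst x \<partial>backup ?W s a) - Q V s $ a\<bar> \<le> sqrt \<gamma> * \<epsilon>" for a by simp
  have E: "?E \<in> space (prob_algebra QN)"
    using measurable_space[OF measurable_estimateQ[OF floor_bounds e] s] .
  interpret prob_space ?E using E by (simp add: space_prob_algebra)
  have mE: "measurable ?E N = measurable QN N" for N
    using E by (intro measurable_cong_sets) (auto simp: space_prob_algebra)
  \<comment> \<open>Mean of the output conditional on the crude estimate. It is bounded by
    \<open>vmax\<close> for every x, so a failed crude estimate is treated as in the previous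
    case.\<close>
  define H where "H x = (\<integral>y. fst y \<partial>one_sample ?W s x)" for x
  have mH: "H \<in> borel_measurable ?E"
    unfolding mE H_def
    by (rule measurable_compose[OF measurable_prob_algebraD[OF measurable_one_sample[OF W s]]])
       (rule integral_measurable_subprob_algebra, simp)
  have H_le: "\<bar>H x\<bar> \<le> vmax" for x
    unfolding H_def
    by (rule order_trans[OF one_sample_mean_abs_le[OF W s AEW vmax_nonneg] vmax_step])
  have V_le: "\<bar>V s\<bar> \<le> vmax"
    using value_abs_le_qmax[OF s] qmax_le_vmax by linarith
  have AE1: "AE y in one_sample ?W s x. \<bar>fst y\<bar> \<le> 1 + Mlam + \<gamma> * vmax" for x
  proof -
    have "AE y in one_sample ?W s x. \<bar>fst y\<bar> \<le> 1 + Mlam + \<gamma> * vmax \<and> snd y = snd x + Suc (calls \<delta>' (\<epsilon> / sqrt \<gamma>))"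
      by (rule AE_one_sample[OF W s AEW vmax_nonneg])
    then show ?thesis by eventually_elim simp
  qed
  have "(\<integral>x. fst x \<partial>sampleV lo \<delta>' \<epsilon> s) = (\<integral>x. H x \<partial>?E)"
    unfolding sampleV_small[OF small(1-3) W s] H_def
    by (rule integral_bind_AE_bounded[OF E measurable_one_sample[OF W s] _ AE_I2[OF AE1]]) simp
  moreover have "(\<integral>x. H x - V s \<partial>?E) = (\<integral>x. H x \<partial>?E) - V s"
  proof -
    have "integrable ?E H"
      by (rule integrable_const_bound[where B = vmax, OF AE_I2 mH]) (simp only: real_norm_def H_le)
    then have "(\<integral>x. H x - V s \<partial>?E) = (\<integral>x. H x \<partial>?E) - (\<integral>x. V s \<partial>?E)"
      by (rule Bochner_Integration.integral_diff[OF _ integrable_const])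
    also have "(\<integral>x. V s \<partial>?E) = V s"
      by (simp only: lebesgue_integral_const prob_space scaleR_one)
    finally show ?thesis .
  qed
  ultimately have "\<bar>(\<integral>x. fst x \<partial>sampleV lo \<delta>' \<epsilon> s) - V s\<bar> = \<bar>\<integral>x. H x - V s \<partial>?E\<bar>" by simp
  also have "\<dots> \<le> ((\<rho> * ?e)\<^sup>2 / (2 * lam) + sqrt \<gamma> * \<epsilon>) + 2 * vmax * prob {x \<in> space ?E. \<exists>a. \<bar>fst x $ a - Q V s $ a\<bar> > \<rho> * ?e}"
  proof (rule integral_abs_le_bad_event)
    show "Measurable.pred ?E (\<lambda>x. \<exists>a. \<bar>fst x $ a - Q V s $ a\<bar> > \<rho> * ?e)"
      unfolding mE by measurable
    have "\<bar>H x - V s\<bar> \<le> 2 * vmax" for x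
      using H_le[of x] V_le by linarith
    then show "AE x in ?E. \<bar>H x - V s\<bar> \<le> 2 * vmax" by simp
    show "AE x in ?E. \<not> (\<exists>a. \<bar>fst x $ a - Q V s $ a\<bar> > \<rho> * ?e) \<longrightarrow> \<bar>H x - V s\<bar> \<le> (\<rho> * ?e)\<^sup>2 / (2 * lam) + sqrt \<gamma> * \<epsilon>"
      unfolding value_eq[OF s] H_def
      by (intro AE_I2 impI one_sample_bias[OF W s AEW vmax_nonneg b]) (assumption | rule leI, blast)+
    show "0 \<le> (\<rho> * ?e)\<^sup>2 / (2 * lam) + sqrt \<gamma> * \<epsilon>" using small(1) sqrt_gamma lam by simp
  qed (use mH in simp)
  also have "\<dots> \<le> ((\<rho> * ?e)\<^sup>2 / (2 * lam) + sqrt \<gamma> * \<epsilon>) + 2 * vmax * \<delta>'"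
    using conc vmax_nonneg by (intro add_left_mono mult_left_mono) auto
  \<comment> \<open>The choice of \<kappa>: the crude accuracy squared is \<kappa> * \<epsilon>, so
    the second-order remainder costs at most half of the budget (1 - sqrt \<gamma>) * \<epsilon>,
    and the failure event at most a sixth.\<close>
  also have "\<dots> \<le> ((1 - sqrt \<gamma>) * \<epsilon> / 2 + sqrt \<gamma> * \<epsilon>) + 2 * vmax * \<delta>'"
  proof -
    have "\<rho>\<^sup>2 \<le> 1" using rho_bounds by (intro power_le_one)
    have ke: "0 \<le> \<kappa> * \<epsilon>"
      by (rule mult_nonneg_nonneg[OF less_imp_le[OF kappa_pos] less_imp_le[OF small(1)]])
    then have "(\<rho> * ?e)\<^sup>2 = \<rho>\<^sup>2 * (\<kappa> * \<epsilon>)"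
      by (simp only: power_mult_distrib real_sqrt_pow2)
    also have "\<dots> \<le> 1 * (\<kappa> * \<epsilon>)"
      by (rule mult_right_mono[OF \<open>\<rho>\<^sup>2 \<le> 1\<close> ke])
    also have "\<kappa> \<le> (1 - sqrt \<gamma>) * lam"
      using sqrt_gamma lam by (simp add: K divide_le_eq Suc_leI)
    then have "1 * (\<kappa> * \<epsilon>) \<le> (1 - sqrt \<gamma>) * lam * \<epsilon>"
      using small(1) by (simp only: mult_1 mult_right_mono less_imp_le)
    finally show ?thesis
      using lam by (simp add: divide_le_eq ac_simps)
  qed
  also have "\<dots> \<le> \<epsilon>"
  proof -
    have "0 \<le> vmax * \<delta>'" using vmax_nonneg \<delta>' by simp
    moreover have "(1 - g) * \<epsilon> / 2 + g * \<epsilon> + 2 * z \<le> \<epsilon>" if "12 * z \<le> (1 - g) * \<epsilon>" "0 \<le> z" for g z :: real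
      using that by (simp add: field_simps)
    ultimately show ?thesis using small.prems(1) by (simp only: mult.assoc)
  qed
  finally show ?case .
qed

text \<open>Only the outermost \<open>estimateQ\<close> contributes a failure probability; all inner
  calls enter through their bias, which is a number and not an event. This is why the confidence is
  \<delta>' itself.\<close>

lemma smooth_cruiser_accuracy:
  assumes "0 < \<epsilon>" "12 * vmax * \<delta>' \<le> (1 - sqrt \<gamma>) * \<epsilon>" and s: "s \<in> space S"
  shows "measure (smooth_cruiser lo \<delta>' \<epsilon> s) {x \<in> space (smooth_cruiser lo \<delta>' \<epsilon> s). \<bar>fst x - V s\<bar> > \<epsilon>} \<le> \<delta>'"
proof -
  let ?E = "estimateQ lo \<delta>' \<epsilon> s"
  have mono: "\<epsilon> \<le> \<epsilon> / sqrt \<gamma>" "0 < \<epsilon> / sqrt \<gamma>"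
    using assms(1) sqrt_gamma by (simp_all add: pos_le_divide_eq mult_left_le)
  have "(1 - sqrt \<gamma>) * \<epsilon> \<le> (1 - sqrt \<gamma>) * (\<epsilon> / sqrt \<gamma>)"
    using mono sqrt_gamma by (intro mult_left_mono) auto
  then have conc: "measure ?E {x \<in> space ?E. \<exists>a. \<bar>fst x $ a - Q V s $ a\<bar> > \<rho> * \<epsilon>} \<le> \<delta>'"
    using assms mono by (intro estimateQ_concentration sampleV_bias) auto
  have E: "?E \<in> space (prob_algebra QN)"
    using measurable_space[OF measurable_estimateQ[OF floor_bounds assms(1)] s] .
  interpret prob_space ?E using E by (simp add: space_prob_algebra)
  have mE: "measurable ?E N = measurable QN N" for N
    using E by (intro measurable_cong_sets) (auto simp: space_prob_algebra)
  have sets: "{x \<in> space ?E. \<exists>a. \<bar>fst x $ a - Q V s $ a\<bar> > \<rho> * \<epsilon>} \<in> sets ?E"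
    unfolding pred_def[symmetric] mE by measurable
  have "{x \<in> space RN. \<bar>fst x - V s\<bar> > \<epsilon>} \<in> sets RN" by measurable
  then have "measure (smooth_cruiser lo \<delta>' \<epsilon> s) {x \<in> space (smooth_cruiser lo \<delta>' \<epsilon> s). \<bar>fst x - V s\<bar> > \<epsilon>}
     = prob ((\<lambda>x. (F s (fst x), snd x)) -` {x \<in> space RN. \<bar>fst x - V s\<bar> > \<epsilon>} \<inter> space ?E)"
    unfolding smooth_cruiser_eq[OF floor_bounds assms(1) s] reg_value_def space_distr
    by (intro measure_distr measurable_reg_value_map[OF E s])
  also have "\<dots> \<le> prob {x \<in> space ?E. \<exists>a. \<bar>fst x $ a - Q V s $ a\<bar> > \<rho> * \<epsilon>}"
  proof (rule finite_measure_mono[OF _ sets], safe)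
    fix x assume "x \<in> space ?E" and x: "(F s (fst x), snd x) \<in> space RN" "\<bar>fst (F s (fst x), snd x) - V s\<bar> > \<epsilon>"
    show "\<exists>a. \<bar>fst x $ a - Q V s $ a\<bar> > \<rho> * \<epsilon>"
    proof (rule ccontr)
      assume "\<not> (\<exists>a. \<bar>fst x $ a - Q V s $ a\<bar> > \<rho> * \<epsilon>)"
      then have "\<bar>F s (fst x) - V s\<bar> \<le> \<rho> * \<epsilon>"
        unfolding value_eq[OF s] by (intro F_lipschitz) (simp add: not_less)
      also have "\<rho> * \<epsilon> \<le> 1 * \<epsilon>"
        using assms(1) rho_bounds by (intro mult_right_mono) auto
      finally show False using x by simp
    qed
  qed
  also note conc
  finally show ?thesis .
qed

end
end
end

subsection \<open>Number of oracle calls\<close>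

definition nconst :: real where
  "nconst = 18 * (1 + Mlam)\<^sup>2 / ((1 - \<gamma>) ^ 4 * (1 - sqrt \<gamma>)\<^sup>2)"

lemma nconst_pos: "0 < nconst"
  unfolding nconst_def using gamma sqrt_gamma Mlam_nonneg by (intro divide_pos_pos mult_pos_pos zero_less_power) auto

lemma K_pos: "1 \<le> real K"
  by (simp add: K Suc_leI)

text \<open>The \<ell> of the overview. Its lower bound ln 2 lets additive constants be absorbed
  into multiples of it.\<close>

definition logterm :: "real \<Rightarrow> real" where
  "logterm \<delta>' = ln (2 * real K / \<delta>')"

context
  fixes \<delta>' :: real
  assumes \<delta>': "0 < \<delta>'" "\<delta>' < 1"
begin

lemma logterm_ge: "ln 2 \<le> logterm \<delta>'"
proof -
  have "2 * \<delta>' \<le> 2 * real K" using \<delta>' K_pos by linarith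
  then have "2 \<le> 2 * real K / \<delta>'" using \<delta>' by (simp add: pos_le_divide_eq)
  then show ?thesis unfolding logterm_def by (intro ln_mono) auto
qed

lemma logterm_pos: "0 < logterm \<delta>'"
  using logterm_ge ln_gt_zero[of "2::real"] by linarith

lemma nsamples_le: "0 < \<epsilon> \<Longrightarrow> real (nsamples \<delta>' \<epsilon>) \<le> nconst * logterm \<delta>' / \<epsilon>\<^sup>2 + 1"
  using nconst_pos logterm_pos unfolding nsamples_def nconst_def[symmetric] logterm_def[symmetric]
  by (simp add: of_nat_nat less_imp_le)

lemma nsamples_ge_1: "0 < \<epsilon> \<Longrightarrow> 1 \<le> real (nsamples \<delta>' \<epsilon>)"
proof -
  assume "0 < \<epsilon>"
  then have "0 < nconst * (logterm \<delta>' / \<epsilon>\<^sup>2)"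
    using nconst_pos logterm_pos by (intro mult_pos_pos divide_pos_pos) auto
  then have "0 < \<lceil>nconst * (logterm \<delta>' / \<epsilon>\<^sup>2)\<rceil>"
    by (simp only: zero_less_ceiling)
  then have "1 \<le> nsamples \<delta>' \<epsilon>"
    unfolding nsamples_def nconst_def[symmetric] logterm_def[symmetric] by linarith
  then show ?thesis by simp
qed

lemma nsamples_antimono: "0 < x \<Longrightarrow> x \<le> y \<Longrightarrow> nsamples \<delta>' y \<le> nsamples \<delta>' x"
  unfolding nsamples_def nconst_def[symmetric] logterm_def[symmetric] using nconst_pos logterm_pos
  by (intro nat_mono ceiling_mono mult_left_mono divide_left_mono power_mono mult_pos_pos) auto

text \<open>Each level multiplies 1 + calls by at most the base of the power: no level draws more
  samples than the finest accuracy e0 does, and the 2 pays for the additive constant and for the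
  single continuing call of the third branch.\<close>

lemma calls_crude_bound:
  assumes "0 < e0" "e0 \<le> \<epsilon>"
  shows "1 + real (calls \<delta>' \<epsilon>) \<le> (2 + real K * real (nsamples \<delta>' e0)) ^ depth \<epsilon>"
proof -
  define X where "X = 2 + real K * real (nsamples \<delta>' e0)"
  have X: "1 \<le> X" by (simp add: X_def)
  have N: "real K * real (nsamples \<delta>' y) \<le> real K * real (nsamples \<delta>' e0)" if "e0 \<le> y" for y
    using nsamples_antimono[OF assms(1) that] by (intro mult_left_mono) auto
  have "0 < \<epsilon>" using assms by linarith
  then have "1 + real (calls \<delta>' \<epsilon>) \<le> X ^ depth \<epsilon>"
    using assms(2)
  proof (induction \<epsilon> rule: accuracy_induct)
    case (large \<epsilon>)
    then show ?case using X by (simp add: calls.simps one_le_power)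
  next
    case (middle \<epsilon>)
    have "\<epsilon> \<le> \<epsilon> / sqrt \<gamma>"
      using middle(1) sqrt_gamma by (simp add: pos_le_divide_eq mult_left_le)
    then have IH: "1 + real (calls \<delta>' (\<epsilon> / sqrt \<gamma>)) \<le> X ^ depth (\<epsilon> / sqrt \<gamma>)"
      using middle by auto
    define D where "D = X ^ depth (\<epsilon> / sqrt \<gamma>)"
    have D: "1 \<le> D" unfolding D_def using X by simp
    have "1 + real (calls \<delta>' \<epsilon>) = 1 + real K * real (nsamples \<delta>' \<epsilon>) * (1 + real (calls \<delta>' (\<epsilon> / sqrt \<gamma>)))"
      using middle by (subst calls.simps) (simp add: algebra_simps)
    also have "\<dots> \<le> D + real K * real (nsamples \<delta>' e0) * D"
      using D by (intro add_mono mult_mono[OF N[OF middle.prems] IH[folded D_def]]) auto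
    also have "\<dots> \<le> X * D" using D by (simp add: X_def algebra_simps)
    finally show ?case using depth_step[OF middle(1,2)] by (simp add: D_def flip: power_Suc)
  next
    case (small \<epsilon>)
    let ?e = "sqrt (\<kappa> * \<epsilon>)"
    have "\<epsilon> \<le> \<epsilon> / sqrt \<gamma>"
      using small(1) sqrt_gamma by (simp add: pos_le_divide_eq mult_left_le)
    moreover have "\<epsilon> \<le> ?e" using small by (intro le_sqrt_mult)
    moreover from this have "\<epsilon> / sqrt \<gamma> \<le> ?e / sqrt \<gamma>" using sqrt_gamma by (intro divide_right_mono) auto
    ultimately have IH: "1 + real (calls \<delta>' (\<epsilon> / sqrt \<gamma>)) \<le> X ^ depth (\<epsilon> / sqrt \<gamma>)"
      and IH': "1 + real (calls \<delta>' (?e / sqrt \<gamma>)) \<le> X ^ depth (?e / sqrt \<gamma>)"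
      and e: "e0 \<le> ?e" "e0 \<le> \<epsilon> / sqrt \<gamma>"
      using small by auto
    define D where "D = X ^ depth (\<epsilon> / sqrt \<gamma>)"
    have D: "1 \<le> D" unfolding D_def using X by simp
    have "depth (?e / sqrt \<gamma>) \<le> depth (\<epsilon> / sqrt \<gamma>)"
      using \<open>\<epsilon> / sqrt \<gamma> \<le> ?e / sqrt \<gamma>\<close> e assms(1) by (intro depth_antimono) auto
    then have "X ^ depth (?e / sqrt \<gamma>) \<le> D"
      unfolding D_def using X by (intro power_increasing)
    then have IH': "1 + real (calls \<delta>' (?e / sqrt \<gamma>)) \<le> D" using IH' by linarith
    have "1 + real (calls \<delta>' \<epsilon>) = 1 + real K * real (nsamples \<delta>' ?e) * (1 + real (calls \<delta>' (?e / sqrt \<gamma>))) + (1 + real (calls \<delta>' (\<epsilon> / sqrt \<gamma>)))"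
      using small by (subst calls.simps) (simp add: algebra_simps)
    also have "\<dots> \<le> D + real K * real (nsamples \<delta>' e0) * D + D"
      using D by (intro add_mono mult_mono[OF N[OF e(1)] IH'] IH[folded D_def]) auto
    also have "\<dots> = X * D" by (simp add: X_def algebra_simps)
    finally show ?case using depth_step[OF small(1,2)] by (simp add: D_def flip: power_Suc)
  qed
  then show ?thesis by (simp only: X_def)
qed

text \<open>Below e1 the power law reproduces itself: the continuing call at \<epsilon> / sqrt
  \<gamma> takes the fraction sqrt \<gamma> powr p of the bound, and \<open>e1_small\<close> fits
  the sampling term into the rest. Above e1 the crude bound supplies the constant. The range ends at
  \<kappa> / sqrt \<gamma> because recursive calls made from \<epsilon> < \<kappa> stay below
  it.\<close>

lemma calls_fine_bound:
  assumes p: "0 < p" and e1: "0 < e1" "e1 \<le> 1" "e1 \<le> \<kappa>"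
    and e1_small: "\<And>\<epsilon>. 0 < \<epsilon> \<Longrightarrow> \<epsilon> < e1 \<Longrightarrow>
       2 * real K * real (nsamples \<delta>' (sqrt (\<kappa> * \<epsilon>))) * (sqrt (\<kappa> * \<epsilon>) / sqrt \<gamma>) powr - p
         \<le> (1 - sqrt \<gamma> powr p) * \<epsilon> powr - p"
    and \<epsilon>: "0 < \<epsilon>" "\<epsilon> \<le> \<kappa> / sqrt \<gamma>"
  shows "1 + real (calls \<delta>' \<epsilon>) \<le> (2 + real K * real (nsamples \<delta>' e1)) ^ depth e1 * (\<kappa> / sqrt \<gamma>) powr p * \<epsilon> powr - p"
proof -
  define Y where "Y = (2 + real K * real (nsamples \<delta>' e1)) ^ depth e1"
  define \<Phi> where "\<Phi> = Y * (\<kappa> / sqrt \<gamma>) powr p"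
  have Y: "1 \<le> Y" unfolding Y_def by (intro one_le_power) simp
  have k: "0 < \<kappa> / sqrt \<gamma>" by (rule divide_pos_pos[OF kappa_pos sqrt_gamma(1)])
  have \<Phi>: "0 \<le> \<Phi>" unfolding \<Phi>_def using Y by simp
  have base: "1 + real (calls \<delta>' \<epsilon>) \<le> \<Phi> * \<epsilon> powr - p" if "e1 \<le> \<epsilon>" "\<epsilon> \<le> \<kappa> / sqrt \<gamma>" for \<epsilon>
  proof -
    have "1 + real (calls \<delta>' \<epsilon>) \<le> (2 + real K * real (nsamples \<delta>' e1)) ^ depth \<epsilon>"
      by (rule calls_crude_bound[OF e1(1) that(1)])
    also have "\<dots> \<le> Y"
      unfolding Y_def using depth_antimono[OF e1(1) that(1)] by (intro power_increasing) auto
    also have "\<dots> = Y * 1" by simp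
    \<comment> \<open>The factor (\<kappa> / sqrt \<gamma>) powr p normalizes the power law to be at
      least 1 on the whole range.\<close>
    also have "\<dots> \<le> Y * ((\<kappa> / sqrt \<gamma>) powr p * \<epsilon> powr - p)"
    proof (rule mult_left_mono)
      have "\<epsilon> powr p \<le> (\<kappa> / sqrt \<gamma>) powr p"
        using that e1 p by (intro powr_mono2) auto
      then show "1 \<le> (\<kappa> / sqrt \<gamma>) powr p * \<epsilon> powr - p"
        using that e1 by (simp add: powr_minus field_simps)
    qed (use Y in simp)
    finally show ?thesis by (simp add: \<Phi>_def mult_ac)
  qed
  have "\<epsilon> \<le> \<kappa> / sqrt \<gamma> \<longrightarrow> 1 + real (calls \<delta>' \<epsilon>) \<le> \<Phi> * \<epsilon> powr - p"
    using \<epsilon>(1)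
  proof (induction \<epsilon> rule: accuracy_induct)
    \<comment> \<open>Here and in the next case the accuracy is at least e1, by e1 \<le> 1 \<le>
      qmax and e1 \<le> \<kappa>.\<close>
    case (large \<epsilon>)
    then show ?case using base e1(2) qmax_ge_1 by auto
  next
    case (middle \<epsilon>)
    then show ?case using base e1(3) by auto
  next
    case (small \<epsilon>)
    let ?e = "sqrt (\<kappa> * \<epsilon>)"
    show ?case
    proof (cases "e1 \<le> \<epsilon>")
      case False
      have e: "0 < ?e" using small(1) kappa_pos by (simp only: real_sqrt_gt_0_iff mult_pos_pos)
      have "?e \<le> \<kappa>"
      proof (rule real_le_lsqrt)
        show "\<kappa> * \<epsilon> \<le> \<kappa>\<^sup>2" using small kappa_pos by (simp only: power2_eq_square mult_left_mono less_imp_le)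
      qed (use kappa_pos in linarith)
      then have IH': "1 + real (calls \<delta>' (?e / sqrt \<gamma>)) \<le> \<Phi> * (?e / sqrt \<gamma>) powr - p"
        using small(4) sqrt_gamma divide_right_mono[of ?e \<kappa> "sqrt \<gamma>"] by auto
      have IH: "1 + real (calls \<delta>' (\<epsilon> / sqrt \<gamma>)) \<le> \<Phi> * (\<epsilon> / sqrt \<gamma>) powr - p"
        using small(3,5) sqrt_gamma divide_right_mono[of \<epsilon> \<kappa> "sqrt \<gamma>"] by auto
      let ?KN = "real K * real (nsamples \<delta>' ?e)"
      have KN: "1 \<le> ?KN" using mult_mono[OF K_pos nsamples_ge_1[OF e]] by simp
      \<comment> \<open>The additive 1 is absorbed by doubling the sampling term, hence the factor 2
        in \<open>e1_small\<close>.\<close>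
      have one: "1 \<le> ?KN * (1 + real (calls \<delta>' (?e / sqrt \<gamma>)))"
        using KN mult_mono[of 1 ?KN 1 "1 + real (calls \<delta>' (?e / sqrt \<gamma>))"] by simp
      have "1 + real (calls \<delta>' \<epsilon>) = 1 + ?KN * (1 + real (calls \<delta>' (?e / sqrt \<gamma>))) + (1 + real (calls \<delta>' (\<epsilon> / sqrt \<gamma>)))"
        using small(1-3) by (subst calls.simps) (simp add: algebra_simps)
      also have "\<dots> \<le> ?KN * (1 + real (calls \<delta>' (?e / sqrt \<gamma>))) + ?KN * (1 + real (calls \<delta>' (?e / sqrt \<gamma>))) + (1 + real (calls \<delta>' (\<epsilon> / sqrt \<gamma>)))"
        using one by simp
      also have "\<dots>
         \<le> ?KN * (\<Phi> * (?e / sqrt \<gamma>) powr - p) + ?KN * (\<Phi> * (?e / sqrt \<gamma>) powr - p) + \<Phi> * (\<epsilon> / sqrt \<gamma>) powr - p"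
        using IH IH' KN by (intro add_mono mult_left_mono) auto
      also have "\<dots> = \<Phi> * (2 * real K * real (nsamples \<delta>' ?e) * (?e / sqrt \<gamma>) powr - p) + \<Phi> * (\<epsilon> / sqrt \<gamma>) powr - p"
        by (simp add: algebra_simps)
      also have "\<dots> \<le> \<Phi> * ((1 - sqrt \<gamma> powr p) * \<epsilon> powr - p) + \<Phi> * (\<epsilon> / sqrt \<gamma>) powr - p"
        using False small(1) \<Phi> by (intro add_right_mono mult_left_mono e1_small) auto
      also have "(\<epsilon> / sqrt \<gamma>) powr - p = sqrt \<gamma> powr p * \<epsilon> powr - p"
        using small(1) sqrt_gamma by (simp add: powr_divide powr_minus field_simps)
      also have "\<Phi> * ((1 - sqrt \<gamma> powr p) * \<epsilon> powr - p) + \<Phi> * (sqrt \<gamma> powr p * \<epsilon> powr - p) = \<Phi> * \<epsilon> powr - p"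
        by (simp add: algebra_simps)
      finally show ?thesis by simp
    qed (use base in auto)
  qed
  then show ?thesis using \<epsilon>(2) by (simp add: \<Phi>_def Y_def mult_ac)
qed

end
end

text \<open>Used with y = ln (k / \<epsilon>): since (ln y)^2 / y tends to 0, the crude constant and
  the logarithmic factor together stay below any positive power of 1 / \<epsilon>.\<close>

lemma polylog_subexponential:
  fixes u v w r c :: real
  assumes "0 < c"
  shows "eventually (\<lambda>y. y * exp ((u + v * ln y) * (w + r * ln y)) \<le> exp (c * y)) at_top"
proof -
  have "((\<lambda>y. (1 + u * r + v * w) * (ln y / y) + u * w * (1 / y) + v * r * ((ln y)\<^sup>2 / y)) \<longlongrightarrow>
      (1 + u * r + v * w) * 0 + u * w * 0 + v * r * 0) at_top"
    by (intro tendsto_intros; real_asymp)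
  then have "eventually (\<lambda>y. (1 + u * r + v * w) * (ln y / y) + u * w * (1 / y) + v * r * ((ln y)\<^sup>2 / y) < c) at_top"
    using assms by (intro order_tendstoD) auto
  with eventually_gt_at_top[of 0] show ?thesis
  proof eventually_elim
    case (elim y)
    have "ln y + (u + v * ln y) * (w + r * ln y) =
        ((1 + u * r + v * w) * (ln y / y) + u * w * (1 / y) + v * r * ((ln y)\<^sup>2 / y)) * y"
      using elim by (simp add: field_simps power2_eq_square)
    also have "\<dots> \<le> c * y"
      using elim by (intro mult_right_mono) auto
    finally have "exp (ln y + (u + v * ln y) * (w + r * ln y)) \<le> exp (c * y)" by simp
    then show ?case using elim by (simp add: exp_add)
  qed
qed

section \<open>Choice of constants and the final rate\<close>

context regularized_game
begin

text \<open>All constants are fixed before \<delta>' and \<epsilon>, so \<open>logterm\<close> alone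
  carries the dependence on \<delta>'.\<close>

lemma calls_Q_bound:
  assumes c: "0 < c"
  obtains C u v w r where "0 \<le> C"
    and "\<And>\<delta>' \<epsilon>. 0 < \<delta>' \<Longrightarrow> \<delta>' < 1 \<Longrightarrow> 0 < \<epsilon> \<Longrightarrow> \<epsilon> \<le> 1 \<Longrightarrow> \<epsilon> \<le> \<kappa> \<Longrightarrow>
      real (calls_Q \<delta>' \<epsilon>) \<le> C * (logterm \<delta>' * exp ((u + v * ln (logterm \<delta>')) * (w + r * ln (logterm \<delta>')))) * \<epsilon> powr - (4 + 2 * c)"
proof -
  define k where "k = \<kappa>"
  define g where "g = sqrt \<gamma>"
  have k: "0 < k" unfolding k_def by (rule kappa_pos)
  have g: "0 < g" "g < 1" using sqrt_gamma by (auto simp: g_def)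
  define p where "p = 2 + 2 * c"
  have p: "0 < p" using c by (simp add: p_def)
  define l2 where "l2 = ln (2 :: real)"
  have l2: "0 < l2" by (simp add: l2_def)
  \<comment> \<open>At accuracy sqrt (k * x) with x \<le> 1, at most a1 * l / x samples are drawn; 1
    / l2 absorbs the rounding, by l \<ge> l2.\<close>
  define a1 where "a1 = nconst / k + 1 / l2"
  define B where "B = (sqrt k / g) powr - p"
  \<comment> \<open>The first summand fits the sampling term as soon as E * l * x powr c \<le> 1;
    the second forces e1 \<le> min 1 k for every l \<ge> l2.\<close>
  define E where "E = 2 * real K * a1 * B / (1 - g powr p) + min 1 k powr - c / l2"
  have gp: "g powr p < 1" using powr_less_mono2[of p g 1] g p by simp
  have a1: "0 < a1" unfolding a1_def using nconst_pos k l2 by (intro add_pos_pos divide_pos_pos) auto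
  have B: "0 < B" using k g by (simp add: B_def)
  have E1: "0 < 2 * real K * a1 * B / (1 - g powr p)"
    using K_pos a1 B gp by (intro divide_pos_pos mult_pos_pos) auto
  have E2: "0 < min 1 k powr - c / l2"
    using k l2 by (intro divide_pos_pos) auto
  have E: "0 < E" using E1 E2 by (simp add: E_def)
  \<comment> \<open>The sample count at e1 is of order l / e1^2, that is l powr (1 + 2 / c); w
    collects the coefficients.\<close>
  define r where "r = 1 + 2 / c"
  define w where "w = ln ((2 + real K) / l2 powr r + real K * nconst * E powr (2 / c))"
  define b where "b = - ln g"
  have b: "0 < b" using g by (simp add: b_def)
  \<comment> \<open>Coefficients of the depth at e1, from ln (1 / e1) = (ln E + ln l) / c; the final
    1 is the rounding.\<close>
  define u where "u = (ln qmax + ln E / c) / b + 1"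
  define v where "v = 1 / (c * b)"
  define C where "C = real K * (nconst + 1 / l2) * (k / g) powr p * g powr p"
  show thesis
  proof (rule that)
    show "0 \<le> C"
      unfolding C_def using nconst_pos l2 by simp
    fix \<delta>' \<epsilon> :: real
    assume \<delta>': "0 < \<delta>'" "\<delta>' < 1" and \<epsilon>: "0 < \<epsilon>" "\<epsilon> \<le> 1" "\<epsilon> \<le> \<kappa>"
    define l where "l = logterm \<delta>'"
    have l: "l2 \<le> l" "0 < l"
      using logterm_ge[OF \<delta>'] logterm_pos[OF \<delta>'] by (auto simp: l_def l2_def)
    have El: "0 < E * l" using E l by simp
    \<comment> \<open>The threshold solves E * l * e1 powr c = 1.\<close>
    define e1 where "e1 = (E * l) powr (- 1 / c)"
    have e1: "0 < e1" using E l by (simp add: e1_def)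
    have e1_min: "e1 \<le> min 1 k"
    proof -
      have "min 1 k powr - c = (min 1 k powr - c / l2) * l2" using l2 by simp
      also have "\<dots> \<le> E * l"
        using E1 E2 E l l2 by (intro mult_mono) (auto simp: E_def)
      finally have "min 1 k powr - c \<le> E * l" .
      then have "(E * l) powr (- 1 / c) \<le> (min 1 k powr - c) powr (- 1 / c)"
        using k c by (intro powr_mono2') auto
      then show ?thesis using c k by (simp add: e1_def powr_powr)
    qed
    then have e1_le: "e1 \<le> 1" "e1 \<le> k" by auto
    have l_ge: "1 \<le> l / l2" using l l2 by simp
    have small: "2 * real K * real (nsamples \<delta>' (sqrt (\<kappa> * x))) * (sqrt (\<kappa> * x) / sqrt \<gamma>) powr - p
         \<le> (1 - sqrt \<gamma> powr p) * x powr - p" if x: "0 < x" "x < e1" for x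
    proof -
      have kx: "0 < k * x" using k x by simp
      have "real (nsamples \<delta>' (sqrt (k * x))) \<le> nconst * l / (sqrt (k * x))\<^sup>2 + 1"
        unfolding l_def using kx by (intro nsamples_le[OF \<delta>']) simp
      also have "(sqrt (k * x))\<^sup>2 = k * x" using kx by simp
      also have "1 \<le> l / l2 / x"
        using l_ge x e1_le by (subst pos_le_divide_eq[OF x(1)]) linarith
      also have "nconst * l / (k * x) + l / l2 / x = a1 * l / x"
        by (simp add: a1_def add_divide_distrib distrib_right)
      finally have N: "real (nsamples \<delta>' (sqrt (k * x))) \<le> a1 * l / x" by simp
      have split: "sqrt (k * x) / g = (sqrt k / g) * x powr (1 / 2)"
        using k x by (simp add: real_sqrt_mult powr_half_sqrt)
      have s: "(sqrt (k * x) / g) powr - p = B * x powr (- p / 2)"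
        unfolding split B_def using k g by (subst powr_mult) (simp_all add: powr_powr)
      have nn: "0 \<le> B * x powr (- p / 2)" using B by (intro mult_nonneg_nonneg) auto
      have "2 * real K * real (nsamples \<delta>' (sqrt (k * x))) \<le> 2 * real K * (a1 * l / x)"
        by (rule mult_left_mono[OF N]) (rule mult_nonneg_nonneg, rule zero_le_numeral, rule of_nat_0_le_iff)
      then have "2 * real K * real (nsamples \<delta>' (sqrt (k * x))) * (sqrt (k * x) / g) powr - p
          \<le> 2 * real K * (a1 * l / x) * (B * x powr (- p / 2))"
        by (simp only: s mult_right_mono[OF _ nn])
      also have "\<dots> = (2 * real K * a1 * B / (1 - g powr p)) * l * (1 - g powr p) * (x powr - 1 * x powr (- p / 2))"
      proof -
        have "2 * n * (a * l / x) * (b * y) = (2 * n * a * b / q) * l * q * (1 / x * y)" if "q \<noteq> 0" for n a b y q :: real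
          using that by simp
        moreover have "x powr - 1 = 1 / x" using x by (simp add: powr_minus_divide)
        moreover have "1 - g powr p \<noteq> 0" using gp by simp
        ultimately show ?thesis by (simp only:)
      qed
      \<comment> \<open>The gain x powr c over the critical exponent: - 1 - p / 2 = c - p for p = 2
        + 2 * c.\<close>
      also have "x powr - 1 * x powr (- p / 2) = x powr c * x powr - p"
      proof -
        have "- 1 + - p / 2 = c + - p" by (simp add: p_def field_simps)
        then show ?thesis by (simp only: powr_add[symmetric])
      qed
      also have "(2 * real K * a1 * B / (1 - g powr p)) * l * (1 - g powr p) * (x powr c * x powr - p)
         \<le> E * l * (1 - g powr p) * (x powr c * x powr - p)"
      proof (intro mult_right_mono)
        show "2 * real K * a1 * B / (1 - g powr p) \<le> E" using E2 by (simp add: E_def)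
      qed (use l gp in auto)
      also have "\<dots> = (E * l * x powr c) * ((1 - g powr p) * x powr - p)"
        by simp
      also have "\<dots> \<le> 1 * ((1 - g powr p) * x powr - p)"
      proof (rule mult_right_mono)
        have "x powr c \<le> e1 powr c" using x c by (intro powr_mono2) auto
        also have "e1 powr c = (E * l) powr - 1"
          using c by (simp add: e1_def powr_powr)
        also have "\<dots> = 1 / (E * l)"
          by (rule powr_neg_one[OF El])
        finally have "x powr c * (E * l) \<le> 1"
          by (simp only: pos_le_divide_eq[OF El])
        then show "E * l * x powr c \<le> 1"
          by (simp only: mult.commute)
      qed (use gp in simp)
      finally show ?thesis by (simp add: k_def g_def)
    qed
    define X where "X = 2 + real K * real (nsamples \<delta>' e1)"
    have X: "X \<le> exp (w + r * ln l)"
    proof -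
      have "1 \<le> (l / l2) powr r"
        using l_ge c by (intro ge_one_powr_ge_zero) (auto simp: r_def)
      then have "(2 + real K) * 1 \<le> (2 + real K) * (l / l2) powr r"
        by (intro mult_left_mono) auto
      then have *: "2 + real K \<le> (2 + real K) / l2 powr r * l powr r"
        using l l2 by (simp add: powr_divide)
      have "nconst * l / e1\<^sup>2 = nconst * E powr (2 / c) * l powr r"
      proof -
        have "e1\<^sup>2 = e1 powr 2" using e1 by (simp add: powr_numeral)
        also have "\<dots> = (E * l) powr - (2 / c)" by (simp add: e1_def powr_powr)
        finally have "1 / e1\<^sup>2 = (E * l) powr (2 / c)" using El by (simp add: powr_minus_divide)
        also have "\<dots> = E powr (2 / c) * l powr (2 / c)" using E l by (simp add: powr_mult)
        finally have "1 / e1\<^sup>2 = E powr (2 / c) * l powr (2 / c)" .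
        moreover have "l powr r = l * l powr (2 / c)" using l by (simp add: r_def powr_add)
        moreover have "nconst * l / e1\<^sup>2 = nconst * l * (1 / e1\<^sup>2)" by simp
        ultimately show ?thesis by (simp only: mult_ac)
      qed
      then have "real (nsamples \<delta>' e1) \<le> nconst * E powr (2 / c) * l powr r + 1"
        using nsamples_le[OF \<delta>' e1] by (simp add: l_def)
      then have "X \<le> 2 + real K * (nconst * E powr (2 / c) * l powr r + 1)"
        unfolding X_def by (intro add_left_mono mult_left_mono) auto
      also have "\<dots> = (2 + real K) + real K * nconst * E powr (2 / c) * l powr r"
        by (simp add: algebra_simps)
      also have "\<dots> \<le> ((2 + real K) / l2 powr r + real K * nconst * E powr (2 / c)) * l powr r"
        using * by (simp add: distrib_right)
      also have "\<dots> = exp (w + r * ln l)"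
      proof -
        have "0 < (2 + real K) / l2 powr r + real K * nconst * E powr (2 / c)"
          using l2 nconst_pos by (intro add_pos_nonneg divide_pos_pos) auto
        then show ?thesis using l by (simp add: w_def exp_add powr_def)
      qed
      finally show ?thesis .
    qed
    have X1: "1 \<le> X" by (simp add: X_def)
    \<comment> \<open>The upper bound on the depth may be multiplied only by a nonnegative number;
      this one is nonnegative because X \<ge> 1.\<close>
    have wr: "0 \<le> w + r * ln l"
    proof -
      have "1 \<le> exp (w + r * ln l)" using X1 X by linarith
      then show ?thesis by simp
    qed
    have depth: "real (depth e1) \<le> u + v * ln l"
    proof -
      have "1 \<le> qmax / e1" using qmax_ge_1 e1 e1_le(1) by (subst pos_le_divide_eq) linarith+
      then have nn: "0 \<le> ln (qmax / e1) / b" using b by simp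
      have "ln (qmax / e1) = ln qmax - ln e1"
        by (rule ln_divide_pos[OF qmax_pos e1])
      also have "ln e1 = - ((ln E + ln l) / c)"
        using E l by (simp add: e1_def ln_powr ln_mult)
      finally have ln_eq: "ln (qmax / e1) = ln qmax - - ((ln E + ln l) / c)" .
      have "(x - - ((y + z) / c)) / b + 1 = (x + y / c) / b + 1 + 1 / (c * b) * z" for x y z :: real
        by (simp add: add_divide_distrib diff_divide_distrib)
      then have "ln (qmax / e1) / b + 1 = u + v * ln l"
        unfolding ln_eq u_def v_def by (simp only:)
      moreover have "real (depth e1) \<le> ln (qmax / e1) / b + 1"
        unfolding depth_def g_def[symmetric] b_def[symmetric] using nn by linarith
      ultimately show ?thesis by linarith
    qed
    have Y: "X ^ depth e1 \<le> exp ((u + v * ln l) * (w + r * ln l))"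
    proof -
      have "X ^ depth e1 \<le> exp (w + r * ln l) ^ depth e1"
        using X X1 by (intro power_mono) auto
      also have "\<dots> = exp (real (depth e1) * (w + r * ln l))"
        by (simp add: exp_of_nat_mult)
      also have "\<dots> \<le> exp ((u + v * ln l) * (w + r * ln l))"
        using depth wr by (simp add: mult_right_mono)
      finally show ?thesis .
    qed
    have "1 + real (calls \<delta>' (\<epsilon> / sqrt \<gamma>)) \<le> (2 + real K * real (nsamples \<delta>' e1)) ^ depth e1 * (\<kappa> / sqrt \<gamma>) powr p * (\<epsilon> / sqrt \<gamma>) powr - p"
      using \<epsilon> sqrt_gamma e1_le
      by (intro calls_fine_bound[OF \<delta>' p e1 _ _ small] divide_right_mono divide_pos_pos) (auto simp: k_def)
    then have fine: "1 + real (calls \<delta>' (\<epsilon> / g)) \<le> X ^ depth e1 * ((k / g) powr p * (\<epsilon> / g) powr - p)"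
      by (simp add: X_def k_def g_def mult.assoc)
    have N: "real (nsamples \<delta>' \<epsilon>) \<le> (nconst + 1 / l2) * l * \<epsilon> powr - 2"
    proof -
      have "1 \<le> l / l2 / \<epsilon>\<^sup>2"
      proof (subst pos_le_divide_eq)
        show "1 * \<epsilon>\<^sup>2 \<le> l / l2"
          using l_ge \<epsilon> power_le_one[of \<epsilon> 2] by linarith
      qed (use \<epsilon> in simp)
      then have "real (nsamples \<delta>' \<epsilon>) \<le> nconst * l / \<epsilon>\<^sup>2 + l / l2 / \<epsilon>\<^sup>2"
        using nsamples_le[OF \<delta>' \<epsilon>(1)] by (simp add: l_def)
      also have "\<dots> = (nconst + 1 / l2) * l * (1 / \<epsilon>\<^sup>2)"
        by (simp add: add_divide_distrib distrib_right)
      also have "1 / \<epsilon>\<^sup>2 = \<epsilon> powr - 2"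
        using \<epsilon> by (simp add: powr_minus_divide powr_numeral)
      finally show ?thesis .
    qed
    have "real (calls_Q \<delta>' \<epsilon>) = real K * real (nsamples \<delta>' \<epsilon>) * (1 + real (calls \<delta>' (\<epsilon> / g)))"
      by (simp add: calls_Q_def g_def distrib_left)
    also have "\<dots> \<le> real K * ((nconst + 1 / l2) * l * \<epsilon> powr - 2) * (exp ((u + v * ln l) * (w + r * ln l)) * ((k / g) powr p * (\<epsilon> / g) powr - p))"
      using N nconst_pos l2 l
      by (intro mult_mono mult_nonneg_nonneg order_trans[OF fine] mult_right_mono[OF Y]) auto
    also have "(\<epsilon> / g) powr - p = g powr p * \<epsilon> powr - p"
      using \<epsilon> g by (simp add: powr_divide powr_minus field_simps)
    also have "real K * ((nconst + 1 / l2) * l * \<epsilon> powr - 2) * (exp ((u + v * ln l) * (w + r * ln l)) * ((k / g) powr p * (g powr p * \<epsilon> powr - p)))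
      = C * (l * exp ((u + v * ln l) * (w + r * ln l))) * (\<epsilon> powr - 2 * \<epsilon> powr - p)"
      by (simp only: C_def mult_ac)
    also have "\<epsilon> powr - 2 * \<epsilon> powr - p = \<epsilon> powr - (4 + 2 * c)"
      by (simp add: p_def flip: powr_add)
    finally show "real (calls_Q \<delta>' \<epsilon>) \<le> C * (logterm \<delta>' * exp ((u + v * ln (logterm \<delta>')) * (w + r * ln (logterm \<delta>')))) * \<epsilon> powr - (4 + 2 * c)"
      by (simp only: l_def)
  qed
qed

text \<open>The caps give a value below 1 and the required confidence; the last term is the largest
  \<delta>' that the bias bound tolerates. It attains the minimum for small \<epsilon>, so ln (1 /
  \<delta>') grows only like ln (1 / \<epsilon>).\<close>

definition delta_choice :: "real \<Rightarrow> real \<Rightarrow> real" where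
  "delta_choice \<epsilon> \<delta> = min (min (1 / 2) \<delta>) ((1 - sqrt \<gamma>) / (12 * vmax) * \<epsilon>)"

lemma vmax_pos: "0 < vmax"
  using qmax_le_vmax qmax_pos by linarith

lemma delta_scale_pos: "0 < (1 - sqrt \<gamma>) / (12 * vmax)"
  using sqrt_gamma vmax_pos by (intro divide_pos_pos) auto

lemma delta_choice_bounds:
  assumes "0 < \<epsilon>" "0 < \<delta>"
  shows "0 < delta_choice \<epsilon> \<delta>" "delta_choice \<epsilon> \<delta> < 1" "delta_choice \<epsilon> \<delta> \<le> \<delta>"
    and "12 * vmax * delta_choice \<epsilon> \<delta> \<le> (1 - sqrt \<gamma>) * \<epsilon>"
proof -
  show "0 < delta_choice \<epsilon> \<delta>"
    unfolding delta_choice_def using assms delta_scale_pos by (simp only: min_less_iff_conj mult_pos_pos) simp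
  show "delta_choice \<epsilon> \<delta> < 1" "delta_choice \<epsilon> \<delta> \<le> \<delta>"
    by (auto simp: delta_choice_def)
  have "12 * vmax * delta_choice \<epsilon> \<delta> \<le> 12 * vmax * ((1 - sqrt \<gamma>) / (12 * vmax) * \<epsilon>)"
    unfolding delta_choice_def using vmax_pos by (intro mult_left_mono) auto
  then show "12 * vmax * delta_choice \<epsilon> \<delta> \<le> (1 - sqrt \<gamma>) * \<epsilon>"
    using vmax_pos by simp
qed

lemma calls_Q_bigo:
  assumes "0 < \<delta>" "0 < c"
  shows "(\<lambda>\<epsilon>. real (calls_Q (delta_choice \<epsilon> \<delta>) \<epsilon>)) \<in> O[at_right 0](\<lambda>\<epsilon>. 1 / \<epsilon> powr (4 + c))"
proof -
  \<comment> \<open>Two of the three shares go to \<open>calls_Q_bound\<close>, the third to the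
    polylogarithmic factor.\<close>
  define c' where "c' = c / 3"
  have c': "0 < c'" using assms by (simp add: c'_def)
  obtain C u v w r where C: "0 \<le> C"
    and bound: "\<And>\<delta>' \<epsilon>. 0 < \<delta>' \<Longrightarrow> \<delta>' < 1 \<Longrightarrow> 0 < \<epsilon> \<Longrightarrow> \<epsilon> \<le> 1 \<Longrightarrow> \<epsilon> \<le> \<kappa> \<Longrightarrow>
      real (calls_Q \<delta>' \<epsilon>) \<le> C * (logterm \<delta>' * exp ((u + v * ln (logterm \<delta>')) * (w + r * ln (logterm \<delta>')))) * \<epsilon> powr - (4 + 2 * c')"
    using calls_Q_bound[OF c'] by blast
  define c0 where "c0 = (1 - sqrt \<gamma>) / (12 * vmax)"
  have c0: "0 < c0" unfolding c0_def by (rule delta_scale_pos)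
  define k where "k = 2 * real K / c0"
  have k: "0 < k" using c0 K_pos by (simp add: k_def)
  have small: "eventually (\<lambda>x. 0 < x \<and> x < y) (at_right 0)" if "0 < y" for y :: real
    using eventually_at_right_real[OF that] by simp
  have "eventually (\<lambda>\<epsilon>. 0 < \<epsilon> \<and> \<epsilon> < min (min 1 \<kappa>) (min (1 / 2) \<delta> / c0)) (at_right 0)"
  proof (rule small)
    have "0 < min (1 / 2) \<delta> / c0" using assms c0 by (intro divide_pos_pos) auto
    then show "0 < min (min 1 \<kappa>) (min (1 / 2) \<delta> / c0)"
      using kappa_pos by (simp only: min_less_iff_conj) simp
  qed
  moreover have "filterlim (\<lambda>\<epsilon>. ln (k / \<epsilon>)) at_top (at_right 0)"
    using k by real_asymp
  then have "eventually (\<lambda>\<epsilon>. ln (k / \<epsilon>) * exp ((u + v * ln (ln (k / \<epsilon>))) * (w + r * ln (ln (k / \<epsilon>)))) \<le> exp (c' * ln (k / \<epsilon>))) (at_right 0)"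
    by (rule eventually_compose_filterlim[OF polylog_subexponential[OF c']])
  ultimately have "eventually (\<lambda>\<epsilon>. norm (real (calls_Q (delta_choice \<epsilon> \<delta>) \<epsilon>)) \<le> C * k powr c' * norm (1 / \<epsilon> powr (4 + c))) (at_right 0)"
  proof eventually_elim
    case (elim \<epsilon>)
    then have \<epsilon>: "0 < \<epsilon>" "\<epsilon> \<le> 1" "\<epsilon> \<le> \<kappa>" and "\<epsilon> < min (1 / 2) \<delta> / c0" by auto
    then have "c0 * \<epsilon> \<le> min (1 / 2) \<delta>"
      using c0 by (simp only: pos_less_divide_eq mult.commute less_imp_le)
    then have dc: "delta_choice \<epsilon> \<delta> = c0 * \<epsilon>"
      unfolding delta_choice_def c0_def[symmetric] by simp
    have lt: "logterm (delta_choice \<epsilon> \<delta>) = ln (k / \<epsilon>)"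
      by (simp add: dc logterm_def k_def)
    have "real (calls_Q (delta_choice \<epsilon> \<delta>) \<epsilon>) \<le> C * (ln (k / \<epsilon>) * exp ((u + v * ln (ln (k / \<epsilon>))) * (w + r * ln (ln (k / \<epsilon>))))) * \<epsilon> powr - (4 + 2 * c')"
      unfolding lt[symmetric] by (rule bound[OF delta_choice_bounds(1,2)[OF \<epsilon>(1) assms(1)] \<epsilon>])
    also have "\<dots> \<le> C * exp (c' * ln (k / \<epsilon>)) * \<epsilon> powr - (4 + 2 * c')"
      using elim C by (intro mult_right_mono mult_left_mono) auto
    also have "exp (c' * ln (k / \<epsilon>)) = k powr c' * \<epsilon> powr - c'"
    proof -
      have "exp (c' * ln (k / \<epsilon>)) = exp (c' * ln k + - c' * ln \<epsilon>)"
        using k \<epsilon>(1) by (simp add: ln_div right_diff_distrib)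
      then show ?thesis
        using k \<epsilon>(1) by (simp only: exp_add) (simp add: powr_def)
    qed
    also have "C * (k powr c' * \<epsilon> powr - c') * \<epsilon> powr - (4 + 2 * c') = C * k powr c' * (\<epsilon> powr - c' * \<epsilon> powr - (4 + 2 * c'))"
      by (simp only: mult.assoc)
    also have "\<epsilon> powr - c' * \<epsilon> powr - (4 + 2 * c') = 1 / \<epsilon> powr (4 + c)"
    proof -
      have "- c' + - (4 + 2 * c') = - (4 + c)" by (simp add: c'_def)
      then show ?thesis by (simp only: powr_add[symmetric]) (rule powr_minus_divide)
    qed
    finally show ?case by simp
  qed
  then show ?thesis by (rule bigoI)
qed

end

theorem theorem2:
  fixes S :: "'s measure"
    and P :: "'s \<Rightarrow> 'a::finite \<Rightarrow> 's measure"
    and Rew :: "'s \<Rightarrow> 'a \<Rightarrow> real measure"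
    and Orc :: "'s \<Rightarrow> 'a \<Rightarrow> (real \<times> 's) measure"
    and Mini :: "'s set"
    and K :: nat
    and \<gamma> lam lo :: real
    and V :: "'s \<Rightarrow> real"
  assumes "regularized_game S P Rew Orc Mini K \<gamma> lam"
    and "regularized_game.value_function S P Rew Mini \<gamma> lam V"
    and "regularized_game.valid_floor S P Rew Mini K \<gamma> lam V lo"
  shows "\<exists>(\<delta>' :: real \<Rightarrow> real \<Rightarrow> real) (n :: real \<Rightarrow> real \<Rightarrow> nat).
      (\<forall>\<epsilon>>0. \<forall>d\<in>{0<..<1}. \<forall>s\<in>space S.
         AE x in regularized_game.smooth_cruiser Orc Mini K \<gamma> lam lo d \<epsilon> s. snd x = n \<epsilon> d) \<and>
      (\<forall>\<epsilon>>0. \<forall>\<delta>>0. \<delta>' \<epsilon> \<delta> \<in> {0<..<1} \<and>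
         (\<forall>s\<in>space S. \<P>(x in regularized_game.smooth_cruiser Orc Mini K \<gamma> lam lo (\<delta>' \<epsilon> \<delta>) \<epsilon> s. \<bar>fst x - V s\<bar> > \<epsilon>) \<le> \<delta>)) \<and>
      (\<forall>\<delta>>0. \<forall>c>0.
         (\<lambda>\<epsilon>. real (n \<epsilon> (\<delta>' \<epsilon> \<delta>))) \<in> O[at_right 0](\<lambda>\<epsilon>. 1 / \<epsilon> powr (4 + c)))"
proof -
  interpret regularized_game S P Rew Orc Mini K \<gamma> lam by fact
  note V = assms(2) and floor = assms(3)
  show ?thesis
  \<comment> \<open>One \<delta>' serves all states, and the count is exhibited for every d, not
    only for the chosen one.\<close>
  proof (intro exI[of _ delta_choice] exI[of _ "\<lambda>\<epsilon> d. calls_Q d \<epsilon>"] conjI allI impI ballI)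
    fix \<epsilon> d :: real and s
    assume "0 < \<epsilon>" "s \<in> space S"
    then show "AE x in smooth_cruiser lo d \<epsilon> s. snd x = calls_Q d \<epsilon>"
      by (rule smooth_cruiser_calls[OF floor_bounds[OF V floor]])
  next
    fix \<epsilon> \<delta> :: real
    assume pos: "0 < \<epsilon>" "0 < \<delta>"
    note bounds = delta_choice_bounds[OF pos]
    show "delta_choice \<epsilon> \<delta> \<in> {0<..<1}"
      using bounds by simp
    fix s assume s: "s \<in> space S"
    show "\<P>(x in smooth_cruiser lo (delta_choice \<epsilon> \<delta>) \<epsilon> s. \<bar>fst x - V s\<bar> > \<epsilon>) \<le> \<delta>"
      by (rule order_trans[OF smooth_cruiser_accuracy[OF V floor bounds(1,2) pos(1) bounds(4) s] bounds(3)])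
  next
    fix \<delta> c :: real assume "0 < \<delta>" "0 < c"
    then show "(\<lambda>\<epsilon>. real (calls_Q (delta_choice \<epsilon> \<delta>) \<epsilon>)) \<in> O[at_right 0](\<lambda>\<epsilon>. 1 / \<epsilon> powr (4 + c))"
      by (rule calls_Q_bigo)
  qed
qed

end
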